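(* Let $k$ be a field complete with respect to a non-archimedean absolute value $|\cdot|$, with valuation ring $\mathfrak o_k$. Let $\mathscr A$ be a finitely generated $\mathfrak o_k$-algebra containing $\mathfrak o_k$ as a subring, and $A:=\mathscr A\otimes_{\mathfrak o_k}k$. Let $\operatorname{Spec}(A)^{\mathrm{an}}_{\mathscr A}$ be the set of points $x$ of the Berkovich analytification $\operatorname{Spec}(A)^{\mathrm{an}}$ (multiplicative seminorms $|\cdot|_x$ on $A$ extending $|\cdot|$) such that $|a|_x\leq1$ for all $a\in\mathscr A$. Then $\{\alpha\in A\mid \alpha\text{ is integral over }\mathscr A\}=\bigcap_{x\in\operatorname{Spec}(A)^{\mathrm{an}}_{\mathscr A}}\{\alpha\in A\mid |\alpha|_x\leq1\}.$ *)

theory Defs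
  imports Complex_Main
begin

definition nonarch_abs :: "('k::field \<Rightarrow> real) \<Rightarrow> bool" where
  "nonarch_abs v \<longleftrightarrow>
     (\<forall>x. v x \<ge> 0) \<and> (\<forall>x. v x = 0 \<longleftrightarrow> x = 0) \<and>
     (\<forall>x y. v (x * y) = v x * v y) \<and>
     (\<forall>x y. v (x + y) \<le> max (v x) (v y))"

definition complete_abs :: "('k::field \<Rightarrow> real) \<Rightarrow> bool" where
  "complete_abs v \<longleftrightarrow>
     (\<forall>X :: nat \<Rightarrow> 'k.
        (\<forall>e>0. \<exists>N. \<forall>m\<ge>N. \<forall>n\<ge>N. v (X m - X n) < e) \<longrightarrow>
        (\<exists>L. \<forall>e>0. \<exists>N. \<forall>n\<ge>N. v (X n - L) < e))"

definition valring :: "('k::field \<Rightarrow> real) \<Rightarrow> 'k set" where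
  "valring v = {c. v c \<le> 1}"

definition subring_embedding :: "'k::field set \<Rightarrow> ('k \<Rightarrow> 'a::comm_ring_1) \<Rightarrow> bool" where
  "subring_embedding Ok j \<longleftrightarrow>
     inj_on j Ok \<and> j 1 = 1 \<and>
     (\<forall>x\<in>Ok. \<forall>y\<in>Ok. j (x + y) = j x + j y \<and> j (x * y) = j x * j y)"

inductive_set gen_alg :: "'k set \<Rightarrow> ('k \<Rightarrow> 'a::comm_ring_1) \<Rightarrow> 'a set \<Rightarrow> 'a set"
  for Ok j G where
  scal: "c \<in> Ok \<Longrightarrow> j c \<in> gen_alg Ok j G"
| gen: "g \<in> G \<Longrightarrow> g \<in> gen_alg Ok j G"
| add: "a \<in> gen_alg Ok j G \<Longrightarrow> b \<in> gen_alg Ok j G \<Longrightarrow> a + b \<in> gen_alg Ok j G"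
| mult: "a \<in> gen_alg Ok j G \<Longrightarrow> b \<in> gen_alg Ok j G \<Longrightarrow> a * b \<in> gen_alg Ok j G"

definition fin_gen_alg :: "'k set \<Rightarrow> ('k \<Rightarrow> 'a::comm_ring_1) \<Rightarrow> bool" where
  "fin_gen_alg Ok j \<longleftrightarrow> (\<exists>G. finite G \<and> gen_alg Ok j G = UNIV)"

definition ring_hom_fun :: "('a::comm_ring_1 \<Rightarrow> 'b::comm_ring_1) \<Rightarrow> bool" where
  "ring_hom_fun f \<longleftrightarrow> f 1 = 1 \<and> (\<forall>x y. f (x + y) = f x + f y \<and> f (x * y) = f x * f y)"

text \<open>(B, \<iota>, \<phi>) is the base change \<A> \<otimes>_{o_k} k, characterised as the
  localisation of \<A> at the nonzero elements of o_k (since k = Frac(o_k)):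
  \<iota> : k \<rightarrow> B makes B a k-algebra, \<phi> : \<A> \<rightarrow> B is compatible on o_k,
  every element is \<phi>(a)/s and the kernel of \<phi> is the o_k-torsion.\<close>
definition base_change_field ::
  "'k::field set \<Rightarrow> ('k \<Rightarrow> 'a::comm_ring_1) \<Rightarrow> ('k \<Rightarrow> 'b::comm_ring_1) \<Rightarrow> ('a \<Rightarrow> 'b) \<Rightarrow> bool" where
  "base_change_field Ok j \<iota> \<phi> \<longleftrightarrow>
     ring_hom_fun \<iota> \<and> ring_hom_fun \<phi> \<and>
     (\<forall>c\<in>Ok. \<phi> (j c) = \<iota> c) \<and>
     (\<forall>b. \<exists>a. \<exists>s\<in>Ok. s \<noteq> 0 \<and> \<iota> s * b = \<phi> a) \<and>
     (\<forall>a. \<phi> a = 0 \<longleftrightarrow> (\<exists>s\<in>Ok. s \<noteq> 0 \<and> j s * a = 0))"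

definition mult_seminorm :: "('b::comm_ring_1 \<Rightarrow> real) \<Rightarrow> bool" where
  "mult_seminorm f \<longleftrightarrow>
     (\<forall>x. f x \<ge> 0) \<and> f 0 = 0 \<and>
     (\<forall>x y. f (x + y) \<le> f x + f y) \<and> (\<forall>x y. f (x * y) = f x * f y)"

definition berk_an :: "('k::field \<Rightarrow> real) \<Rightarrow> ('k \<Rightarrow> 'b::comm_ring_1) \<Rightarrow> ('b \<Rightarrow> real) set" where
  "berk_an v \<iota> = {f. mult_seminorm f \<and> (\<forall>c. f (\<iota> c) = v c)}"

definition berk_an_model ::
  "('k::field \<Rightarrow> real) \<Rightarrow> ('k \<Rightarrow> 'b::comm_ring_1) \<Rightarrow> ('a::comm_ring_1 \<Rightarrow> 'b) \<Rightarrow> ('b \<Rightarrow> real) set" where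
  "berk_an_model v \<iota> \<phi> = {x \<in> berk_an v \<iota>. \<forall>a. x (\<phi> a) \<le> 1}"

definition integral_over :: "'b::comm_ring_1 set \<Rightarrow> 'b \<Rightarrow> bool" where
  "integral_over S \<alpha> \<longleftrightarrow>
     (\<exists>n c. (\<forall>i<n. c i \<in> S) \<and> \<alpha> ^ n + (\<Sum>i<n. c i * \<alpha> ^ i) = 0)"

end

theory Submission
  imports Defs "HOL-Algebra.Algebraic_Closure_Type" "HOL-Library.Poly_Mapping"
    "HOL-Computational_Algebra.Fraction_Field"
begin

text \<open>
  Let \<open>\<alpha>\<close> be non-integral over the image \<open>R\<close> of \<open>\<phi>\<close>. Dividing by an ideal maximal among those modulo which \<open>\<alpha>\<close> stays
  non-integral, which is prime, one may take \<open>R\<close> inside a field. Integrality over \<open>R\<close> is then detected by a family of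
  valuation rings \<open>V \<supseteq> R\<close> that is small enough for every element \<open>a\<close> to have one exponent \<open>M\<close> with \<open>a ^ M \<in> \<pi> V\<close>
  for all \<open>V\<close> of the family in which \<open>a\<close> is a non-unit. For a polynomial ring over the ring of integers
  these are the extensions of the Gauss valuation: the minimal polynomial of an element integral over \<open>R[1/\<pi>]\<close> and over the Gauss
  valuation ring has its coefficients in the normal ring \<open>R\<close>. In general Nagata's substitution gives \<open>R = T[x]\<close> with fewer
  generators for \<open>T\<close> and an \<open>a\<close>, invertible on the special fibre of \<open>R\<close>, such that \<open>a\<close> and \<open>a * x\<close> are integral over \<open>T\<close>.
  The family for \<open>R\<close> consists of the members for \<open>T\<close> that contain \<open>x\<close>; into all the others
  an element is multiplied by a single power of \<open>a\<close>. Finally, a member \<open>V\<close> not containing \<open>\<alpha>\<close> defines a real-valued seminorm,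
  which exceeds \<open>1\<close> at \<open>\<alpha>\<close> because \<open>1 / \<alpha> ^ M \<in> \<pi> V\<close>.
\<close>

text \<open>A single valuation ring \<open>V\<close> containing \<open>R\<close> but not \<alpha>
  does not suffice: \<open>V\<close> may have rank greater than one, and \<alpha> may exceed the
  units of \<open>V\<close> only infinitesimally, so that the real-valued seminorm attached to
  \<open>V\<close> is 1 at \<alpha>. Over a Noetherian base discrete valuations would help, but the
  ring of integers of k is in general not Noetherian. The exponent \<open>M\<close> replaces them:
  since 1/\<alpha> to the power \<open>M\<close> is divisible by \<pi>, the seminorm at \<alpha> is
  at least the \<open>M\<close>-th root of 1/|\<pi>|. Uniformity over the family is what carries the
  induction on generators, because in passing from \<open>T\<close> to \<open>T[x]\<close> one power
  of \<open>a\<close> has to work for infinitely many \<open>V\<close> at once. Here \<pi> is a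
  denominator of \<alpha>, so integrality is tested only on elements that become integral after
  multiplication by a power of \<pi>. Everything takes place inside one algebraically closed field,
  the closure of a rational function field over k in countably many variables, which receives every
  residue ring that occurs.\<close>

instance alg_closure :: (field) field_gcd ..

section \<open>Subrings and integrality\<close>

definition is_subring :: "'a::comm_ring_1 set \<Rightarrow> bool" where
  "is_subring S \<longleftrightarrow> 1 \<in> S \<and> (\<forall>x\<in>S. \<forall>y\<in>S. x - y \<in> S \<and> x * y \<in> S)"

context
  fixes S :: "'a::comm_ring_1 set"
  assumes S: "is_subring S"
begin

lemma subring_one: "1 \<in> S"
  using S by (simp add: is_subring_def)

lemma subring_diff: "x \<in> S \<Longrightarrow> y \<in> S \<Longrightarrow> x - y \<in> S"
  using S by (simp add: is_subring_def)

lemma subring_mult: "x \<in> S \<Longrightarrow> y \<in> S \<Longrightarrow> x * y \<in> S"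
  using S by (simp add: is_subring_def)

lemma subring_zero: "0 \<in> S"
  using subring_diff[OF subring_one subring_one] by simp

lemma subring_uminus: "x \<in> S \<Longrightarrow> - x \<in> S"
  using subring_diff[OF subring_zero, of x] by simp

lemma subring_add: "x \<in> S \<Longrightarrow> y \<in> S \<Longrightarrow> x + y \<in> S"
  using subring_diff[OF _ subring_uminus, of x y] by simp

lemma subring_power: "x \<in> S \<Longrightarrow> x ^ n \<in> S"
  by (induction n) (auto intro: subring_one subring_mult)

lemma subring_sum: "(\<And>i. i \<in> I \<Longrightarrow> f i \<in> S) \<Longrightarrow> sum f I \<in> S"
  by (induction I rule: infinite_finite_induct) (auto intro: subring_zero subring_add)

end

lemmas subring_intros = subring_one subring_diff subring_mult subring_zero subring_uminus
  subring_add subring_power subring_sum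

lemma is_subring_Inter:
  assumes "\<And>S. S \<in> \<S> \<Longrightarrow> is_subring S"
  shows "is_subring (\<Inter>\<S>)"
  using assms unfolding is_subring_def by blast

lemma is_subring_Union_chain:
  assumes "\<C> \<noteq> {}" "subset.chain \<A> \<C>" "\<And>S. S \<in> \<C> \<Longrightarrow> is_subring S"
  shows "is_subring (\<Union>\<C>)"
proof -
  have "x - y \<in> \<Union>\<C> \<and> x * y \<in> \<Union>\<C>" if xy: "x \<in> \<Union>\<C>" "y \<in> \<Union>\<C>" for x y
  proof -
    obtain U Y where XY: "U \<in> \<C>" "x \<in> U" "Y \<in> \<C>" "y \<in> Y" using xy by blast
    have "U \<subseteq> Y \<or> Y \<subseteq> U" using assms(2) XY unfolding subset.chain_def by blast
    then obtain Z where "Z \<in> \<C>" "x \<in> Z" "y \<in> Z" using XY by blast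
    then show ?thesis using assms(3)[of Z] unfolding is_subring_def by blast
  qed
  moreover have "1 \<in> \<Union>\<C>" using assms(1,3) unfolding is_subring_def by blast
  ultimately show ?thesis unfolding is_subring_def by blast
qed

definition ring_hull :: "'a::comm_ring_1 set \<Rightarrow> 'a set" where
  "ring_hull E = \<Inter>{S. is_subring S \<and> E \<subseteq> S}"

lemma is_subring_ring_hull: "is_subring (ring_hull E)"
  unfolding ring_hull_def by (rule is_subring_Inter) auto

lemma ring_hull_superset: "E \<subseteq> ring_hull E"
  unfolding ring_hull_def by blast

lemma ring_hull_minimal: "is_subring S \<Longrightarrow> E \<subseteq> S \<Longrightarrow> ring_hull E \<subseteq> S"
  unfolding ring_hull_def by blast

lemma ring_hull_mono: "E \<subseteq> F \<Longrightarrow> ring_hull E \<subseteq> ring_hull F"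
  unfolding ring_hull_def by blast

lemma ring_hom_fun_simps:
  assumes "ring_hom_fun f"
  shows "f 1 = 1" "f (x + y) = f x + f y" "f (x * y) = f x * f y" "f 0 = 0" "f (x - y) = f x - f y" "f (x ^ n) = f x ^ n"
    "f (sum g S) = (\<Sum>i\<in>S. f (g i))"
proof -
  show *: "f 1 = 1" "f (x + y) = f x + f y" "f (x * y) = f x * f y" for x y
    using assms by (auto simp: ring_hom_fun_def)
  show d: "f (x - y) = f x - f y" for x y using *(2)[of "x - y" y] by (simp add: algebra_simps)
  show z: "f 0 = 0" using d[of 0 0] by simp
  show "f (x ^ n) = f x ^ n" by (induction n) (auto simp: *)
  show "f (sum g S) = (\<Sum>i\<in>S. f (g i))" by (induction S rule: infinite_finite_induct) (auto simp: * z)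
qed

lemma is_subring_image:
  assumes f: "ring_hom_fun f" and S: "is_subring S" shows "is_subring (f ` S)"
  unfolding is_subring_def
proof (intro conjI ballI)
  note I = subring_intros[OF S] and h = ring_hom_fun_simps[OF f]
  show "1 \<in> f ` S" using I(1) h(1) by force
  fix x y assume "x \<in> f ` S" "y \<in> f ` S"
  then obtain a b where ab: "x = f a" "y = f b" "a \<in> S" "b \<in> S" by blast
  then show "x - y \<in> f ` S" "x * y \<in> f ` S"
    using I(2,3)[of a b] by (simp_all add: h(3,5)[symmetric])
qed

lemma is_subring_UNIV: "is_subring UNIV"
  by (simp add: is_subring_def)

definition polys_over :: "'a::comm_ring_1 set \<Rightarrow> 'a poly set" where
  "polys_over A = {p. \<forall>i. coeff p i \<in> A}"

lemma polys_overI: "(\<And>i. coeff p i \<in> A) \<Longrightarrow> p \<in> polys_over A"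
  by (simp add: polys_over_def)

lemma polys_overD: "p \<in> polys_over A \<Longrightarrow> coeff p i \<in> A"
  by (simp add: polys_over_def)

lemma polys_over_mono: "A \<subseteq> B \<Longrightarrow> polys_over A \<subseteq> polys_over B"
  by (auto simp: polys_over_def)

lemma subring_polys_over:
  assumes "is_subring A" shows "is_subring (polys_over A)"
  unfolding is_subring_def
  by (auto intro!: polys_overI subring_intros[OF assms] dest: polys_overD simp: coeff_mult coeff_1)

lemma monom_in_polys_over: "0 \<in> A \<Longrightarrow> c \<in> A \<Longrightarrow> monom c n \<in> polys_over A"
  by (simp add: polys_over_def)

lemma smult_in_polys_over: "is_subring A \<Longrightarrow> c \<in> A \<Longrightarrow> p \<in> polys_over A \<Longrightarrow> smult c p \<in> polys_over A"
  by (simp add: polys_over_def subring_mult)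

lemma pCons_in_polys_over: "c \<in> A \<Longrightarrow> p \<in> polys_over A \<Longrightarrow> pCons c p \<in> polys_over A"
  by (auto simp: polys_over_def coeff_pCons split: nat.splits)

lemma poly_in_subring:
  assumes "is_subring S" "p \<in> polys_over S" "y \<in> S"
  shows "poly p y \<in> S"
  unfolding poly_altdef using assms by (auto intro!: subring_intros[OF assms(1)] dest: polys_overD)

definition adjoin :: "'a::comm_ring_1 set \<Rightarrow> 'a \<Rightarrow> 'a set" where
  "adjoin A y = (\<lambda>p. poly p y) ` polys_over A"

lemma adjoinE:
  assumes "z \<in> adjoin A y" obtains p where "p \<in> polys_over A" "z = poly p y"
  using assms unfolding adjoin_def by blast

lemma is_subring_adjoin:
  assumes "is_subring A" shows "is_subring (adjoin A y)"
  unfolding is_subring_def adjoin_def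
proof (safe)
  note P = subring_intros[OF subring_polys_over[OF assms]]
  show "1 \<in> (\<lambda>p. poly p y) ` polys_over A" using P(1) by (metis image_eqI poly_1)
  fix p q assume "p \<in> polys_over A" "q \<in> polys_over A"
  then show "poly p y - poly q y \<in> (\<lambda>p. poly p y) ` polys_over A"
    "poly p y * poly q y \<in> (\<lambda>p. poly p y) ` polys_over A"
    using P by (metis image_eqI poly_diff, metis image_eqI poly_mult)
qed

lemma subset_adjoin: "is_subring A \<Longrightarrow> A \<subseteq> adjoin A y"
  unfolding adjoin_def
  by (rule subsetI, rule_tac x = "[:x:]" in image_eqI) (auto simp: polys_over_def subring_zero coeff_pCons split: nat.splits)

lemma adjoin_self: "is_subring A \<Longrightarrow> y \<in> adjoin A y"
  unfolding adjoin_def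
  by (rule image_eqI[of _ _ "monom 1 1"]) (auto simp: poly_monom intro!: monom_in_polys_over subring_intros)

lemma adjoin_minimal:
  assumes "is_subring S" "A \<subseteq> S" "y \<in> S" shows "adjoin A y \<subseteq> S"
  using assms poly_in_subring polys_over_mono unfolding adjoin_def by blast

lemma adjoin_ring_hull: "adjoin (ring_hull E) y = ring_hull (insert y E)"
proof
  show "adjoin (ring_hull E) y \<subseteq> ring_hull (insert y E)"
    using ring_hull_superset[of "insert y E"]
    by (intro adjoin_minimal is_subring_ring_hull ring_hull_mono) auto
  show "ring_hull (insert y E) \<subseteq> adjoin (ring_hull E) y"
    using ring_hull_superset[of E] subset_adjoin[OF is_subring_ring_hull, of E y]
      adjoin_self[OF is_subring_ring_hull, of y E]
    by (intro ring_hull_minimal is_subring_adjoin is_subring_ring_hull) auto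
qed

lemma monic_poly_of_relation:
  assumes A: "is_subring A" and c: "\<forall>i<n. c i \<in> A"
  shows "\<exists>p\<in>polys_over A. lead_coeff p = 1 \<and> (\<forall>z. poly p z = z ^ n + (\<Sum>i<n. c i * z ^ i))"
proof -
  define p where "p = monom 1 n + (\<Sum>i<n. monom (c i) i)"
  have cp: "coeff p i = (if i = n then 1 else if i < n then c i else 0)" for i
    by (auto simp: p_def coeff_sum sum.delta')
  have deg: "degree p = n"
    by (rule antisym) (auto intro!: degree_le le_degree simp: cp)
  have "p \<in> polys_over A"
    by (rule polys_overI) (auto simp: cp c intro: subring_intros[OF A])
  moreover have "lead_coeff p = 1" using deg cp by simp
  moreover have "poly p z = z ^ n + (\<Sum>i<n. c i * z ^ i)" for z by (simp add: p_def poly_sum poly_monom)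
  ultimately show ?thesis by blast
qed

lemma integral_over_iff_monic:
  assumes A: "is_subring A"
  shows "integral_over A z \<longleftrightarrow> (\<exists>p\<in>polys_over A. lead_coeff p = 1 \<and> poly p z = 0)"
proof
  assume "integral_over A z"
  then obtain n c where c: "\<forall>i<n. c i \<in> A" and eq: "z ^ n + (\<Sum>i<n. c i * z ^ i) = 0"
    unfolding integral_over_def by blast
  obtain p where "p \<in> polys_over A" "lead_coeff p = 1" "poly p z = z ^ n + (\<Sum>i<n. c i * z ^ i)"
    using monic_poly_of_relation[OF A c] by blast
  then show "\<exists>p\<in>polys_over A. lead_coeff p = 1 \<and> poly p z = 0" using eq by (intro bexI[of _ p]) simp_all
next
  assume "\<exists>p\<in>polys_over A. lead_coeff p = 1 \<and> poly p z = 0"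
  then obtain p where p: "p \<in> polys_over A" "lead_coeff p = 1" "poly p z = 0" by blast
  have "z ^ degree p + (\<Sum>i<degree p. coeff p i * z ^ i) = poly p z"
    using p(2) by (simp add: poly_altdef lessThan_Suc_atMost[symmetric] add.commute)
  then show "integral_over A z"
    using p polys_overD unfolding integral_over_def by metis
qed

lemma integral_over_mono: "integral_over A z \<Longrightarrow> A \<subseteq> B \<Longrightarrow> integral_over B z"
  unfolding integral_over_def by blast

lemma integral_over_mem:
  assumes "is_subring A" "z \<in> A" shows "integral_over A z"
  unfolding integral_over_def
  by (rule exI[of _ 1], rule exI[of _ "\<lambda>_. - z"]) (use assms in \<open>auto intro: subring_uminus\<close>)

section \<open>Valuation rings of a field\<close>

definition valuation_ring :: "'c::field set \<Rightarrow> bool" where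
  "valuation_ring V \<longleftrightarrow> is_subring V \<and> (\<forall>z. z \<in> V \<or> inverse z \<in> V)"

text \<open>Membership in \<open>V\<close> is not part of the formula; for a valuation ring it
  follows, since one of \<open>z\<close> and \<open>inverse z\<close> always lies in
  \<open>V\<close>.\<close>

definition max_ideal :: "'c::field set \<Rightarrow> 'c set" where
  "max_ideal V = {z. z = 0 \<or> inverse z \<notin> V}"

lemma vr_subring: "valuation_ring V \<Longrightarrow> is_subring V"
  by (simp add: valuation_ring_def)

context
  fixes V :: "'c::field set"
  assumes V: "valuation_ring V"
begin

lemmas vr_intros = subring_intros[OF vr_subring[OF V]]

lemma vr_inverse: "z \<notin> V \<Longrightarrow> inverse z \<in> V"
  using V by (auto simp: valuation_ring_def)

lemma max_ideal_subset: "z \<in> max_ideal V \<Longrightarrow> z \<in> V"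
  using vr_inverse[of z] vr_intros(4) by (auto simp: max_ideal_def)

lemma zero_max_ideal: "0 \<in> max_ideal V"
  by (simp add: max_ideal_def)

lemma one_not_max_ideal: "1 \<notin> max_ideal V"
  using vr_intros(1) by (simp add: max_ideal_def)

lemma max_ideal_mult: "x \<in> max_ideal V \<Longrightarrow> y \<in> V \<Longrightarrow> x * y \<in> max_ideal V"
  using vr_intros(3)[of "inverse (x * y)" y] by (auto simp: max_ideal_def field_simps)

text \<open>One of the quotients \<open>x / y\<close>, \<open>y / x\<close> lies in
  \<open>V\<close>, so the sum is one of the summands times an element of \<open>V\<close>.\<close>

lemma max_ideal_add:
  assumes "x \<in> max_ideal V" "y \<in> max_ideal V" shows "x + y \<in> max_ideal V"
proof (cases "x = 0 \<or> y = 0")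
  case False
  then have nz: "x \<noteq> 0" "y \<noteq> 0" by auto
  consider "x / y \<in> V" | "y / x \<in> V" using vr_inverse[of "x / y"] by (auto simp: field_simps)
  then show ?thesis
  proof cases
    case 1
    have "y * (1 + x / y) \<in> max_ideal V"
      by (rule max_ideal_mult[OF assms(2)]) (intro vr_intros 1)
    then show ?thesis using nz by (simp add: distrib_left add.commute)
  next
    case 2
    have "x * (1 + y / x) \<in> max_ideal V"
      by (rule max_ideal_mult[OF assms(1)]) (intro vr_intros 2)
    then show ?thesis using nz by (simp add: distrib_left)
  qed
qed (use assms in auto)

lemma max_ideal_sum: "(\<And>i. i \<in> I \<Longrightarrow> f i \<in> max_ideal V) \<Longrightarrow> sum f I \<in> max_ideal V"
  by (induction I rule: infinite_finite_induct) (auto intro: zero_max_ideal max_ideal_add)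

lemma max_ideal_uminus: "x \<in> max_ideal V \<Longrightarrow> - x \<in> max_ideal V"
  using max_ideal_mult[of x "-1"] vr_intros(1) vr_intros(5) by auto

lemma unit_iff: "z \<in> V \<Longrightarrow> z \<notin> max_ideal V \<longleftrightarrow> z \<noteq> 0 \<and> inverse z \<in> V"
  by (auto simp: max_ideal_def)

lemma max_ideal_prime: "x \<in> V \<Longrightarrow> y \<in> V \<Longrightarrow> x \<notin> max_ideal V \<Longrightarrow> y \<notin> max_ideal V \<Longrightarrow> x * y \<notin> max_ideal V"
  by (auto simp: max_ideal_def intro: vr_intros)

lemma max_ideal_power: "x ^ n \<in> max_ideal V \<Longrightarrow> x \<in> V \<Longrightarrow> x \<in> max_ideal V"
  by (induction n) (use one_not_max_ideal max_ideal_prime vr_intros(7) in auto)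

lemma not_in_iff: "z \<notin> V \<longleftrightarrow> z \<noteq> 0 \<and> inverse z \<in> max_ideal V"
  using vr_intros(4) by (auto simp: max_ideal_def)

text \<open>Dividing a monic equation of degree \<open>n\<close> by \<open>z ^ n\<close> expresses 1
  through positive powers of \<open>inverse z\<close>, which would lie in the maximal ideal if
  \<open>z\<close> were outside \<open>V\<close>.\<close>

lemma integral_over_vr:
  assumes "integral_over V z" shows "z \<in> V"
proof (rule ccontr)
  assume z: "z \<notin> V"
  then have nz: "z \<noteq> 0" and u: "inverse z \<in> max_ideal V" using not_in_iff by auto
  obtain n c where c: "\<forall>i<n. c i \<in> V" and eq: "z ^ n + (\<Sum>i<n. c i * z ^ i) = 0"
    using assms unfolding integral_over_def by blast
  have "0 = (z ^ n + (\<Sum>i<n. c i * z ^ i)) * inverse z ^ n" using eq by simp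
  also have "\<dots> = 1 + (\<Sum>i<n. c i * inverse z ^ (n - i))"
    unfolding distrib_right sum_distrib_right using nz
    by (intro arg_cong2[of _ _ _ _ "(+)"] sum.cong) (auto simp: field_simps power_diff)
  finally have "1 = - (\<Sum>i<n. c i * inverse z ^ (n - i))" by (metis add.commute add_eq_0_iff)
  moreover have "(\<Sum>i<n. c i * inverse z ^ (n - i)) \<in> max_ideal V"
  proof (rule max_ideal_sum)
    fix i assume i: "i \<in> {..<n}"
    then have "inverse z * (inverse z ^ (n - i - 1) * c i) \<in> max_ideal V"
      using c by (intro max_ideal_mult u vr_intros max_ideal_subset[OF u]) auto
    moreover have "inverse z * inverse z ^ (n - i - 1) = inverse z ^ (n - i)"
      using i by (subst power_Suc[symmetric]) (simp add: Suc_diff_Suc)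
    ultimately show "c i * inverse z ^ (n - i) \<in> max_ideal V"
      by (metis mult.assoc mult.commute)
  qed
  ultimately show False using one_not_max_ideal max_ideal_uminus by force
qed

end

text \<open>The shortening step of Chevalley's extension theorem. The expression of \<open>z\<close>
  in \<open>inverse u\<close>, multiplied by \<open>w\<close>, writes the unit
  \<open>1 - w * b 0\<close> through negative powers of \<open>u\<close> alone. Divided by this unit
  and multiplied by \<open>a n * u ^ n\<close>, it replaces the top term of the expression in
  \<open>u\<close> by lower ones; \<open>m \<le> n\<close> keeps the exponents nonnegative.\<close>

lemma chevalley_descent:
  fixes u z w :: "'c::field"
  assumes M: "is_subring M" and zw: "z * w = 1" and w: "w \<in> M" and zM: "z \<notin> M"
    and unit: "\<And>c. c \<in> M \<Longrightarrow> 1 - w * c \<noteq> 0 \<and> inverse (1 - w * c) \<in> M"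
    and u: "u \<noteq> 0"
    and a: "\<forall>i\<le>n. a i \<in> M" "z = (\<Sum>i\<le>n. a i * u ^ i)"
    and b: "\<forall>i\<le>m. b i \<in> M" "z = (\<Sum>i\<le>m. b i * inverse u ^ i)"
    and mn: "m \<le> n"
  shows "n > 0 \<and> (\<exists>a'. (\<forall>i\<le>n-1. a' i \<in> M) \<and> z = (\<Sum>i\<le>n-1. a' i * u ^ i))"
proof -
  note I = subring_intros[OF M]
  have m0: "m > 0"
  proof (rule ccontr)
    assume "\<not> m > 0" then show False using b zM by simp
  qed
  define e where "e = 1 - w * b 0"
  have e: "e \<noteq> 0" "inverse e \<in> M" using unit[of "b 0"] b(1) by (auto simp: e_def)
  define d where "d i = inverse e * w * b i * a n" for i
  have dM: "i \<le> m \<Longrightarrow> d i \<in> M" for i using a b e w by (auto simp: d_def intro!: I)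
  have "z = b 0 + (\<Sum>i=1..m. b i * inverse u ^ i)"
    unfolding b(2) by (subst atMost_atLeast0, subst sum.atLeast_Suc_atMost) auto
  then have "z * w = w * b 0 + w * (\<Sum>i=1..m. b i * inverse u ^ i)" by (metis distrib_left mult.commute)
  then have "e = w * (\<Sum>i=1..m. b i * inverse u ^ i)" using zw by (simp add: e_def algebra_simps)
  then have "1 = inverse e * w * (\<Sum>i=1..m. b i * inverse u ^ i)"
    using e by (simp add: field_simps)
  then have "a n * u ^ n = a n * u ^ n * (inverse e * w * (\<Sum>i=1..m. b i * inverse u ^ i))" by simp
  also have "\<dots> = (\<Sum>i=1..m. d i * u ^ (n - i))"
    unfolding sum_distrib_left using u mn
    by (intro sum.cong) (auto simp: d_def power_diff field_simps)
  also have "\<dots> = (\<Sum>j\<in>{n-m..n-1}. d (n - j) * u ^ j)"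
    by (rule sum.reindex_bij_witness[of _ "\<lambda>j. n - j" "\<lambda>i. n - i"]) (use mn m0 in auto)
  also have "\<dots> = (\<Sum>j\<le>n-1. (if n - m \<le> j then d (n - j) else 0) * u ^ j)"
    by (rule sum.mono_neutral_cong_left) auto
  finally have an: "a n * u ^ n = \<dots>" .
  have n0: "n > 0" using m0 mn by simp
  have "z = (\<Sum>i\<le>n-1. a i * u ^ i) + a n * u ^ n"
    using a(2) n0 by (cases n) auto
  then have "z = (\<Sum>i\<le>n-1. (a i + (if n - m \<le> i then d (n - i) else 0)) * u ^ i)"
    unfolding an by (simp only: ring_distribs sum.distrib)
  moreover have "\<forall>i\<le>n-1. a i + (if n - m \<le> i then d (n - i) else 0) \<in> M"
    using a dM by (auto intro!: I)
  ultimately show ?thesis using n0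
    by (intro conjI exI[of _ "\<lambda>i. a i + (if n - m \<le> i then d (n - i) else 0)"])
qed

text \<open>Krull's description of the integral closure. A non-integral \<open>z\<close> is not in
  \<open>A[1/z]\<close>, and a subring maximal among those that contain \<open>A[1/z]\<close> and
  omit \<open>z\<close> is a valuation ring.\<close>

theorem valuation_ring_avoiding:
  fixes z :: "'c::field"
  assumes A: "is_subring A" and nint: "\<not> integral_over A z"
  shows "\<exists>V. valuation_ring V \<and> A \<subseteq> V \<and> z \<notin> V"
proof -
  define w where "w = inverse z"
  have z0: "z \<noteq> 0" using nint integral_over_mem[OF A subring_zero[OF A]] by auto
  then have zw: "z * w = 1" by (simp add: w_def)
  define \<F> where "\<F> = {S. is_subring S \<and> A \<subseteq> S \<and> w \<in> S \<and> z \<notin> S}"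
  \<comment> \<open>A relation expressing \<open>z\<close> as a polynomial in \<open>1/z\<close>,
    multiplied by a power of \<open>z\<close>, is a monic equation for \<open>z\<close>.\<close>
  have "z \<notin> adjoin A w"
  proof
    assume "z \<in> adjoin A w"
    then obtain p where p: "p \<in> polys_over A" "z = poly p w" by (rule adjoinE)
    define d where "d = degree p"
    have "z ^ Suc d = z ^ d * poly p w" using p by simp
    also have "\<dots> = (\<Sum>i\<le>d. coeff p i * z ^ (d - i))"
      unfolding poly_altdef sum_distrib_left d_def[symmetric]
      by (rule sum.cong) (use z0 in \<open>auto simp: w_def power_diff field_simps\<close>)
    also have "\<dots> = (\<Sum>i\<le>d. coeff p (d - i) * z ^ i)"
      by (rule sum.reindex_bij_witness[of _ "\<lambda>i. d - i" "\<lambda>i. d - i"]) auto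
    finally have "z ^ Suc d + (\<Sum>i<Suc d. - coeff p (d - i) * z ^ i) = 0"
      by (simp only: lessThan_Suc_atMost mult_minus_left sum_negf) simp
    then have "integral_over A z"
      unfolding integral_over_def using p
      by (intro exI[of _ "Suc d"] exI[of _ "\<lambda>i. - coeff p (d - i)"])
        (auto dest: polys_overD intro: subring_uminus[OF A])
    then show False using nint by blast
  qed
  then have "adjoin A w \<in> \<F>"
    unfolding \<F>_def using is_subring_adjoin[OF A] subset_adjoin[OF A] adjoin_self[OF A] by auto
  then have ne: "\<F> \<noteq> {}" by blast
  have "\<exists>M\<in>\<F>. \<forall>S\<in>\<F>. M \<subseteq> S \<longrightarrow> S = M"
  proof (rule subset_Zorn_nonempty[OF ne])
    fix \<C> assume C: "\<C> \<noteq> {}" "subset.chain \<F> \<C>"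
    have "is_subring (\<Union>\<C>)"
      using C by (intro is_subring_Union_chain[of \<C> \<F>]) (auto simp: subset.chain_def \<F>_def)
    then show "\<Union>\<C> \<in> \<F>" using C by (auto simp: subset.chain_def \<F>_def)
  qed
  then obtain M where "M \<in> \<F>" and max: "\<And>S. S \<in> \<F> \<Longrightarrow> M \<subseteq> S \<Longrightarrow> S = M" by blast
  then have M: "is_subring M" "A \<subseteq> M" "w \<in> M" "z \<notin> M" by (auto simp: \<F>_def)
  note I = subring_intros[OF M(1)]
  have big: "z \<in> adjoin M u" if "u \<notin> M" for u
  proof (rule ccontr)
    assume "z \<notin> adjoin M u"
    then have "adjoin M u \<in> \<F>"
      using M subset_adjoin[OF M(1), of u] is_subring_adjoin[OF M(1)] by (auto simp: \<F>_def)
    then have "adjoin M u = M" using max subset_adjoin[OF M(1)] by blast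
    then show False using that adjoin_self[OF M(1), of u] by simp
  qed
  \<comment> \<open>This says that \<open>w\<close> lies in the Jacobson radical of
    \<open>M\<close>. Otherwise maximality makes \<open>z\<close> a polynomial in
    \<open>inverse t\<close>, so \<open>t ^ d * z \<in> M\<close>; but \<open>t ^ d\<close> is 1
    modulo \<open>w\<close>, and this product differs from \<open>z\<close> by an element of
    \<open>M\<close>.\<close>
  have unit: "1 - w * c \<noteq> 0 \<and> inverse (1 - w * c) \<in> M" if c: "c \<in> M" for c
  proof -
    define t where "t = 1 - w * c"
    have tM: "t \<in> M" using c M by (auto simp: t_def intro!: I)
    have t0: "t \<noteq> 0"
    proof
      assume "t = 0" then have "z * (w * c) = z" by (simp add: t_def)
      then have "c = z" using zw by (simp add: mult.assoc[symmetric])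
      then show False using c M by simp
    qed
    have "inverse t \<in> M"
    proof (rule ccontr)
      assume "inverse t \<notin> M"
      then obtain p where p: "p \<in> polys_over M" "z = poly p (inverse t)" using adjoinE[OF big] by blast
      define d where "d = degree p"
      have "t ^ d * z = (\<Sum>i\<le>d. coeff p i * t ^ (d - i))"
        unfolding p(2) poly_altdef sum_distrib_left d_def[symmetric]
        by (rule sum.cong) (use t0 in \<open>auto simp: power_diff field_simps\<close>)
      also have "\<dots> \<in> M" using p tM by (auto intro!: I dest: polys_overD)
      finally have td: "t ^ d * z \<in> M" .
      have "\<exists>c'\<in>M. t ^ k = 1 - w * c'" for k
      proof (induction k)
        case 0 show ?case by (rule bexI[of _ 0]) (auto intro: I)
      next
        case (Suc k)
        then obtain c' where c': "c' \<in> M" "t ^ k = 1 - w * c'" by blast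
        have "t ^ Suc k = 1 - w * (c' + c - w * c * c')"
          unfolding power_Suc c'(2) by (simp add: t_def algebra_simps)
        then show ?case using c c' M by (intro bexI[of _ "c' + c - w * c * c'"]) (auto intro!: I)
      qed
      then obtain c' where c': "c' \<in> M" "t ^ d = 1 - w * c'" by blast
      have "t ^ d * z = z - (z * w) * c'" unfolding c'(2) by (simp add: algebra_simps)
      then have "t ^ d * z + c' = z" using zw by simp
      then show False using td c' M I(6) by metis
    qed
    then show ?thesis using t0 by (simp add: t_def)
  qed
  have "u \<in> M \<or> inverse u \<in> M" for u
  proof (rule ccontr)
    assume "\<not> (u \<in> M \<or> inverse u \<in> M)"
    then have uM: "u \<notin> M" "inverse u \<notin> M" by auto
    then have u0: "u \<noteq> 0" using I(4) by auto
    define P where "P u n \<longleftrightarrow> (\<exists>a. (\<forall>i\<le>n. a i \<in> M) \<and> z = (\<Sum>i\<le>n. a i * u ^ i))" for u n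
    have ex: "\<exists>n. P u n" if "u \<notin> M" for u
    proof -
      obtain p where "p \<in> polys_over M" "z = poly p u" using big[OF \<open>u \<notin> M\<close>] by (auto elim: adjoinE)
      then show ?thesis unfolding P_def
        by (intro exI[of _ "degree p"] exI[of _ "coeff p"]) (simp add: poly_altdef polys_overD)
    qed
    \<comment> \<open>Both expressions of \<open>z\<close> are taken as short as possible; the
      longer one can nevertheless be shortened by means of the other.\<close>
    define n m where "n = (LEAST n. P u n)" and "m = (LEAST n. P (inverse u) n)"
    have n: "P u n" unfolding n_def by (rule LeastI_ex[OF ex[OF uM(1)]])
    have m: "P (inverse u) m" unfolding m_def by (rule LeastI_ex[OF ex[OF uM(2)]])
    have nmin: "\<not> P u (n - 1)" if "n > 0" using that unfolding n_def by (intro not_less_Least) simp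
    have mmin: "\<not> P (inverse u) (m - 1)" if "m > 0" using that unfolding m_def by (intro not_less_Least) simp
    obtain a where a: "\<forall>i\<le>n. a i \<in> M" "z = (\<Sum>i\<le>n. a i * u ^ i)" using n unfolding P_def by blast
    obtain b where b: "\<forall>i\<le>m. b i \<in> M" "z = (\<Sum>i\<le>m. b i * inverse u ^ i)" using m unfolding P_def by blast
    show False
    proof (cases "m \<le> n")
      case True
      have "n > 0 \<and> P u (n - 1)"
        unfolding P_def by (rule chevalley_descent[OF M(1) zw M(3,4) unit u0 a b True])
      then show ?thesis using nmin by simp
    next
      case False
      have b': "z = (\<Sum>i\<le>n. a i * inverse (inverse u) ^ i)" using a by simp
      have "m > 0 \<and> P (inverse u) (m - 1)"
        unfolding P_def
        by (rule chevalley_descent[OF M(1) zw M(3,4) unit _ b a(1) b']) (use False u0 in simp_all)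
      then show ?thesis using mmin by simp
    qed
  qed
  then show ?thesis using M by (intro exI[of _ M]) (auto simp: valuation_ring_def)
qed

section \<open>Gauss lemmas\<close>

text \<open>The whole ring counts as prime here; properness is stated or derived separately where it
  matters.\<close>

definition prime_ideal_in :: "'a::comm_ring_1 set \<Rightarrow> 'a set \<Rightarrow> bool" where
  "prime_ideal_in A I \<longleftrightarrow> I \<subseteq> A \<and> 0 \<in> I \<and> (\<forall>x\<in>I. \<forall>y\<in>I. x + y \<in> I) \<and>
     (\<forall>x\<in>I. \<forall>a\<in>A. x * a \<in> I) \<and> (\<forall>x\<in>A. \<forall>y\<in>A. x * y \<in> I \<longrightarrow> x \<in> I \<or> y \<in> I)"

lemma prime_ideal_in_sum:
  "prime_ideal_in A I \<Longrightarrow> (\<And>i. i \<in> S \<Longrightarrow> f i \<in> I) \<Longrightarrow> sum f S \<in> I"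
  by (induction S rule: infinite_finite_induct) (auto simp: prime_ideal_in_def)

lemma prime_max_ideal: "valuation_ring V \<Longrightarrow> prime_ideal_in V (max_ideal V)"
  unfolding prime_ideal_in_def
  by (auto intro: max_ideal_subset zero_max_ideal max_ideal_add max_ideal_mult dest: max_ideal_prime)

text \<open>Gauss's lemma: if \<open>i\<close> and \<open>j\<close> are the lowest positions of
  coefficients outside \<open>I\<close>, the coefficient of the product at \<open>i + j\<close> is
  the product of these two modulo \<open>I\<close>.\<close>

lemma polys_over_prime:
  assumes A: "is_subring A" and I: "prime_ideal_in A I"
    and p: "p \<in> polys_over A" "p \<notin> polys_over I" and q: "q \<in> polys_over A" "q \<notin> polys_over I"
  shows "p * q \<notin> polys_over I"
proof
  assume pq: "p * q \<in> polys_over I"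
  define i where "i = (LEAST i. coeff p i \<notin> I)"
  define j where "j = (LEAST i. coeff q i \<notin> I)"
  have i: "coeff p i \<notin> I" "\<And>k. k < i \<Longrightarrow> coeff p k \<in> I"
    using p(2) unfolding i_def polys_over_def mem_Collect_eq not_all by (rule LeastI_ex, blast dest: not_less_Least)
  have j: "coeff q j \<notin> I" "\<And>k. k < j \<Longrightarrow> coeff q k \<in> I"
    using q(2) unfolding j_def polys_over_def mem_Collect_eq not_all by (rule LeastI_ex, blast dest: not_less_Least)
  have mI: "x * a \<in> I" "a * x \<in> I" if "x \<in> I" "a \<in> A" for x a
    using I that unfolding prime_ideal_in_def by (metis, metis mult.commute)
  define R where "R = (\<Sum>k\<in>{..i+j}-{i}. coeff p k * coeff q (i + j - k))"
  have R: "R \<in> I"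
    unfolding R_def
  proof (rule prime_ideal_in_sum[OF I])
    fix k assume k: "k \<in> {..i+j} - {i}"
    show "coeff p k * coeff q (i + j - k) \<in> I"
    proof (cases "k < i")
      case True then show ?thesis using i q polys_overD mI by blast
    next
      case False then have "i + j - k < j" using k by auto
      then show ?thesis using j p polys_overD mI by blast
    qed
  qed
  have "coeff (p * q) (i + j) = coeff p i * coeff q j + R"
    unfolding coeff_mult R_def by (subst sum.remove[of _ i]) auto
  then have "coeff p i * coeff q j = coeff (p * q) (i + j) + R * (-1)" by simp
  also have "\<dots> \<in> I"
    using polys_overD[OF pq] R mI(1)[of R "-1"] A I subring_one subring_uminus
    unfolding prime_ideal_in_def by blast
  finally show False using i j p q I polys_overD unfolding prime_ideal_in_def by blast
qed

lemma finite_max_valuation: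
  assumes V: "valuation_ring V" and S: "finite S" "S \<noteq> {}" "0 \<notin> S"
  shows "\<exists>s\<in>S. \<forall>t\<in>S. t / s \<in> V"
  using S
proof (induction S rule: finite_ne_induct)
  case (singleton x)
  then show ?case using vr_intros(1)[OF V] by auto
next
  case (insert x S)
  then obtain s where s: "s \<in> S" "\<forall>t\<in>S. t / s \<in> V" by auto
  have nz: "x \<noteq> 0" "s \<noteq> 0" using insert s by auto
  show ?case
  proof (cases "x / s \<in> V")
    case True then show ?thesis using s by auto
  next
    case False
    then have sx: "s / x \<in> V" using vr_inverse[OF V, of "x / s"] by simp
    have "t / x \<in> V" if "t \<in> S" for t
      using vr_intros(3)[OF V s(2)[rule_format, OF that] sx] nz by simp
    then show ?thesis using nz vr_intros(1)[OF V] by (intro bexI[of _ x]) auto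
  qed
qed

text \<open>The scalar \<open>c\<close> is a coefficient of largest value; dividing by it leaves a
  coefficient equal to 1.\<close>

lemma poly_content:
  assumes V: "valuation_ring V" and p: "p \<noteq> 0"
  obtains c p0 where "c \<noteq> 0" "p = smult c p0" "p0 \<in> polys_over V" "p0 \<notin> polys_over (max_ideal V)"
proof -
  have "\<exists>s\<in>coeff p ` {i. i \<le> degree p \<and> coeff p i \<noteq> 0}. \<forall>t\<in>coeff p ` {i. i \<le> degree p \<and> coeff p i \<noteq> 0}. t / s \<in> V"
  proof (rule finite_max_valuation[OF V])
    show "coeff p ` {i. i \<le> degree p \<and> coeff p i \<noteq> 0} \<noteq> {}"
      using p leading_coeff_0_iff[of p] by blast
  qed auto
  then obtain k where k: "coeff p k \<noteq> 0" "\<And>i. i \<le> degree p \<Longrightarrow> coeff p i \<noteq> 0 \<Longrightarrow> coeff p i / coeff p k \<in> V"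
    by blast
  define p0 where "p0 = smult (inverse (coeff p k)) p"
  have "coeff p0 i \<in> V" for i
    using k(2)[of i] vr_intros(4)[OF V]
    by (cases "i \<le> degree p \<and> coeff p i \<noteq> 0") (auto simp: p0_def field_simps coeff_eq_0)
  moreover have "coeff p0 k = 1" using k by (simp add: p0_def)
  ultimately have "p0 \<in> polys_over V" "p0 \<notin> polys_over (max_ideal V)"
    using one_not_max_ideal[OF V] unfolding polys_over_def by (blast, metis mem_Collect_eq)
  moreover have "p = smult (coeff p k) p0" using k by (simp add: p0_def)
  ultimately show thesis using that k by blast
qed

text \<open>The inverse contents of the monic factors are the leading coefficients of their
  primitive parts, hence lie in \<open>V\<close>. The product of the primitive parts is primitive
  and equals \<open>p * q\<close> times both inverse contents, which forces the inverse content of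
  \<open>p\<close> to be a unit.\<close>

lemma monic_factor_over_valuation_ring:
  assumes V: "valuation_ring V" and p: "lead_coeff p = 1" and q: "lead_coeff q = 1"
    and pq: "p * q \<in> polys_over V"
  shows "p \<in> polys_over V"
proof -
  note I = vr_intros[OF V]
  have "p \<noteq> 0" "q \<noteq> 0" using p q by auto
  obtain c p0 where p0: "c \<noteq> 0" "p = smult c p0" "p0 \<in> polys_over V" "p0 \<notin> polys_over (max_ideal V)"
    using poly_content[OF V \<open>p \<noteq> 0\<close>] .
  obtain d q0 where q0: "d \<noteq> 0" "q = smult d q0" "q0 \<in> polys_over V" "q0 \<notin> polys_over (max_ideal V)"
    using poly_content[OF V \<open>q \<noteq> 0\<close>] .
  have "p0 * q0 \<notin> polys_over (max_ideal V)"
    using polys_over_prime[OF vr_subring prime_max_ideal] V p0 q0 by blast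
  then obtain k where k: "coeff (p0 * q0) k \<notin> max_ideal V" by (auto simp: polys_over_def)
  have lc: "c * lead_coeff p0 = 1" "d * lead_coeff q0 = 1"
    using p q p0(1,2) q0(1,2) by (simp_all add: lead_coeff_smult[symmetric] del: degree_smult_eq)
  have inv: "inverse c = lead_coeff p0" "inverse d = lead_coeff q0"
    using lc by (auto intro: inverse_unique)
  have "p0 * q0 = smult (inverse c * inverse d) (p * q)" using p0(1) q0(1) by (simp add: p0(2) q0(2) field_simps)
  then have eq: "coeff (p0 * q0) k = inverse c * (inverse d * coeff (p * q) k)" by (simp add: mult.assoc)
  have V1: "inverse d * coeff (p * q) k \<in> V" "inverse c \<in> V"
    using inv pq polys_overD[OF p0(3)] polys_overD[OF q0(3)] polys_overD[OF pq] by (auto intro!: I)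
  then have "inverse c \<notin> max_ideal V" using k max_ideal_mult[OF V] unfolding eq by blast
  then have "c \<in> V" using V1 unit_iff[OF V, of "inverse c"] by simp
  then show ?thesis using p0(2,3) smult_in_polys_over[OF vr_subring[OF V]] by simp
qed

text \<open>If the content \<open>c\<close> of \<open>r\<close> were outside \<open>V\<close>,
  multiplying the integral equation by the \<open>n\<close>-th power of \<open>u = inverse c\<close>
  would put all coefficients of \<open>r0 ^ n\<close> into the maximal ideal, against Gauss's lemma
  for the primitive part \<open>r0\<close>.\<close>

lemma integral_poly_over_valuation_ring:
  assumes V: "valuation_ring V" and r: "integral_over (polys_over V) r"
  shows "r \<in> polys_over V"
proof (cases "r = 0")
  case True then show ?thesis using vr_intros(4)[OF V] by (simp add: polys_over_def)
next
  case False
  note VS = vr_subring[OF V]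
  note PI = subring_intros[OF subring_polys_over[OF VS]]
  obtain c r0 where r0: "c \<noteq> 0" "r = smult c r0" "r0 \<in> polys_over V" "r0 \<notin> polys_over (max_ideal V)"
    using poly_content[OF V False] .
  show ?thesis
  proof (cases "c \<in> V")
    case True then show ?thesis using r0 smult_in_polys_over[OF VS] by simp
  next
    case cV: False
    define u where "u = inverse c"
    have u: "u \<in> max_ideal V" using cV not_in_iff[OF V] by (auto simp: u_def)
    obtain n C where C: "\<forall>i<n. C i \<in> polys_over V" and eq: "r ^ n + (\<Sum>i<n. C i * r ^ i) = 0"
      using r unfolding integral_over_def by blast
    have pw: "smult (u ^ n) (r ^ i) = smult (u ^ (n - i)) (r0 ^ i)" if "i \<le> n" for i
    proof -
      have "u ^ n * c ^ i = u ^ (n - i)"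
        using that r0(1) by (simp add: u_def power_diff field_simps)
      then show ?thesis unfolding r0(2) by (simp add: smult_power)
    qed
    have "0 = [:u ^ n:] * (r ^ n + (\<Sum>i<n. C i * r ^ i))" using eq by simp
    also have "\<dots> = r0 ^ n + (\<Sum>i<n. smult (u ^ (n - i)) (C i * r0 ^ i))"
      unfolding distrib_left sum_distrib_left using pw[of n]
      by (intro arg_cong2[of _ _ _ _ "(+)"] sum.cong) (auto simp: pw mult_smult_right[symmetric] simp del: mult_smult_right)
    finally have eq0: "r0 ^ n = - (\<Sum>i<n. smult (u ^ (n - i)) (C i * r0 ^ i))"
      by (simp add: eq_neg_iff_add_eq_0)
    have "coeff (r0 ^ n) k \<in> max_ideal V" for k
    proof -
      have "u ^ (n - i) * coeff (C i * r0 ^ i) k \<in> max_ideal V" if "i < n" for i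
      proof -
        have "u * (u ^ (n - i - 1) * coeff (C i * r0 ^ i) k) \<in> max_ideal V"
          using C that r0(3) max_ideal_subset[OF V u]
          by (intro max_ideal_mult[OF V u] vr_intros[OF V] polys_overD[where A = V] PI) auto
        then show ?thesis using that by (metis Suc_diff_Suc diff_diff_left mult.assoc plus_1_eq_Suc power_Suc add.commute)
      qed
      then show ?thesis unfolding eq0 coeff_minus coeff_sum coeff_smult
        by (intro max_ideal_uminus max_ideal_sum V) auto
    qed
    then have "r0 ^ n \<in> polys_over (max_ideal V)" by (rule polys_overI)
    moreover have "r0 ^ n \<notin> polys_over (max_ideal V)" for n
    proof (induction n)
      case 0
      then show ?case using one_not_max_ideal[OF V] by (auto simp: polys_over_def intro!: exI[of _ 0])
    next
      case (Suc n)
      then show ?case unfolding power_Suc using r0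
        by (intro polys_over_prime[OF VS prime_max_ideal[OF V]] PI)
    qed
    ultimately show ?thesis by blast
  qed
qed

section \<open>Normal subrings\<close>

definition frac :: "'c::field set \<Rightarrow> 'c set" where
  "frac A = {p / q |p q. p \<in> A \<and> q \<in> A \<and> q \<noteq> 0}"

definition normal_ring :: "'c::field set \<Rightarrow> bool" where
  "normal_ring A \<longleftrightarrow> (\<forall>z\<in>frac A. integral_over A z \<longrightarrow> z \<in> A)"

definition transcendental_over :: "'c::field set \<Rightarrow> 'c \<Rightarrow> bool" where
  "transcendental_over A y \<longleftrightarrow> (\<forall>p\<in>polys_over A. poly p y = 0 \<longrightarrow> p = 0)"

lemma subset_frac: "is_subring A \<Longrightarrow> A \<subseteq> frac A"
  unfolding frac_def using subring_one by (force intro: exI[of _ 1])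

lemma is_subring_frac:
  assumes A: "is_subring A" shows "is_subring (frac A)"
  unfolding is_subring_def
proof (intro conjI ballI)
  note I = subring_intros[OF A]
  show "1 \<in> frac A" using subset_frac[OF A] I(1) by blast
  fix x y assume "x \<in> frac A" "y \<in> frac A"
  then obtain a b c d where *: "x = a / b" "y = c / d" "a \<in> A" "b \<in> A" "c \<in> A" "d \<in> A" "b \<noteq> 0" "d \<noteq> 0"
    unfolding frac_def by blast
  have "x - y = (a * d - c * b) / (b * d)" "x * y = (a * c) / (b * d)" using * by (auto simp: field_simps)
  moreover have "a * d - c * b \<in> A" "b * d \<in> A" "a * c \<in> A" "b * d \<noteq> 0" using * I by auto
  ultimately show "x - y \<in> frac A" "x * y \<in> frac A" unfolding frac_def by blast+
qed

lemma frac_divide: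
  assumes A: "is_subring A" and "x \<in> frac A" "y \<in> frac A"
  shows "x / y \<in> frac A"
proof (cases "y = 0")
  case True then show ?thesis using subring_zero[OF is_subring_frac[OF A]] by simp
next
  case False
  obtain a b c d where *: "x = a / b" "y = c / d" "a \<in> A" "b \<in> A" "c \<in> A" "d \<in> A" "b \<noteq> 0" "d \<noteq> 0"
    using assms unfolding frac_def by blast
  then have "x / y = (a * d) / (b * c)" "a * d \<in> A" "b * c \<in> A" "b * c \<noteq> 0"
    using False subring_mult[OF A] by auto
  then show ?thesis unfolding frac_def by blast
qed

text \<open>The leading coefficient of \<open>r\<close> is a quotient of leading coefficients in
  \<open>frac A\<close>; subtracting the leading monomial lowers the degree.\<close>

lemma quotient_in_polys_over_frac:
  assumes A: "is_subring A" and q: "q \<in> polys_over (frac A)" "q \<noteq> 0"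
  shows "q * r \<in> polys_over (frac A) \<Longrightarrow> r \<in> polys_over (frac A)"
proof (induction "degree r" arbitrary: r rule: less_induct)
  case less
  note F = is_subring_frac[OF A]
  note PI = subring_intros[OF subring_polys_over[OF F]]
  have "lead_coeff r = lead_coeff (q * r) / lead_coeff q"
    using q(2) by (simp add: lead_coeff_mult)
  then have lc: "lead_coeff r \<in> frac A"
    using frac_divide[OF A] polys_overD[OF less.prems] polys_overD[OF q(1)] by simp
  define m where "m = monom (lead_coeff r) (degree r)"
  have m: "m \<in> polys_over (frac A)"
    unfolding m_def by (intro monom_in_polys_over subring_zero[OF F] lc)
  show ?case
  proof (cases "degree r = 0")
    case True
    then have "r = m" by (metis m_def degree_eq_zeroE lead_coeff_pCons(2) monom_0)
    then show ?thesis using m by simp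
  next
    case False
    have "degree (r - m) < degree r"
    proof -
      have "coeff (r - m) i = 0" if "i > degree r - 1" for i
        using that False by (cases "i = degree r") (auto simp: m_def coeff_eq_0)
      then have "degree (r - m) \<le> degree r - 1" by (intro degree_le) auto
      then show ?thesis using False by simp
    qed
    moreover have "q * (r - m) \<in> polys_over (frac A)"
      unfolding right_diff_distrib by (intro PI less.prems q m)
    ultimately have "r - m \<in> polys_over (frac A)" using less.hyps by blast
    then have "(r - m) + m \<in> polys_over (frac A)" using m PI(6) by blast
    then show ?thesis by simp
  qed
qed

text \<open>Serves twice: to cancel a common factor \<open>g\<close> of numerator and denominator,
  and with \<open>s = 1\<close> to divide a relation for \<open>r * g\<close> by
  \<open>g ^ n\<close>.\<close>

lemma homogenize_monic_relation:
  fixes g :: "'a::comm_semiring_1"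
  shows "g ^ n * (r ^ n + (\<Sum>i<n. C i * r ^ i * s ^ (n - i))) =
    (r * g) ^ n + (\<Sum>i<n. C i * (r * g) ^ i * (s * g) ^ (n - i))"
proof -
  have "g ^ n * (C i * r ^ i * s ^ (n - i)) = C i * (r * g) ^ i * (s * g) ^ (n - i)" if "i < n" for i
  proof -
    have "g ^ n = g ^ i * g ^ (n - i)" using power_add[of g i "n - i"] that by simp
    then show ?thesis by (simp only: power_mult_distrib mult_ac)
  qed
  then show ?thesis by (simp add: distrib_left sum_distrib_left power_mult_distrib mult.commute)
qed

text \<open>The rational root argument: in lowest terms the denominator divides a power of the
  numerator, to which it is coprime.\<close>

lemma dvd_of_integral_quotient:
  fixes p q :: "'c::field_gcd poly"
  assumes q: "q \<noteq> 0" and eq: "p ^ n + (\<Sum>i<n. C i * p ^ i * q ^ (n - i)) = 0"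
  shows "q dvd p"
proof -
  define g where "g = gcd p q"
  obtain p' q' where pq: "p = p' * g" "q = q' * g" "coprime p' q'"
    using gcd_coprime_exists[of p q] q unfolding g_def by (metis gcd_eq_0_iff)
  have g0: "g \<noteq> 0" using q by (simp add: g_def)
  have "p ^ n + (\<Sum>i<n. C i * p ^ i * q ^ (n - i)) = g ^ n * (p' ^ n + (\<Sum>i<n. C i * p' ^ i * q' ^ (n - i)))"
    unfolding pq(1,2) by (rule homogenize_monic_relation[symmetric])
  then have "p' ^ n + (\<Sum>i<n. C i * p' ^ i * q' ^ (n - i)) = 0" using eq g0 by simp
  then have "p' ^ n = - (\<Sum>i<n. C i * p' ^ i * q' ^ (n - i))" by (simp add: eq_neg_iff_add_eq_0)
  moreover have "q' dvd (\<Sum>i<n. C i * p' ^ i * q' ^ (n - i))"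
    by (intro dvd_sum dvd_mult) (auto intro: dvd_power)
  ultimately have "q' dvd p' ^ n" by simp
  then have "is_unit q'" using pq(3) by (meson coprime_absorb_right coprime_power_left_iff)
  then show ?thesis unfolding pq by (simp add: mult_dvd_mono unit_imp_dvd)
qed

text \<open>Together with \<open>integral_imp_in_vr\<close> this turns claims of integrality into
  membership in valuation rings, where sums, products and transitivity are immediate.\<close>

lemma integral_if_in_all_vr:
  assumes "is_subring A" "\<And>V. valuation_ring V \<Longrightarrow> A \<subseteq> V \<Longrightarrow> z \<in> V"
  shows "integral_over A z"
  using valuation_ring_avoiding assms by blast

lemma integral_imp_in_vr:
  "integral_over A z \<Longrightarrow> valuation_ring V \<Longrightarrow> A \<subseteq> V \<Longrightarrow> z \<in> V"
  using integral_over_vr integral_over_mono by blast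

text \<open>Transcendence of \<open>y\<close> lifts the integral equation to polynomials, where the
  quotient becomes a polynomial \<open>r\<close> over \<open>frac A\<close>. As \<open>r\<close> is
  integral over \<open>polys_over V\<close> for each valuation ring \<open>V\<close> containing
  \<open>A\<close>, its coefficients lie in all these \<open>V\<close>, and normality of
  \<open>A\<close> applies to each of them.\<close>

theorem normal_ring_adjoin:
  fixes y :: "'c::field_gcd"
  assumes A: "is_subring A" and normal: "normal_ring A" and tr: "transcendental_over A y"
  shows "normal_ring (adjoin A y)"
  unfolding normal_ring_def
proof (intro ballI impI)
  fix z assume "z \<in> frac (adjoin A y)" and int: "integral_over (adjoin A y) z"
  then obtain p q where pq: "p \<in> polys_over A" "q \<in> polys_over A" "z = poly p y / poly q y" "poly q y \<noteq> 0"
    unfolding frac_def adjoin_def by blast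
  have q0: "q \<noteq> 0" using pq by auto
  note P = subring_intros[OF subring_polys_over[OF A]]
  obtain n c where c: "\<forall>i<n. c i \<in> adjoin A y" and eq: "z ^ n + (\<Sum>i<n. c i * z ^ i) = 0"
    using int unfolding integral_over_def by blast
  have "\<exists>C. \<forall>i<n. C i \<in> polys_over A \<and> c i = poly (C i) y"
    by (rule choice) (use c in \<open>auto simp: adjoin_def\<close>)
  then obtain C where C: "\<And>i. i < n \<Longrightarrow> C i \<in> polys_over A" "\<And>i. i < n \<Longrightarrow> c i = poly (C i) y" by blast
  define h where "h = p ^ n + (\<Sum>i<n. C i * p ^ i * q ^ (n - i))"
  have "poly h y = poly q y ^ n * (z ^ n + (\<Sum>i<n. c i * z ^ i))"
    unfolding h_def pq(3) distrib_left sum_distrib_left poly_add poly_sum poly_mult poly_power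
    using pq(4) C
    by (intro arg_cong2[of _ _ _ _ "(+)"] sum.cong) (auto simp: field_simps power_diff)
  then have "poly h y = 0" using eq by simp
  moreover have "h \<in> polys_over A" unfolding h_def using pq C by (auto intro!: P)
  ultimately have h0: "h = 0" using tr by (auto simp: transcendental_over_def)
  then have "q dvd p" using dvd_of_integral_quotient[OF q0] unfolding h_def by blast
  then obtain r where r: "p = q * r" by blast
  have sub: "polys_over A \<subseteq> polys_over (frac A)" by (rule polys_over_mono[OF subset_frac[OF A]])
  have rF: "r \<in> polys_over (frac A)"
    using quotient_in_polys_over_frac[OF A, of q r] q0 pq sub r by auto
  have "q ^ n * (r ^ n + (\<Sum>i<n. C i * r ^ i)) = h"
    using homogenize_monic_relation[of q n r C 1] by (simp add: h_def r mult.commute)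
  then have req: "r ^ n + (\<Sum>i<n. C i * r ^ i) = 0" using h0 q0 by simp
  have "coeff r k \<in> A" for k
  proof -
    have "integral_over A (coeff r k)"
    proof (rule integral_if_in_all_vr[OF A])
      fix V assume V: "valuation_ring V" "A \<subseteq> V"
      have "integral_over (polys_over V) r"
        unfolding integral_over_def using C(1) polys_over_mono[OF V(2)] req by blast
      then show "coeff r k \<in> V" using integral_poly_over_valuation_ring[OF V(1)] polys_overD by blast
    qed
    then show ?thesis using normal rF polys_overD unfolding normal_ring_def by blast
  qed
  moreover have "z = poly r y" using pq by (simp add: r)
  ultimately show "z \<in> adjoin A y" unfolding adjoin_def by (auto intro: polys_overI)
qed

text \<open>For a subring \<open>S\<close> of a field and a nonzero \<open>a \<in> S\<close> this is
  the subring \<open>S[1/a]\<close>.\<close>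

definition localized :: "'a::comm_ring_1 set \<Rightarrow> 'a \<Rightarrow> 'a set" where
  "localized S a = {z. \<exists>m. a ^ m * z \<in> S}"

lemma subset_localized: "S \<subseteq> localized S a"
  unfolding localized_def by (auto intro: exI[of _ 0])

lemma localized_le:
  assumes S: "is_subring S" and a: "a \<in> S" and "a ^ m * z \<in> S" "m \<le> n"
  shows "a ^ n * z \<in> S"
proof -
  have "a ^ n * z = a ^ (n - m) * (a ^ m * z)"
    using assms(4) by (simp add: mult.assoc[symmetric] power_add[symmetric])
  then show ?thesis using subring_intros[OF S] a assms(3) by simp
qed

lemma subring_localized:
  assumes S: "is_subring S" and a: "a \<in> S" shows "is_subring (localized S a)"
  unfolding is_subring_def
proof (intro conjI ballI)
  show "1 \<in> localized S a" using subset_localized[of S a] subring_one[OF S] by blast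
  fix x y assume "x \<in> localized S a" "y \<in> localized S a"
  then obtain m n where mn: "a ^ m * x \<in> S" "a ^ n * y \<in> S" unfolding localized_def by blast
  have "a ^ (m + n) * x \<in> S" "a ^ (m + n) * y \<in> S"
    using localized_le[OF S a] mn by auto
  then have "a ^ (m + n) * (x - y) \<in> S" unfolding right_diff_distrib by (rule subring_diff[OF S])
  then show "x - y \<in> localized S a" unfolding localized_def by blast
  have "a ^ (m + n) * (x * y) = (a ^ m * x) * (a ^ n * y)" by (simp add: power_add mult_ac)
  then have "a ^ (m + n) * (x * y) \<in> S" using subring_mult[OF S mn] by simp
  then show "x * y \<in> localized S a" unfolding localized_def by blast
qed

lemma localized_common:
  assumes S: "is_subring S" and a: "a \<in> S" and c: "\<And>i. i < (n::nat) \<Longrightarrow> c i \<in> localized S a"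
  shows "\<exists>m. \<forall>i<n. a ^ m * c i \<in> S"
  using c
proof (induction n)
  case (Suc n)
  then obtain m where m: "\<forall>i<n. a ^ m * c i \<in> S" by auto
  obtain k where k: "a ^ k * c n \<in> S" using Suc.prems[of n] unfolding localized_def by auto
  have "\<forall>i<Suc n. a ^ (m + k) * c i \<in> S"
    using m k localized_le[OF S a, of m _ "m + k"] localized_le[OF S a, of k _ "m + k"]
    by (auto simp: less_Suc_eq)
  then show ?case by blast
qed auto

text \<open>One power \<open>g\<close> of \<open>a\<close> clears all coefficients. Scaling the root
  by \<open>g\<close> multiplies the coefficient of degree \<open>i\<close> by
  \<open>g ^ (n - i)\<close>, which contains at least one factor \<open>g\<close>.\<close>

lemma integral_over_localized:
  assumes S: "is_subring S" and a: "a \<in> S" and int: "integral_over (localized S a) z"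
  shows "\<exists>m. integral_over S (a ^ m * z)"
proof -
  obtain n c where c: "\<forall>i<n. c i \<in> localized S a" and eq: "z ^ n + (\<Sum>i<n. c i * z ^ i) = 0"
    using int unfolding integral_over_def by blast
  obtain m where m: "\<forall>i<n. a ^ m * c i \<in> S" using localized_common[OF S a] c by blast
  define g where "g = a ^ m"
  have *: "g ^ n * (c i * z ^ i) = (g ^ (n - i) * c i) * (g * z) ^ i" if "i < n" for i
  proof -
    have "g ^ n = g ^ i * g ^ (n - i)" using power_add[of g i "n - i"] that by simp
    then show ?thesis by (simp only: power_mult_distrib mult_ac)
  qed
  have "(g * z) ^ n + (\<Sum>i<n. (g ^ (n - i) * c i) * (g * z) ^ i) = g ^ n * (z ^ n + (\<Sum>i<n. c i * z ^ i))"
    using * by (simp add: distrib_left sum_distrib_left power_mult_distrib)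
  then have "(g * z) ^ n + (\<Sum>i<n. (g ^ (n - i) * c i) * (g * z) ^ i) = 0" using eq by simp
  moreover have "g ^ (n - i) * c i \<in> S" if "i < n" for i
  proof -
    have "g ^ (n - i) * c i = g ^ (n - i - 1) * (g * c i)"
      using that by (metis Suc_diff_Suc diff_diff_left mult.assoc mult.commute plus_1_eq_Suc power_Suc add.commute)
    moreover have "g \<in> S" "g * c i \<in> S" using m that a subring_power[OF S] by (auto simp: g_def)
    ultimately show ?thesis using subring_mult[OF S] subring_power[OF S] by metis
  qed
  ultimately have "integral_over S (g * z)" unfolding integral_over_def
    by (intro exI[of _ n] exI[of _ "\<lambda>i. g ^ (n - i) * c i"]) simp
  then show ?thesis unfolding g_def by blast
qed

section \<open>Minimal polynomials over the fraction field of a subring\<close>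

lemma minimal_polynomial:
  fixes z :: "'c::field_gcd"
  assumes A: "is_subring A" and z: "integral_over (frac A) z"
  obtains Q where "Q \<in> polys_over (frac A)" "lead_coeff Q = 1" "poly Q z = 0"
    "\<And>f. f \<in> polys_over (frac A) \<Longrightarrow> poly f z = 0 \<Longrightarrow> Q dvd f"
proof -
  note F = is_subring_frac[OF A]
  note PI = subring_intros[OF subring_polys_over[OF F]]
  define P where "P Q \<longleftrightarrow> Q \<in> polys_over (frac A) \<and> lead_coeff Q = 1 \<and> poly Q z = 0" for Q
  have "\<exists>Q. P Q" using z unfolding integral_over_iff_monic[OF F] P_def by blast
  then obtain Q where Q: "P Q" and min: "\<And>R. P R \<Longrightarrow> degree Q \<le> degree R"
    using ex_has_least_nat[of P _ degree] by blast
  have Q0: "Q \<noteq> 0" using Q by (auto simp: P_def)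
  have "Q dvd f" if "f \<in> polys_over (frac A)" "poly f z = 0" for f
    using that
  proof (induction "degree f" arbitrary: f rule: less_induct)
    case less
    show ?case
    proof (cases "f = 0")
      case False
      have lc: "lead_coeff f \<in> frac A" "lead_coeff f \<noteq> 0" using less.prems polys_overD False by auto
      then have lci: "inverse (lead_coeff f) \<in> frac A"
        using frac_divide[OF A, of 1 "lead_coeff f"] subring_one[OF F] by (simp add: field_simps)
      have "P (smult (inverse (lead_coeff f)) f)"
        unfolding P_def using less.prems lci lc by (auto intro!: smult_in_polys_over[OF F])
      then have deg: "degree Q \<le> degree f" using min lc by fastforce
      define k where "k = degree f - degree Q"
      define f' where "f' = f - monom (lead_coeff f) k * Q"
      have f': "f' \<in> polys_over (frac A)" "poly f' z = 0"
        using less.prems Q lc(1) unfolding f'_def P_def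
        by (auto intro!: PI monom_in_polys_over subring_zero[OF F])
      have "Q dvd f'"
      proof (cases "f' = 0")
        case nz: False
        have "coeff f' i = 0" if "i > degree f - 1" for i
        proof (cases "i > degree f")
          case True
          moreover have "degree (monom (lead_coeff f) k * Q) \<le> degree f"
            using degree_mult_le[of "monom (lead_coeff f) k" Q] degree_monom_le[of "lead_coeff f" k] deg by (simp add: k_def)
          ultimately show ?thesis by (simp add: f'_def coeff_eq_0)
        next
          case False
          then have "i = degree f" using that by simp
          then show ?thesis using Q deg by (simp add: f'_def k_def coeff_monom_mult P_def)
        qed
        then have le: "degree f' \<le> degree f - 1" by (intro degree_le) auto
        show ?thesis
        proof (cases "degree f = 0")
          case True
          then have "degree Q = 0" using deg by simp
          then have "is_unit Q" using Q0 by (simp add: is_unit_iff_degree)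
          then show ?thesis by (rule unit_imp_dvd)
        next
          case False
          then show ?thesis using le by (intro less.hyps f') simp
        qed
      qed simp
      moreover have "f = f' + monom (lead_coeff f) k * Q" by (simp add: f'_def)
      ultimately show ?thesis by (metis dvd_add dvd_triv_right)
    qed simp
  qed
  then show thesis using that Q unfolding P_def by blast
qed

text \<open>Over any valuation ring containing \<open>B\<close>, the polynomial \<open>Q\<close> is
  a monic factor of a monic polynomial and hence has its coefficients there.\<close>

lemma minimal_polynomial_coeffs_integral:
  fixes z :: "'c::field_gcd"
  assumes B: "is_subring B" "B \<subseteq> F" and z: "integral_over B z"
    and Q: "lead_coeff Q = 1" "\<And>f. f \<in> polys_over F \<Longrightarrow> poly f z = 0 \<Longrightarrow> Q dvd f"
  shows "integral_over B (coeff Q i)"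
proof (rule integral_if_in_all_vr[OF B(1)])
  fix V assume V: "valuation_ring V" "B \<subseteq> V"
  obtain f where f: "f \<in> polys_over B" "lead_coeff f = 1" "poly f z = 0"
    using z integral_over_iff_monic[OF B(1)] by blast
  obtain h where h: "f = Q * h" using Q(2) f polys_over_mono[OF B(2)] by blast
  have "lead_coeff h = 1" using f(2) Q(1) unfolding h by (simp add: lead_coeff_mult)
  moreover have "Q * h \<in> polys_over V" using f(1) polys_over_mono[OF V(2)] h by blast
  ultimately have "Q \<in> polys_over V" using monic_factor_over_valuation_ring[OF V(1) Q(1)] by blast
  then show "coeff Q i \<in> V" by (rule polys_overD)
qed

section \<open>Algebras over the ring of integers inside a field\<close>

lemma nonarch_abs_simps:
  assumes "nonarch_abs v"
  shows "v 0 = 0" "v 1 = 1" "v (- x) = v x" "v (x * y) = v x * v y" "v (x ^ n) = v x ^ n"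
    "v x = 0 \<longleftrightarrow> x = 0" "v x \<ge> 0" "v (x / y) = v x / v y" "v (inverse x) = inverse (v x)"
    "v (x + y) \<le> max (v x) (v y)"
proof -
  note * = assms[unfolded nonarch_abs_def]
  show mult: "v (x * y) = v x * v y" for x y using * by blast
  show z: "v x = 0 \<longleftrightarrow> x = 0" for x using * by blast
  show "v x \<ge> 0" "v (x + y) \<le> max (v x) (v y)" using * by blast+
  show "v 0 = 0" using z by blast
  have "v 1 * v 1 = v 1" using mult[of 1 1] by simp
  then show one: "v 1 = 1" using z[of 1] by simp
  have "v (-1) * v (-1) = 1" using mult[of "-1" "-1"] one by simp
  then have "v (-1) = 1" using * by (metis abs_of_nonneg power2_eq_1_iff power2_eq_square abs_1 abs_minus_cancel)
  then show "v (- x) = v x" using mult[of "-1" x] by simp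
  show "v (x ^ n) = v x ^ n" by (induction n) (auto simp: one mult)
  show inv: "v (inverse x) = inverse (v x)" for x
  proof (cases "x = 0")
    case True then show ?thesis using z[of 0] by simp
  next
    case False
    then have "v x * v (inverse x) = 1" using mult[of x "inverse x"] one by simp
    then show ?thesis by (metis inverse_unique)
  qed
  show "v (x / y) = v x / v y" using mult[of x "inverse y"] inv[of y] by (simp add: field_simps)
qed

lemma valuation_ring_valring:
  assumes "nonarch_abs v" shows "valuation_ring (valring v)"
proof -
  note s = nonarch_abs_simps[OF assms]
  have "x - y \<in> valring v" if "x \<in> valring v" "y \<in> valring v" for x y
    using s(10)[of x "- y"] s(3)[of y] that by (simp add: valring_def)
  moreover have "x * y \<in> valring v" if "x \<in> valring v" "y \<in> valring v" for x y
    using s(4)[of x y] s(7)[of y] s(7)[of x] that mult_le_one by (auto simp: valring_def)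
  moreover have "z \<in> valring v \<or> inverse z \<in> valring v" for z
    by (cases "v z \<le> 1") (auto simp: valring_def s(9) inverse_le_1_iff)
  ultimately show ?thesis using s(2) by (auto simp: valuation_ring_def is_subring_def valring_def)
qed

text \<open>The field \<open>'c\<close> is an extension of k through \<open>e\<close>, and \<pi> is
  a pseudo-uniformizer, so the absolute value is nontrivial. The sort \<open>field_gcd\<close>
  provides gcds of polynomials over \<open>'c\<close>.\<close>

locale valued_embedding =
  fixes v :: "'k::field \<Rightarrow> real" and e :: "'k \<Rightarrow> 'c::field_gcd" and \<pi> :: 'k
  assumes nonarch: "nonarch_abs v"
    and hom: "ring_hom_fun e"
    and pi_pos: "0 < v \<pi>" and pi_less: "v \<pi> < 1"
begin

lemmas v_simps = nonarch_abs_simps[OF nonarch]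

lemma e_1: "e 1 = 1" and e_add: "e (x + y) = e x + e y" and e_mult: "e (x * y) = e x * e y"
  using hom by (auto simp: ring_hom_fun_def)

lemma e_0: "e 0 = 0" using e_add[of 0 0] by (metis add_0 add_cancel_right_right)

lemma e_minus: "e (- x) = - e x" using e_add[of x "- x"] e_0 by (simp add: eq_neg_iff_add_eq_0 add.commute)

lemma e_power: "e (x ^ n) = e x ^ n" by (induction n) (auto simp: e_1 e_mult)

lemma e_inverse: "e (inverse x) = inverse (e x)"
proof (cases "x = 0")
  case False
  then have "e x * e (inverse x) = 1" using e_mult[of x "inverse x"] e_1 by simp
  then show ?thesis by (metis inverse_unique)
qed (simp add: e_0)

lemma e_divide: "e (x / y) = e x / e y"
  using e_mult[of x "inverse y"] by (simp add: e_inverse field_class.field_divide_inverse)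

lemma e_eq_0: "e x = 0 \<longleftrightarrow> x = 0"
  by (metis e_0 e_1 e_inverse e_mult field_class.field_inverse mult_zero_right zero_neq_one)

lemma pi_nz: "\<pi> \<noteq> 0" "e \<pi> \<noteq> 0"
  using pi_pos v_simps(1) e_eq_0 by auto

definition \<O> :: "'c set" where "\<O> = e ` valring v"

text \<open>The ideal of \<open>T\<close> generated by the scalars of absolute value below 1; the
  quotient by it is the special fibre. Single products do for sums, as finitely many scalars are
  multiples of the largest one.\<close>

definition mI :: "'c set \<Rightarrow> 'c set" where "mI T = {e c * t |c t. v c < 1 \<and> t \<in> T}"

lemma mI_I: "v c < 1 \<Longrightarrow> t \<in> T \<Longrightarrow> e c * t \<in> mI T"
  unfolding mI_def by blast

lemma mI_mono: "S \<subseteq> T \<Longrightarrow> mI S \<subseteq> mI T"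
  unfolding mI_def by blast

lemma \<O>_I: "v c \<le> 1 \<Longrightarrow> e c \<in> \<O>"
  by (auto simp: \<O>_def valring_def)

lemma is_subring_\<O>: "is_subring \<O>"
proof -
  note I = subring_intros[OF vr_subring[OF valuation_ring_valring[OF nonarch]]]
  have "1 \<in> \<O>" unfolding \<O>_def using I(1) e_1 by (metis image_eqI)
  moreover have "x - y \<in> \<O> \<and> x * y \<in> \<O>" if xy: "x \<in> \<O>" "y \<in> \<O>" for x y
  proof -
    obtain a b where ab: "x = e a" "y = e b" "a \<in> valring v" "b \<in> valring v" using xy unfolding \<O>_def by blast
    then have "x - y = e (a - b)" "x * y = e (a * b)" using e_add[of a "-b"] e_minus e_mult by auto
    then show ?thesis unfolding \<O>_def using ab I by blast
  qed
  ultimately show ?thesis by (auto simp: is_subring_def)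
qed

lemma archimedean:
  assumes "v c < 1" shows "\<exists>M. v (c ^ M / \<pi>) \<le> 1"
proof -
  obtain M where "v c ^ M < v \<pi>" using real_arch_pow_inv[OF pi_pos assms] by blast
  then show ?thesis using pi_pos by (intro exI[of _ M]) (simp add: v_simps)
qed

text \<open>The absolute value has rank one: some power of \<open>c\<close> is divisible by \<pi>,
  and the maximal ideal is prime.\<close>

lemma small_in_max_ideal:
  assumes V: "valuation_ring V" "\<O> \<subseteq> V" "e \<pi> \<in> max_ideal V" and c: "v c < 1"
  shows "e c \<in> max_ideal V"
proof -
  obtain M where M: "v (c ^ M / \<pi>) \<le> 1" using archimedean[OF c] by blast
  have "e \<pi> * e (c ^ M / \<pi>) \<in> max_ideal V"
    using max_ideal_mult[OF V(1,3)] \<O>_I[OF M] V(2) by blast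
  then have "e c ^ M \<in> max_ideal V" using pi_nz by (simp add: e_divide e_power)
  moreover have "e c \<in> V" using \<O>_I[of c] c V(2) by auto
  ultimately show ?thesis using max_ideal_power[OF V(1)] by blast
qed

text \<open>A valuation ring over the rank-one ring \<open>\<O>\<close> meets k in the ring of
  integers or in all of k; the latter is excluded because \<pi> is not a unit.\<close>

lemma e_in_valuation_ring_iff:
  assumes V: "valuation_ring V" "\<O> \<subseteq> V" "e \<pi> \<in> max_ideal V"
  shows "e c \<in> V \<longleftrightarrow> v c \<le> 1"
proof
  assume c: "e c \<in> V"
  show "v c \<le> 1"
  proof (rule ccontr)
    assume 1: "\<not> v c \<le> 1"
    then have "v (inverse c) < 1" by (simp add: v_simps inverse_less_1_iff)
    then have "inverse (e c) \<in> max_ideal V" using small_in_max_ideal[OF V] e_inverse by metis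
    then show False using c 1 not_in_iff[OF V(1), of "e c"] by (auto simp: e_eq_0 v_simps)
  qed
qed (use \<O>_I V(2) in blast)

lemma mI_subset_max_ideal:
  assumes V: "valuation_ring V" "e \<pi> \<in> max_ideal V" and T: "\<O> \<subseteq> T" "T \<subseteq> V"
  shows "mI T \<subseteq> max_ideal V"
  unfolding mI_def using small_in_max_ideal[OF V(1) _ V(2)] max_ideal_mult[OF V(1)] T by blast

context
  fixes T assumes T: "is_subring T" "\<O> \<subseteq> T"
begin

lemma mI_subset: "mI T \<subseteq> T"
  unfolding mI_def using subring_mult[OF T(1)] T(2) \<O>_I by force

text \<open>The scalar of largest absolute value works for all members; the others are absorbed by
  factors from \<open>\<O>\<close>.\<close>

lemma mI_common:
  assumes "finite S" "\<And>i. i \<in> S \<Longrightarrow> f i \<in> mI T"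
  shows "\<exists>c g. v c < 1 \<and> (\<forall>i\<in>S. g i \<in> T \<and> f i = e c * g i)"
proof -
  have "\<exists>c. v c < 1 \<and> (\<forall>i\<in>S. \<exists>t\<in>T. f i = e c * t)"
    using assms
  proof (induction S)
    case empty
    show ?case by (rule exI[of _ 0]) (simp add: v_simps(1))
  next
    case (insert x S)
    then obtain c where c: "v c < 1" "\<forall>i\<in>S. \<exists>t\<in>T. f i = e c * t" by auto
    obtain d t where d: "v d < 1" "t \<in> T" "f x = e d * t" using insert unfolding mI_def by blast
    have scale: "\<exists>t'\<in>T. e a * t = e b * t'" if "v a \<le> v b" "t \<in> T" for a b t
    proof (cases "b = 0")
      case True
      then have "a = 0" using that v_simps(1,6,7) by (metis order_antisym)
      then show ?thesis using True e_0 that by auto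
    next
      case False
      have vb: "v b > 0" using False v_simps(6)[of b] v_simps(7)[of b] by linarith
      then have "e (a / b) \<in> T" using that \<O>_I[of "a / b"] T by (auto simp: v_simps)
      then have "e (a / b) * t \<in> T" using that subring_mult[OF T(1)] by blast
      then show ?thesis using False by (rule_tac bexI[of _ "e (a / b) * t"]) (simp_all add: e_divide e_eq_0)
    qed
    show ?case
    proof (cases "v d \<le> v c")
      case True
      then show ?thesis using c d scale[of d c t] by (intro exI[of _ c]) auto
    next
      case False
      have "\<exists>t\<in>T. f i = e d * t" if i: "i \<in> S" for i
      proof -
        obtain t where "t \<in> T" "f i = e c * t" using c i by blast
        then show ?thesis using scale[of c d t] False by auto
      qed
      then show ?thesis using d by (intro exI[of _ d]) auto
    qed
  qed
  then show ?thesis by (metis (no_types, lifting) bchoice)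
qed

lemma mI_ideal:
  shows "0 \<in> mI T" and "x \<in> mI T \<Longrightarrow> y \<in> mI T \<Longrightarrow> x + y \<in> mI T"
    and "x \<in> mI T \<Longrightarrow> t \<in> T \<Longrightarrow> x * t \<in> mI T"
proof -
  show "0 \<in> mI T" using mI_I[of 0 0 T] subring_zero[OF T(1)] by (simp add: v_simps)
  show "x + y \<in> mI T" if "x \<in> mI T" "y \<in> mI T"
  proof -
    obtain c g where "v c < 1" "\<forall>i\<in>{x,y}. g i \<in> T \<and> i = e c * g i"
      using mI_common[of "{x,y}" "\<lambda>i. i"] \<open>x \<in> mI T\<close> \<open>y \<in> mI T\<close> by auto
    then have "x + y = e c * (g x + g y)" "g x + g y \<in> T" "v c < 1"
      using subring_add[OF T(1)] by (auto simp: distrib_left)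
    then show ?thesis using mI_I by metis
  qed
  show "x * t \<in> mI T" if "x \<in> mI T" "t \<in> T"
  proof -
    obtain c s where "x = e c * s" "v c < 1" "s \<in> T" using \<open>x \<in> mI T\<close> unfolding mI_def by blast
    then show ?thesis using mI_I[of c "s * t" T] subring_mult[OF T(1)] \<open>t \<in> T\<close> by (simp add: mult.assoc)
  qed
qed

lemma mI_sum: "(\<And>i. i \<in> S \<Longrightarrow> f i \<in> mI T) \<Longrightarrow> sum f S \<in> mI T"
  by (induction S rule: infinite_finite_induct) (auto intro: mI_ideal)

text \<open>The argument of \<open>integral_over_vr\<close>, with \<open>mI T\<close> in the role of
  the maximal ideal.\<close>

lemma not_integral_if_inverse_in_mI:
  assumes one: "1 \<notin> mI T" and z: "z \<noteq> 0" "inverse z \<in> mI T" shows "\<not> integral_over T z"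
proof
  assume "integral_over T z"
  then obtain n c where c: "\<forall>i<n. c i \<in> T" and eq: "z ^ n + (\<Sum>i<n. c i * z ^ i) = 0"
    unfolding integral_over_def by blast
  have "0 = (z ^ n + (\<Sum>i<n. c i * z ^ i)) * inverse z ^ n" using eq by simp
  also have "\<dots> = 1 + (\<Sum>i<n. c i * inverse z ^ (n - i))"
    unfolding distrib_right sum_distrib_right using z(1)
    by (intro arg_cong2[of _ _ _ _ "(+)"] sum.cong) (auto simp: field_simps power_diff)
  finally have "1 = (\<Sum>i<n. - (c i * inverse z ^ (n - i)))" by (simp add: sum_negf eq_neg_iff_add_eq_0)
  moreover have "- (c i * inverse z ^ (n - i)) \<in> mI T" if "i < n" for i
  proof -
    have "inverse z * (- (inverse z ^ (n - i - 1)) * c i) \<in> mI T"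
      using z c that mI_subset by (intro mI_ideal subring_intros[OF T(1)]) auto
    moreover have "inverse z * (- (inverse z ^ (n - i - 1)) * c i) = - (c i * inverse z ^ (n - i))"
    proof -
      obtain k where "n - i = Suc k" using \<open>i < n\<close> by (cases "n - i") auto
      then show ?thesis by (simp add: mult_ac)
    qed
    ultimately show ?thesis by metis
  qed
  ultimately show False using one mI_sum[of "{..<n}" "\<lambda>i. - (c i * inverse z ^ (n - i))"] by auto
qed

end
end

section \<open>Gauss norms on polynomial rings\<close>

context valued_embedding
begin

text \<open>What is retained of a polynomial ring over the integers of k with its Gauss norm: a
  nonzero element is a scalar times an element of norm 1, and elements of norm 1 are closed under
  products because \<open>mI T\<close> is prime. In this form variables can be adjoined one at a
  time.\<close>

definition gauss_ring :: "'c set \<Rightarrow> bool" where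
  "gauss_ring T \<longleftrightarrow> is_subring T \<and> \<O> \<subseteq> T \<and> normal_ring T \<and>
     (\<forall>t\<in>T. t \<noteq> 0 \<longrightarrow> (\<exists>c. \<exists>t0\<in>T - mI T. t = e c * t0)) \<and> prime_ideal_in T (mI T)"

text \<open>In absolute value, \<open>c\<close> is the largest of the scalars split off from the
  coefficients.\<close>

lemma gauss_content:
  assumes T: "gauss_ring T" and p: "p \<in> polys_over T" "p \<noteq> 0"
  shows "\<exists>c p0. c \<noteq> 0 \<and> p = smult (e c) p0 \<and> p0 \<in> polys_over T - polys_over (mI T)"
proof -
  note T' = T[unfolded gauss_ring_def]
  have "\<forall>i. coeff p i \<noteq> 0 \<longrightarrow> (\<exists>c. \<exists>t0\<in>T - mI T. coeff p i = e c * t0)"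
    using T' polys_overD[OF p(1)] by blast
  then obtain c t where ct: "\<And>i. coeff p i \<noteq> 0 \<Longrightarrow> t i \<in> T - mI T \<and> coeff p i = e (c i) * t i" by metis
  define S where "S = {i. i \<le> degree p \<and> coeff p i \<noteq> 0}"
  have S: "finite S" "S \<noteq> {}" using p(2) leading_coeff_0_iff[of p] unfolding S_def by (auto intro: exI[of _ "degree p"])
  have "Max ((\<lambda>i. v (c i)) ` S) \<in> (\<lambda>i. v (c i)) ` S" by (rule Max_in) (use S in auto)
  then obtain k where k1: "k \<in> S" "Max ((\<lambda>i. v (c i)) ` S) = v (c k)" by auto
  have k: "k \<in> S" "\<And>i. i \<in> S \<Longrightarrow> v (c i) \<le> v (c k)"
    using k1 S(1) unfolding k1(2)[symmetric] by auto
  have ck: "c k \<noteq> 0" using k(1) ct[of k] e_0 by (auto simp: S_def)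
  then have vck: "v (c k) > 0" using v_simps(6)[of "c k"] v_simps(7)[of "c k"] by linarith
  define p0 where "p0 = smult (e (inverse (c k))) p"
  have cf: "coeff p0 i = e (c i / c k) * t i" if "i \<in> S" for i
    using ct[of i] that by (simp add: p0_def S_def e_inverse e_divide e_1 field_simps)
  have "coeff p0 i \<in> T" for i
  proof (cases "i \<in> S")
    case True
    have "e (c i / c k) \<in> T" using k(2)[OF True] vck T' \<O>_I[of "c i / c k"] by (auto simp: v_simps)
    then show ?thesis using cf[OF True] ct[of i] True T' subring_mult[of T] by (auto simp: S_def)
  next
    case False
    then have "coeff p i = 0" by (auto simp: S_def coeff_eq_0)
    then show ?thesis using T' subring_zero[of T] by (simp add: p0_def)
  qed
  moreover have "coeff p0 k \<notin> mI T" using cf[OF k(1)] ct[of k] k(1) ck by (simp add: S_def e_1)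
  moreover have "p = smult (e (c k)) p0" using ck by (simp add: p0_def e_inverse e_eq_0)
  ultimately show ?thesis using ck by (metis DiffI polys_overI polys_overD)
qed

lemma gauss_ring_one:
  assumes T: "gauss_ring T" shows "1 \<notin> mI T"
proof
  note T' = T[unfolded gauss_ring_def]
  assume 1: "1 \<in> mI T"
  obtain t where "t \<in> T - mI T" using T' subring_one[of T] zero_neq_one[where ?'a = 'c] by metis
  moreover have "1 * t \<in> mI T" using T' 1 \<open>t \<in> T - mI T\<close> by (intro mI_ideal(3)) blast+
  ultimately show False by simp
qed

lemma gauss_ring_\<O>: "gauss_ring \<O>"
proof -
  note O = is_subring_\<O>
  have mIO: "mI \<O> = e ` {c. v c < 1}"
  proof
    show "mI \<O> \<subseteq> e ` {c. v c < 1}"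
    proof
      fix x assume "x \<in> mI \<O>"
      then obtain c d where cd: "x = e c * e d" "v c < 1" "v d \<le> 1" by (auto simp: mI_def \<O>_def valring_def)
      have "v c * v d \<le> v c * 1" using cd v_simps(7) by (intro mult_left_mono) auto
      then have "v (c * d) < 1" using cd by (simp add: v_simps)
      then show "x \<in> e ` {c. v c < 1}" unfolding cd(1) e_mult[symmetric] by blast
    qed
    show "e ` {c. v c < 1} \<subseteq> mI \<O>"
      using mI_I[of _ 1 \<O>] subring_one[OF O] by force
  qed
  have inj: "e a = e b \<Longrightarrow> a = b" for a b
    using e_eq_0[of "a - b"] e_add[of a "- b"] by (simp add: e_minus)
  have one: "1 \<notin> mI \<O>"
    unfolding mIO using inj[of 1] e_1 v_simps(2) by force
  have "normal_ring \<O>"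
    unfolding normal_ring_def
  proof (intro ballI impI)
    fix z assume "z \<in> frac \<O>" and int: "integral_over \<O> z"
    then obtain c where c: "z = e c" unfolding frac_def \<O>_def by (auto simp: e_divide[symmetric])
    show "z \<in> \<O>"
    proof (cases "v c \<le> 1")
      case True then show ?thesis using c \<O>_I by simp
    next
      case False
      then have "inverse z \<in> mI \<O>" "z \<noteq> 0" unfolding mIO c
        using v_simps(1) by (auto simp: e_inverse[symmetric] e_eq_0 v_simps inverse_less_1_iff)
      then show ?thesis using not_integral_if_inverse_in_mI[OF O _ one] int by auto
    qed
  qed
  moreover have "\<exists>c. \<exists>t0\<in>\<O> - mI \<O>. t = e c * t0" if "t \<in> \<O>" for t
    using that one subring_one[OF O] unfolding \<O>_def by (metis DiffI imageE mult.right_neutral)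
  moreover have "prime_ideal_in \<O> (mI \<O>)"
    unfolding prime_ideal_in_def
  proof (intro conjI ballI impI)
    fix x y assume "x \<in> \<O>" "y \<in> \<O>" and xy: "x * y \<in> mI \<O>"
    then obtain a b where ab: "x = e a" "y = e b" "v a \<le> 1" "v b \<le> 1" by (auto simp: \<O>_def valring_def)
    obtain c where c: "x * y = e c" "v c < 1" using xy unfolding mIO by auto
    then have "v a * v b < 1" using ab inj[of "a * b" c] v_simps(4)[of a b] by (simp add: e_mult)
    then have "v a < 1 \<or> v b < 1" using ab by (metis mult.right_neutral nless_le)
    then show "x \<in> mI \<O> \<or> y \<in> mI \<O>" unfolding mIO using ab by auto
  qed (use mI_ideal[OF O order_refl] mI_subset[OF O order_refl] in auto)
  ultimately show ?thesis unfolding gauss_ring_def using O by blast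
qed

lemma gauss_ring_adjoin:
  assumes T: "gauss_ring T" and y: "transcendental_over T y"
  shows "gauss_ring (adjoin T y)"
proof -
  note T' = T[unfolded gauss_ring_def]
  have S: "is_subring T" "\<O> \<subseteq> T" using T' by blast+
  note PI = subring_intros[OF subring_polys_over[OF S(1)]]
  have A: "is_subring (adjoin T y)" "\<O> \<subseteq> adjoin T y"
    using is_subring_adjoin[OF S(1)] subset_adjoin[OF S(1)] S by auto
  have inj: "p = q" if "poly p y = poly q y" "p \<in> polys_over T" "q \<in> polys_over T" for p q
    using y that PI(2)[of p q] unfolding transcendental_over_def by force
  \<comment> \<open>The special fibre of \<open>T[y]\<close> is thus a polynomial ring over the
    special fibre of \<open>T\<close>, and Gauss's lemma yields primality.\<close>
  have mI: "poly p y \<in> mI (adjoin T y) \<longleftrightarrow> p \<in> polys_over (mI T)" if p: "p \<in> polys_over T" for p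
  proof
    assume "poly p y \<in> mI (adjoin T y)"
    then obtain c q where cq: "v c < 1" "q \<in> polys_over T" "poly p y = e c * poly q y"
      by (auto simp: mI_def adjoin_def)
    have "e c \<in> T" using \<O>_I[of c] cq S by auto
    then have "p = smult (e c) q" using cq p by (intro inj smult_in_polys_over S) auto
    then show "p \<in> polys_over (mI T)" using cq by (auto simp: polys_over_def intro: mI_I)
  next
    assume "p \<in> polys_over (mI T)"
    then obtain c g where cg: "v c < 1" "\<And>i. i \<le> degree p \<Longrightarrow> g i \<in> T \<and> coeff p i = e c * g i"
      using mI_common[OF S, of "{..degree p}" "coeff p"] polys_overD by (metis atMost_iff finite_atMost)
    define q where "q = (\<Sum>i\<le>degree p. monom (g i) i)"
    have "q \<in> polys_over T" unfolding q_def using cg S(1) by (auto intro!: PI monom_in_polys_over subring_zero)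
    moreover have "poly p y = e c * poly q y"
      unfolding q_def poly_altdef[of p] using cg(2) by (simp add: poly_sum poly_monom sum_distrib_left mult.assoc)
    ultimately show "poly p y \<in> mI (adjoin T y)" using mI_I[OF cg(1)] unfolding adjoin_def by auto
  qed
  have "\<exists>c. \<exists>t0\<in>adjoin T y - mI (adjoin T y). t = e c * t0" if t: "t \<in> adjoin T y" "t \<noteq> 0" for t
  proof -
    obtain p where p: "p \<in> polys_over T" "t = poly p y" using t(1) by (rule adjoinE)
    then have "p \<noteq> 0" using t(2) by auto
    then obtain c p0 where "p = smult (e c) p0" "p0 \<in> polys_over T - polys_over (mI T)"
      using gauss_content[OF T p(1)] by blast
    then show ?thesis using p mI[of p0] unfolding adjoin_def
      by (intro exI[of _ c] bexI[of _ "poly p0 y"]) auto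
  qed
  moreover have "prime_ideal_in (adjoin T y) (mI (adjoin T y))"
    unfolding prime_ideal_in_def
  proof (intro conjI ballI impI)
    fix s t assume "s \<in> adjoin T y" "t \<in> adjoin T y" and st: "s * t \<in> mI (adjoin T y)"
    then obtain p q where pq: "p \<in> polys_over T" "q \<in> polys_over T" "s = poly p y" "t = poly q y"
      by (auto simp: adjoin_def)
    then have "p * q \<in> polys_over (mI T)" using mI[of "p * q"] st PI(3) by auto
    then have "p \<in> polys_over (mI T) \<or> q \<in> polys_over (mI T)"
      using polys_over_prime[OF S(1), of "mI T"] T' pq by blast
    then show "s \<in> mI (adjoin T y) \<or> t \<in> mI (adjoin T y)" using mI pq by blast
  qed (use mI_ideal[OF A] mI_subset[OF A] in auto)
  ultimately show ?thesis
    unfolding gauss_ring_def using A normal_ring_adjoin[OF S(1) _ y] T' by blast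
qed

section \<open>Families of test valuations\<close>

text \<open>The exponent may depend on \<open>b\<close> but not on \<open>V\<close>; valuation rings
  in which \<open>b\<close> is a unit, or which omit \<open>b\<close>, impose no condition.\<close>

definition uniformly_small :: "'c set set \<Rightarrow> 'c \<Rightarrow> bool" where
  "uniformly_small F b \<longleftrightarrow> (\<exists>M. \<forall>V\<in>F. b \<in> max_ideal V \<longrightarrow> b ^ M / e \<pi> \<in> V)"

text \<open>The elements \<open>b\<close> concerned are those integral over \<open>T\<close> after
  inverting \<pi>. Smallness is asked of \<open>inverse b\<close> for the final estimate at
  1/\<alpha>, and of \<open>b\<close> itself for the element \<open>a\<close> in
  \<open>good_ring_quasi_finite\<close>.\<close>

definition good_ring :: "'c set \<Rightarrow> bool" where
  "good_ring T \<longleftrightarrow> (\<exists>F. (\<forall>V\<in>F. valuation_ring V \<and> T \<subseteq> V \<and> e \<pi> \<in> max_ideal V) \<and>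
     (\<forall>b j. integral_over T (e \<pi> ^ j * b) \<longrightarrow>
        ((\<forall>V\<in>F. b \<in> V) \<longrightarrow> integral_over T b) \<and> uniformly_small F b \<and> uniformly_small F (inverse b)))"

section \<open>The local ring of the Gauss norm\<close>

context
  fixes T assumes T: "gauss_ring T"
begin

private lemma T_simps: "is_subring T" "\<O> \<subseteq> T" "normal_ring T" "prime_ideal_in T (mI T)"
  "\<And>t. t \<in> T \<Longrightarrow> t \<noteq> 0 \<Longrightarrow> \<exists>c. \<exists>t0\<in>T - mI T. t = e c * t0"
  using T unfolding gauss_ring_def by auto

text \<open>The localization of \<open>T\<close> at \<open>mI T\<close>, which is the valuation ring
  of the Gauss norm on the fraction field of \<open>T\<close>.\<close>

definition gauss_local :: "'c set" where
  "gauss_local = {s / t |s t. s \<in> T \<and> t \<in> T - mI T}"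

private lemma not_mI_nz: "t \<notin> mI T \<Longrightarrow> t \<noteq> 0"
  using mI_ideal(1)[OF T_simps(1,2)] by auto

private lemma not_mI_mult: "s \<in> T - mI T \<Longrightarrow> t \<in> T - mI T \<Longrightarrow> s * t \<in> T - mI T"
  using T_simps(4) subring_mult[OF T_simps(1)] unfolding prime_ideal_in_def by blast

lemma gauss_local_subring: "is_subring gauss_local" "T \<subseteq> gauss_local" "gauss_local \<subseteq> frac T"
proof -
  have 1: "1 \<in> T - mI T" using gauss_ring_one[OF T] subring_one[OF T_simps(1)] by simp
  show sub: "T \<subseteq> gauss_local" unfolding gauss_local_def using 1 by force
  show "gauss_local \<subseteq> frac T" unfolding gauss_local_def frac_def using not_mI_nz by blast
  show "is_subring gauss_local"
    unfolding is_subring_def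
  proof (intro conjI ballI)
    show "1 \<in> gauss_local" using 1 sub by blast
    fix x y assume "x \<in> gauss_local" "y \<in> gauss_local"
    then obtain a b c d where *: "x = a / b" "y = c / d" "a \<in> T" "b \<in> T - mI T" "c \<in> T" "d \<in> T - mI T"
      unfolding gauss_local_def by blast
    then have "x - y = (a * d - c * b) / (b * d)" "x * y = (a * c) / (b * d)"
      using not_mI_nz by (auto simp: field_simps)
    moreover have "a * d - c * b \<in> T" "b * d \<in> T - mI T" "a * c \<in> T"
      using * subring_intros[OF T_simps(1)] not_mI_mult by auto
    ultimately show "x - y \<in> gauss_local" "x * y \<in> gauss_local" unfolding gauss_local_def by blast+
  qed
qed

text \<open>Write \<open>c = s / t\<close> and \<open>e \<pi> ^ J * c = e d * p0\<close> with
  \<open>t\<close> and \<open>p0\<close> of Gauss norm 1. If \<open>d\<close> were larger than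
  \<open>\<pi> ^ J\<close>, then \<open>t * p0\<close> would be a small scalar multiple of
  \<open>s\<close>, against the multiplicativity of the Gauss norm.\<close>

lemma gauss_hartogs:
  assumes c: "c \<in> frac T" "integral_over gauss_local c" "integral_over (localized T (e \<pi>)) c"
  shows "c \<in> T"
proof (cases "c = 0")
  case True then show ?thesis using subring_zero[OF T_simps(1)] by simp
next
  case c0: False
  note GL = gauss_local_subring
  have OGL: "\<O> \<subseteq> gauss_local" using GL T_simps by auto
  have epiT: "e \<pi> \<in> T" using \<O>_I[of \<pi>] pi_less T_simps by auto
  have one: "1 \<notin> mI gauss_local"
  proof
    assume "1 \<in> mI gauss_local"
    then obtain d s t where "v d < 1" "s \<in> T" "t \<in> T - mI T" "1 = e d * (s / t)"
      unfolding mI_def gauss_local_def by blast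
    then have "t = e d * s" using not_mI_nz[of t] by (auto simp: field_simps)
    then show False using mI_I \<open>v d < 1\<close> \<open>s \<in> T\<close> \<open>t \<in> T - mI T\<close> by auto
  qed
  have "c \<in> gauss_local"
  proof -
    obtain p q where pq: "c = p / q" "p \<in> T" "q \<in> T" "q \<noteq> 0" "p \<noteq> 0"
      using c(1) c0 unfolding frac_def by auto
    obtain a p0 where p0: "p0 \<in> T - mI T" "p = e a * p0" using T_simps(5) pq by blast
    obtain b q0 where q0: "q0 \<in> T - mI T" "q = e b * q0" using T_simps(5) pq by blast
    have ab: "a \<noteq> 0" "b \<noteq> 0" using pq p0 q0 e_0 by auto
    have va: "v a > 0" "v b > 0" using ab v_simps(6,7) by (metis order_le_less)+
    show ?thesis
    proof (cases "v a \<le> v b")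
      case True
      then have "e (a / b) \<in> T" using \<O>_I[of "a / b"] va T_simps by (auto simp: v_simps)
      then have "e (a / b) * p0 \<in> T" using p0 subring_mult[OF T_simps(1)] by blast
      moreover have "c = (e (a / b) * p0) / q0" using pq(1) p0 q0 by (simp add: e_divide)
      ultimately show ?thesis using q0 unfolding gauss_local_def by blast
    next
      case False
      then have "v (b / a) < 1" using va by (simp add: v_simps)
      moreover have "q0 / p0 \<in> gauss_local" using p0 q0 unfolding gauss_local_def by blast
      moreover have "inverse c = e (b / a) * (q0 / p0)" using pq(1) p0 q0 by (simp add: e_divide)
      ultimately have "inverse c \<in> mI gauss_local" using mI_I by metis
      then show ?thesis using not_integral_if_inverse_in_mI[OF GL(1) OGL one c0] c(2) by blast
    qed
  qed
  then obtain s t where st: "c = s / t" "s \<in> T" "t \<in> T - mI T" unfolding gauss_local_def by blast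
  obtain J where "integral_over T (e \<pi> ^ J * c)"
    using integral_over_localized[OF T_simps(1) epiT c(3)] by blast
  moreover have "e \<pi> ^ J * c \<in> frac T"
    using subset_frac[OF T_simps(1)] epiT is_subring_frac[OF T_simps(1)]
    by (intro subring_mult subring_power c(1)) auto
  ultimately have "e \<pi> ^ J * c \<in> T" using T_simps(3) unfolding normal_ring_def by blast
  then obtain d p0 where p0: "p0 \<in> T - mI T" "e \<pi> ^ J * c = e d * p0"
    using T_simps(5) c0 pi_nz by (metis mult_eq_0_iff power_not_zero)
  have d0: "d \<noteq> 0" using p0(2) c0 pi_nz e_0 by auto
  show ?thesis
  proof (cases "v d \<le> v (\<pi> ^ J)")
    case True
    have "v (\<pi> ^ J) > 0" using pi_pos by (simp add: v_simps)
    then have "e (d / \<pi> ^ J) \<in> T" using True \<O>_I[of "d / \<pi> ^ J"] T_simps by (auto simp: v_simps)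
    then have "e (d / \<pi> ^ J) * p0 \<in> T" using p0 subring_mult[OF T_simps(1)] by blast
    moreover have "c = e (d / \<pi> ^ J) * p0" using p0(2) pi_nz by (simp add: e_divide e_power field_simps)
    ultimately show ?thesis by simp
  next
    case False
    have vd: "v d > 0" using d0 v_simps(6,7) by (metis order_le_less)
    then have "v (\<pi> ^ J / d) < 1" using False by (simp add: v_simps)
    then have "e (\<pi> ^ J / d) * s \<in> mI T" using st mI_I by blast
    moreover have "e (\<pi> ^ J / d) * s = t * p0"
    proof -
      have "s = t * c" using st not_mI_nz[of t] by simp
      then have "e (\<pi> ^ J / d) * s = t * ((e \<pi> ^ J * c) / e d)" by (simp add: e_divide e_power)
      then show ?thesis using p0(2) d0 by (simp add: e_eq_0)
    qed
    ultimately show ?thesis using not_mI_mult[of t p0] st p0 by auto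
  qed
qed

end

end

lemma vr_power_mult: "valuation_ring V \<Longrightarrow> x \<in> V \<Longrightarrow> y \<in> V \<Longrightarrow> x ^ n * y \<in> V"
  by (simp add: vr_intros)

lemma vr_cancel_power:
  assumes V: "valuation_ring V" and u: "u \<noteq> 0" "inverse u \<in> V" and b: "u ^ j * b \<in> V"
  shows "b \<in> V"
proof -
  have "inverse u ^ j * (u ^ j * b) \<in> V" by (intro vr_intros[OF V] u b)
  then show ?thesis using u(1) by (simp add: mult.assoc[symmetric] power_mult_distrib[symmetric])
qed

context valued_embedding
begin

lemma good_ringI:
  assumes "\<And>V. V \<in> F \<Longrightarrow> valuation_ring V \<and> T \<subseteq> V \<and> e \<pi> \<in> max_ideal V"
    and "\<And>b j. integral_over T (e \<pi> ^ j * b) \<Longrightarrow> \<forall>V\<in>F. b \<in> V \<Longrightarrow> integral_over T b"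
    and "\<And>b j. integral_over T (e \<pi> ^ j * b) \<Longrightarrow> uniformly_small F b \<and> uniformly_small F (inverse b)"
  shows "good_ring T"
  unfolding good_ring_def using assms
  by (intro exI[of _ F] conjI ballI allI impI) simp_all

text \<open>Let \<open>i0\<close> be the lowest position of a coefficient of Gauss norm 1. Where
  \<open>b\<close> lies in the maximal ideal, the terms from \<open>i0\<close> on are
  \<open>b ^ i0\<close> times a unit, while the lower ones add up to a multiple of
  \<open>e c\<close> with \<open>v c < 1\<close>. So \<open>b ^ i0\<close> is a multiple of
  \<open>e c\<close>, where \<open>i0\<close> and \<open>c\<close> come from \<open>f\<close> and
  not from \<open>V\<close>.\<close>

lemma uniformly_small_of_relation:
  assumes T: "gauss_ring T" and f: "f \<in> polys_over T - polys_over (mI T)" "poly f b = 0"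
    and F: "\<And>V. V \<in> F \<Longrightarrow> valuation_ring V \<and> gauss_local T \<subseteq> V \<and> e \<pi> \<in> max_ideal V"
  shows "uniformly_small F b"
proof -
  have S: "is_subring T" "\<O> \<subseteq> T" using T unfolding gauss_ring_def by blast+
  define i0 where "i0 = (LEAST i. coeff f i \<notin> mI T)"
  have ex: "\<exists>i. coeff f i \<notin> mI T" using f(1) unfolding polys_over_def by blast
  have i0: "coeff f i0 \<notin> mI T" unfolding i0_def by (rule LeastI_ex[OF ex])
  have low: "coeff f i \<in> mI T" if "i < i0" for i using that not_less_Least unfolding i0_def by blast
  have fT: "coeff f i \<in> T" for i using f(1) polys_overD by blast
  have ideg: "i0 \<le> degree f" using i0 mI_ideal(1)[OF S] coeff_eq_0[of f i0] by fastforce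
  obtain c g where cg: "v c < 1" "\<And>i. i < i0 \<Longrightarrow> g i \<in> T \<and> coeff f i = e c * g i"
    using mI_common[OF S, of "{..<i0}" "coeff f"] low by (metis finite_lessThan lessThan_iff)
  obtain M where M: "v (c ^ M / \<pi>) \<le> 1" using archimedean[OF cg(1)] by blast
  have "b ^ (i0 * M) / e \<pi> \<in> V" if VF: "V \<in> F" and b: "b \<in> max_ideal V" for V
  proof -
    have V: "valuation_ring V" "gauss_local T \<subseteq> V" "e \<pi> \<in> max_ideal V" using F[OF VF] by auto
    note I = vr_intros[OF V(1)]
    have TV: "T \<subseteq> V" using gauss_local_subring(2)[OF T] V by blast
    have bV: "b \<in> V" using max_ideal_subset[OF V(1) b] .
    define w where "w = (\<Sum>i=i0..degree f. coeff f i * b ^ (i - i0))"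
    define z where "z = - (\<Sum>i<i0. g i * b ^ i)"
    have "w = coeff f i0 + (\<Sum>i=Suc i0..degree f. coeff f i * b ^ (i - i0))"
      unfolding w_def by (subst sum.atLeast_Suc_atMost[OF ideg]) simp
    moreover have "(\<Sum>i=Suc i0..degree f. coeff f i * b ^ (i - i0)) \<in> max_ideal V"
    proof (rule max_ideal_sum[OF V(1)])
      fix i assume i: "i \<in> {Suc i0..degree f}"
      then obtain k where k: "i - i0 = Suc k" by (cases "i - i0") auto
      have "b * (b ^ k * coeff f i) \<in> max_ideal V"
        using fT TV bV by (intro max_ideal_mult[OF V(1) b] I) auto
      then show "coeff f i * b ^ (i - i0) \<in> max_ideal V" unfolding k by (simp add: mult_ac)
    qed
    \<comment> \<open>Elements of Gauss norm 1 are units in \<open>gauss_local T\<close>, hence in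
      every member of \<open>F\<close>.\<close>
    moreover have "coeff f i0 \<notin> max_ideal V"
    proof -
      have "1 / coeff f i0 \<in> gauss_local T"
        using i0 fT subring_one[OF S(1)] unfolding gauss_local_def[OF T] by blast
      then show ?thesis using V(2) i0 mI_ideal(1)[OF S] by (auto simp: max_ideal_def field_simps)
    qed
    ultimately have wm: "w \<notin> max_ideal V"
      using max_ideal_add[OF V(1), of w "- (\<Sum>i=Suc i0..degree f. coeff f i * b ^ (i - i0))"]
        max_ideal_uminus[OF V(1)] by force
    have w: "w \<noteq> 0" "inverse w \<in> V" using wm by (auto simp: max_ideal_def)
    have zV: "z \<in> V" unfolding z_def using cg(2) TV bV by (intro I) auto
    have "0 = poly f b" using f(2) by simp
    also have "\<dots> = (\<Sum>i<i0. coeff f i * b ^ i) + (\<Sum>i=i0..degree f. coeff f i * b ^ i)"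
      unfolding poly_altdef using ideg
      by (subst sum.union_disjoint[symmetric]) (auto intro!: sum.cong)
    also have "(\<Sum>i=i0..degree f. coeff f i * b ^ i) = b ^ i0 * w"
      unfolding w_def sum_distrib_left by (rule sum.cong) (auto simp: power_add[symmetric] mult.left_commute)
    also have "(\<Sum>i<i0. coeff f i * b ^ i) = - (e c * z)"
      unfolding z_def using cg(2) by (simp add: sum_distrib_left mult.assoc)
    finally have "b ^ i0 * w = e c * z" by simp
    then have "b ^ i0 = e c * (z * inverse w)" using w by (simp add: field_simps)
    then have "b ^ (i0 * M) / e \<pi> = e (c ^ M / \<pi>) * (z * inverse w) ^ M"
      by (simp add: power_mult power_mult_distrib e_divide e_power)
    moreover have "e (c ^ M / \<pi>) \<in> V" using \<O>_I[OF M] S TV by blast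
    ultimately show ?thesis using zV w by (simp add: I)
  qed
  then show ?thesis unfolding uniformly_small_def by blast
qed

lemma good_ring_if_gauss_ring:
  assumes T: "gauss_ring T" shows "good_ring T"
proof -
  have S: "is_subring T" "\<O> \<subseteq> T" using T unfolding gauss_ring_def by blast+
  note I = subring_intros[OF S(1)] and GL = gauss_local_subring[OF T]
  have epi: "e \<pi> \<in> T" using \<O>_I[of \<pi>] pi_less S by auto
  define F where "F = {V. valuation_ring V \<and> gauss_local T \<subseteq> V \<and> e \<pi> \<in> max_ideal V}"
  have F: "valuation_ring V \<and> gauss_local T \<subseteq> V \<and> e \<pi> \<in> max_ideal V" if "V \<in> F" for V
    using that unfolding F_def by blast
  \<comment> \<open>The monic equation of \<open>e \<pi> ^ j * b\<close> is read as an equation of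
    \<open>b\<close> whose leading coefficient is a power of \<pi>; dividing by the content makes it
    primitive.\<close>
  have rel: "\<exists>f. f \<in> polys_over T - polys_over (mI T) \<and> poly f b = 0" if int: "integral_over T (e \<pi> ^ j * b)" for b j
  proof -
    obtain n c where c: "\<forall>i<n. c i \<in> T" and eq: "(e \<pi> ^ j * b) ^ n + (\<Sum>i<n. c i * (e \<pi> ^ j * b) ^ i) = 0"
      using int unfolding integral_over_def by blast
    define f where "f = monom ((e \<pi> ^ j) ^ n) n + (\<Sum>i<n. monom (c i * (e \<pi> ^ j) ^ i) i)"
    have "f \<in> polys_over T" unfolding f_def using c epi
      by (auto intro!: subring_intros[OF subring_polys_over[OF S(1)]] monom_in_polys_over I)
    moreover have "coeff f n \<noteq> 0" using pi_nz by (simp add: f_def coeff_sum)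
    then have "f \<noteq> 0" by auto
    ultimately obtain c p0 where p0: "c \<noteq> 0" "f = smult (e c) p0" "p0 \<in> polys_over T - polys_over (mI T)"
      using gauss_content[OF T] by blast
    have "poly f b = 0" using eq by (simp add: f_def poly_sum poly_monom power_mult_distrib mult.assoc)
    then have "poly p0 b = 0" using p0 by (simp add: e_eq_0)
    then show ?thesis using p0 by blast
  qed
  have "integral_over T b" if int: "integral_over T (e \<pi> ^ j * b)" and b: "\<forall>V\<in>F. b \<in> V" for b j
  proof -
    define L where "L = localized T (e \<pi>)"
    have Lsub: "is_subring L" "T \<subseteq> L"
      unfolding L_def using subring_localized[OF S(1) epi] subset_localized by auto
    have LF: "L \<subseteq> frac T"
    proof
      fix z assume "z \<in> L"
      then obtain m where m: "e \<pi> ^ m * z \<in> T" unfolding L_def localized_def by blast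
      have "z = (e \<pi> ^ m * z) / e \<pi> ^ m" using pi_nz by simp
      moreover have "e \<pi> ^ m \<in> T" "e \<pi> ^ m \<noteq> 0" using epi I pi_nz by auto
      ultimately show "z \<in> frac T" unfolding frac_def using m by blast
    qed
    have divide: "b \<in> V" if V: "valuation_ring V" "T \<subseteq> V" "inverse (e \<pi>) \<in> V" for V
    proof -
      have "e \<pi> ^ j * b \<in> V" using integral_imp_in_vr[OF int V(1,2)] .
      then show ?thesis by (rule vr_cancel_power[OF V(1) pi_nz(2) V(3)])
    qed
    have intL: "integral_over L b"
    proof (rule integral_if_in_all_vr[OF Lsub(1)])
      fix V assume V: "valuation_ring V" "L \<subseteq> V"
      have "inverse (e \<pi>) \<in> L" unfolding L_def localized_def using pi_nz I(1) by (auto intro!: exI[of _ 1])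
      then show "b \<in> V" using divide V Lsub by blast
    qed
    have intO: "integral_over (gauss_local T) b"
    proof (rule integral_if_in_all_vr[OF GL(1)])
      fix V assume V: "valuation_ring V" "gauss_local T \<subseteq> V"
      show "b \<in> V"
      \<comment> \<open>If \<pi> is a unit in \<open>V\<close>, integrality of
        \<open>e \<pi> ^ j * b\<close> already gives \<open>b \<in> V\<close>; otherwise
        \<open>V\<close> belongs to \<open>F\<close>.\<close>
      proof (cases "e \<pi> \<in> max_ideal V")
        case True then show ?thesis using b V unfolding F_def by blast
      next
        case False then show ?thesis using divide[OF V(1)] GL(2) V(2) by (auto simp: max_ideal_def)
      qed
    qed
    obtain Q where Q: "Q \<in> polys_over (frac T)" "lead_coeff Q = 1" "poly Q b = 0"
      "\<And>f. f \<in> polys_over (frac T) \<Longrightarrow> poly f b = 0 \<Longrightarrow> Q dvd f"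
      using minimal_polynomial[OF S(1) integral_over_mono[OF intL LF]] by blast
    have "coeff Q i \<in> T" for i
    proof (rule gauss_hartogs[OF T])
      show "coeff Q i \<in> frac T" using Q(1) by (rule polys_overD)
      show "integral_over (gauss_local T) (coeff Q i)"
        by (rule minimal_polynomial_coeffs_integral[OF GL(1,3) intO Q(2,4)])
      show "integral_over (localized T (e \<pi>)) (coeff Q i)"
        using minimal_polynomial_coeffs_integral[OF Lsub(1) LF intL Q(2,4)] unfolding L_def .
    qed
    then have "Q \<in> polys_over T" by (rule polys_overI)
    then show "integral_over T b" using Q(2,3) integral_over_iff_monic[OF S(1)] by blast
  qed
  moreover have "uniformly_small F b \<and> uniformly_small F (inverse b)" if "integral_over T (e \<pi> ^ j * b)" for b j
  proof
    obtain f where f: "f \<in> polys_over T - polys_over (mI T)" "poly f b = 0" using rel \<open>integral_over T (e \<pi> ^ j * b)\<close> by blast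
    show *: "uniformly_small F b" by (rule uniformly_small_of_relation[OF T f F])
    show "uniformly_small F (inverse b)"
    proof (cases "b = 0")
      case True then show ?thesis using * by simp
    next
      case False
      obtain i where i: "coeff f i \<notin> mI T" using f(1) unfolding polys_over_def by blast
      have "i \<le> degree f" using i mI_ideal(1)[OF S] coeff_eq_0[of f i] by fastforce
      \<comment> \<open>The reciprocal polynomial is again primitive and has
        \<open>inverse b\<close> as a root.\<close>
      then have "coeff (reflect_poly f) (degree f - i) \<notin> mI T" using i by (subst coeff_reflect_poly) auto
      moreover have "reflect_poly f \<in> polys_over T"
        using f(1) I(4) by (auto simp: polys_over_def coeff_reflect_poly)
      moreover have "poly (reflect_poly f) (inverse b) = 0"
        using False f(2) by (simp add: poly_reflect_poly_nz)
      ultimately show ?thesis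
        by (intro uniformly_small_of_relation[OF T _ _ F, of "reflect_poly f"]) (auto dest: polys_overD)
    qed
  qed
  moreover have "valuation_ring V \<and> T \<subseteq> V \<and> e \<pi> \<in> max_ideal V" if "V \<in> F" for V
    using F[OF that] GL(2) by blast
  ultimately show ?thesis by (intro good_ringI[of F]) blast+
qed

text \<open>After inverting \<pi> and \<open>a\<close>, the rings \<open>T\<close> and
  \<open>T[x]\<close> have the same integral closure, \<open>x\<close> being the quotient of
  \<open>a * x\<close> by \<open>a\<close>. On the special fibre of \<open>T[x]\<close> the element
  \<open>a\<close> reduces to a unit constant and can be cancelled. A member of \<open>F\<close>
  that omits \<open>x\<close> has \<open>a\<close> in its maximal ideal, and there uniform smallness
  trades powers of \<open>a\<close> for powers of \<pi>.\<close>

lemma good_ring_quasi_finite: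
  assumes good: "good_ring T" and S: "is_subring T" "\<O> \<subseteq> T"
    and a: "integral_over T a" "integral_over T (a * x)"
    and unit: "v c = 1" "a - e c \<in> mI (adjoin T x)"
  shows "good_ring (adjoin T x)"
proof -
  define R where "R = adjoin T x"
  have R: "is_subring R" "T \<subseteq> R" "\<O> \<subseteq> R" "x \<in> R"
    unfolding R_def using is_subring_adjoin[OF S(1)] subset_adjoin[OF S(1)] adjoin_self[OF S(1)] S(2) by blast+
  have epi: "e \<pi> \<in> T" "e \<pi> \<in> R" using \<O>_I[of \<pi>] pi_less S R by auto
  obtain F where F: "\<And>V. V \<in> F \<Longrightarrow> valuation_ring V \<and> T \<subseteq> V \<and> e \<pi> \<in> max_ideal V"
    and F1: "\<And>b j. integral_over T (e \<pi> ^ j * b) \<Longrightarrow> (\<And>V. V \<in> F \<Longrightarrow> b \<in> V) \<Longrightarrow> integral_over T b"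
    and F2: "\<And>b j. integral_over T (e \<pi> ^ j * b) \<Longrightarrow> uniformly_small F b \<and> uniformly_small F (inverse b)"
    using good unfolding good_ring_def by metis
  define G where "G = {V\<in>F. x \<in> V}"
  have RV: "R \<subseteq> V" if "valuation_ring V" "T \<subseteq> V" "x \<in> V" for V
    unfolding R_def using adjoin_minimal[OF vr_subring] that by blast
  have a_unit: "a \<in> V \<and> a \<noteq> 0 \<and> inverse a \<in> V" if V: "valuation_ring V" "R \<subseteq> V" "e \<pi> \<in> max_ideal V" for V
  proof -
    have OV: "\<O> \<subseteq> V" using R V by blast
    have 1: "a - e c \<in> max_ideal V"
      using mI_subset_max_ideal[OF V(1,3) R(3) V(2)] unit(2) unfolding R_def by blast
    have "inverse (e c) \<in> V" using e_in_valuation_ring_iff[OF V(1) OV V(3), of "inverse c"] unit(1)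
      by (simp add: v_simps e_inverse)
    moreover have "e c \<noteq> 0" using unit(1) v_simps(1) by (auto simp: e_eq_0)
    ultimately have "e c \<notin> max_ideal V" by (simp add: max_ideal_def)
    then have "a \<notin> max_ideal V"
      using max_ideal_add[OF V(1) _ max_ideal_uminus[OF V(1) 1], of a] by auto
    moreover have "a \<in> V" using integral_imp_in_vr[OF a(1) V(1)] R V by blast
    ultimately show ?thesis by (auto simp: max_ideal_def)
  qed
  define T' where "T' = localized T (e \<pi>)"
  \<comment> \<open>The integral closure of \<open>T'\<close>, written as an intersection of
    valuation rings.\<close>
  define C where "C = \<Inter>{V. valuation_ring V \<and> T' \<subseteq> V}"
  have T': "is_subring T'" "T \<subseteq> T'"
    unfolding T'_def using subring_localized[OF S(1) epi(1)] subset_localized by auto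
  have Csub: "is_subring C" unfolding C_def by (intro is_subring_Inter) (auto intro: vr_subring)
  have T'C: "T' \<subseteq> C" unfolding C_def by blast
  have aC: "a \<in> C" "a * x \<in> C"
    unfolding C_def using a integral_imp_in_vr T'(2) by blast+
  \<comment> \<open>Since \<open>R\<close> lies in \<open>C[1/a]\<close>, so that \<open>b\<close>
    is integral over it, powers of \<open>a\<close> and then of \<pi> clear the denominators in
    turn.\<close>
  have clear: "\<exists>D j'. integral_over T (e \<pi> ^ j' * (a ^ D * b))" if int: "integral_over R (e \<pi> ^ j * b)" for b j
  proof -
    define E where "E = localized C a"
    have E: "is_subring E" "C \<subseteq> E" unfolding E_def
      using subring_localized[OF Csub aC(1)] subset_localized by auto
    have "x \<in> E" unfolding E_def localized_def using aC by (auto intro: exI[of _ 1])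
    then have RE: "R \<subseteq> E" unfolding R_def using adjoin_minimal[OF E(1)] T' T'C E by blast
    have "integral_over E b"
    proof (rule integral_if_in_all_vr[OF E(1)])
      fix V assume V: "valuation_ring V" "E \<subseteq> V"
      have "inverse (e \<pi>) \<in> T'" unfolding T'_def localized_def using pi_nz subring_one[OF S(1)]
        by (auto intro!: exI[of _ 1])
      then have p: "inverse (e \<pi>) \<in> V" using T'C E V by blast
      have "e \<pi> ^ j * b \<in> V" using integral_imp_in_vr[OF int V(1)] RE V by blast
      then show "b \<in> V" by (rule vr_cancel_power[OF V(1) pi_nz(2) p])
    qed
    then obtain D where D: "integral_over C (a ^ D * b)"
      using integral_over_localized[OF Csub aC(1)] unfolding E_def by blast
    have "integral_over T' (a ^ D * b)"
    proof (rule integral_if_in_all_vr[OF T'(1)])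
      fix V assume V: "valuation_ring V" "T' \<subseteq> V"
      then have "C \<subseteq> V" unfolding C_def by blast
      then show "a ^ D * b \<in> V" using integral_imp_in_vr[OF D V(1)] by blast
    qed
    then show ?thesis using integral_over_localized[OF S(1) epi(1)] unfolding T'_def by blast
  qed
  have Gval: "valuation_ring V \<and> R \<subseteq> V \<and> e \<pi> \<in> max_ideal V" if "V \<in> G" for V
    using that F RV unfolding G_def by blast
  have "integral_over R b" if int: "integral_over R (e \<pi> ^ j * b)" and bG: "\<forall>V\<in>G. b \<in> V" for b j
  proof -
    obtain D j' where D: "integral_over T (e \<pi> ^ j' * (a ^ D * b))" using clear[OF int] by blast
    have "integral_over T (e \<pi> ^ 0 * a)" using a(1) by simp
    then obtain M where M: "\<And>V. V \<in> F \<Longrightarrow> a \<in> max_ideal V \<Longrightarrow> a ^ M / e \<pi> \<in> V"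
      using F2 unfolding uniformly_small_def by blast
    \<comment> \<open>At the members with \<open>a\<close> in the maximal ideal each factor
      \<open>a ^ M\<close> makes up for one factor \<pi>, and \<open>j'\<close> of these have to be
      removed.\<close>
    define h where "h = a ^ (M * j') * (a ^ D * b)"
    have aV: "a \<in> V" if "valuation_ring V" "T \<subseteq> V" for V
      using integral_imp_in_vr[OF a(1)] that by blast
    have "integral_over T h"
    proof (rule F1)
      show "integral_over T (e \<pi> ^ j' * h)"
      proof (rule integral_if_in_all_vr[OF S(1)])
        fix V assume V: "valuation_ring V" "T \<subseteq> V"
        have "a ^ (M * j') * (e \<pi> ^ j' * (a ^ D * b)) \<in> V"
          using integral_imp_in_vr[OF D V] aV[OF V] by (rule_tac vr_power_mult[OF V(1)])
        then show "e \<pi> ^ j' * h \<in> V" by (simp add: h_def mult_ac)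
      qed
      fix V assume VF: "V \<in> F"
      then have V: "valuation_ring V" "T \<subseteq> V" "e \<pi> \<in> max_ideal V" using F by auto
      show "h \<in> V"
      proof (cases "a \<in> max_ideal V")
        case True
        have "(a ^ M / e \<pi>) ^ j' * (e \<pi> ^ j' * (a ^ D * b)) \<in> V"
          using integral_imp_in_vr[OF D V(1,2)] M[OF VF True] by (rule_tac vr_power_mult[OF V(1)])
        moreover have "(a ^ M / e \<pi>) ^ j' * (e \<pi> ^ j' * (a ^ D * b)) = h"
          using pi_nz by (simp add: h_def power_divide power_mult)
        ultimately show ?thesis by simp
      next
        case False
        then have ia: "a \<noteq> 0" "inverse a \<in> V" by (auto simp: max_ideal_def)
        have "inverse a * (a * x) \<in> V"
          by (rule vr_intros(3)[OF V(1) ia(2) integral_imp_in_vr[OF a(2) V(1,2)]])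
        then have "x \<in> V" using ia(1) by (simp add: mult.assoc[symmetric])
        then have "b \<in> V" using VF bG unfolding G_def by blast
        then show ?thesis unfolding h_def using aV[OF V(1,2)] by (intro vr_power_mult[OF V(1)])
      qed
    qed
    show ?thesis
    proof (rule integral_if_in_all_vr[OF R(1)])
      fix V assume V: "valuation_ring V" "R \<subseteq> V"
      show "b \<in> V"
      proof (cases "e \<pi> \<in> max_ideal V")
        case True
        have a': "a \<noteq> 0" "inverse a \<in> V" using a_unit[OF V True] by auto
        have "h \<in> V" using integral_imp_in_vr[OF \<open>integral_over T h\<close> V(1)] R V by blast
        then have "inverse a ^ (M * j') * (inverse a ^ D * h) \<in> V" using a'(2) by (intro vr_power_mult[OF V(1)])
        moreover have "inverse a ^ (M * j') * (inverse a ^ D * h) = b"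
          using a'(1) by (simp add: h_def field_simps)
        ultimately show ?thesis by simp
      next
        case False
        then have p: "inverse (e \<pi>) \<in> V" by (auto simp: max_ideal_def)
        have "e \<pi> ^ j * b \<in> V" using integral_imp_in_vr[OF int V] .
        then show "b \<in> V" by (rule vr_cancel_power[OF V(1) pi_nz(2) p])
      qed
    qed
  qed
  moreover have "uniformly_small G b \<and> uniformly_small G (inverse b)" if int: "integral_over R (e \<pi> ^ j * b)" for b j
  proof -
    obtain D j' where D: "integral_over T (e \<pi> ^ j' * (a ^ D * b))" using clear[OF int] by blast
    \<comment> \<open>In every member of \<open>G\<close> the elements \<open>b'\<close> and
      \<open>u * b'\<close> differ by a unit, so an exponent for one serves for the other.\<close>
    have *: "uniformly_small G b'" if sm: "uniformly_small F (u * b')"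
      and u: "\<And>V. V \<in> G \<Longrightarrow> u \<in> V \<and> u \<noteq> 0 \<and> inverse u \<in> V" for b' u
    proof -
      obtain M where M: "\<And>V. V \<in> F \<Longrightarrow> u * b' \<in> max_ideal V \<Longrightarrow> (u * b') ^ M / e \<pi> \<in> V"
        using sm unfolding uniformly_small_def by blast
      have "b' ^ M / e \<pi> \<in> V" if VG: "V \<in> G" and b': "b' \<in> max_ideal V" for V
      proof -
        have V: "valuation_ring V" "V \<in> F" using Gval VG unfolding G_def by auto
        have uu: "u \<in> V" "u \<noteq> 0" "inverse u \<in> V" using u[OF VG] by auto
        have "u * b' \<in> max_ideal V" using max_ideal_mult[OF V(1) b' uu(1)] by (simp add: mult.commute)
        then have "inverse u ^ M * ((u * b') ^ M / e \<pi>) \<in> V"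
          using M[OF V(2)] uu by (intro vr_power_mult[OF V(1)])
        moreover have "inverse u ^ M * ((u * b') ^ M / e \<pi>) = b' ^ M / e \<pi>"
          using uu(2) by (simp add: power_mult_distrib field_simps)
        ultimately show ?thesis by metis
      qed
      then show ?thesis unfolding uniformly_small_def by blast
    qed
    have u: "a ^ D \<in> V \<and> a ^ D \<noteq> 0 \<and> inverse (a ^ D) \<in> V" if "V \<in> G" for V
      using a_unit[of V] Gval[OF that] vr_intros(7)[of V] by (auto simp: power_inverse[symmetric])
    have "uniformly_small F (inverse (a ^ D) * inverse b)" using F2[OF D] by (simp add: mult.commute)
    then have "uniformly_small G (inverse b)" using u by (rule_tac *[of "inverse (a ^ D)"]) auto
    then show ?thesis using *[of "a ^ D" b] F2[OF D] u by blast
  qed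
  ultimately show ?thesis using Gval unfolding R_def[symmetric] by (intro good_ringI[of G]) blast+
qed

text \<open>The leading tail of \<open>P\<close> is integral over \<open>T\<close>, as in Peskine's proof of Zariski's main theorem.\<close>

lemma weierstrass_tail:
  fixes P :: "'c poly"
  assumes S: "is_subring T" "\<O> \<subseteq> T" and P: "P \<in> polys_over T" "poly P x = 0"
    and m: "v c = 1" "coeff P m - e c \<in> mI T" "\<And>j. j > m \<Longrightarrow> coeff P j \<in> mI T"
  shows "\<exists>a. integral_over T a \<and> integral_over T (a * x) \<and> a - e c \<in> mI (adjoin T x)"
proof -
  \<comment> \<open>The maximum keeps \<open>m\<close> in the range of summation even if the
    coefficient of \<open>P\<close> there vanishes, which can happen when \<open>mI T\<close> is all
    of \<open>T\<close>.\<close>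
  define N where "N = max m (degree P)"
  define a where "a = (\<Sum>i=m..N. coeff P i * x ^ (i - m))"
  define d where "d = - (\<Sum>i<m. coeff P i * x ^ i)"
  have PT: "coeff P i \<in> T" for i using P(1) by (rule polys_overD)
  have "poly P x = (\<Sum>i\<le>N. coeff P i * x ^ i)"
    unfolding poly_altdef N_def by (rule sum.mono_neutral_left) (auto simp: coeff_eq_0)
  also have "\<dots> = (\<Sum>i<m. coeff P i * x ^ i) + (\<Sum>i=m..N. coeff P i * x ^ i)"
    by (subst sum.union_disjoint[symmetric]) (auto intro!: sum.cong simp: N_def)
  also have "(\<Sum>i=m..N. coeff P i * x ^ i) = x ^ m * a"
    unfolding a_def sum_distrib_left by (rule sum.cong) (auto simp: power_add[symmetric] mult.left_commute)
  finally have xa: "x ^ m * a = d" using P(2) by (simp add: d_def algebra_simps eq_neg_iff_add_eq_0)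
  \<comment> \<open>For \<open>x \<in> V\<close> the definition of \<open>a\<close> suffices.
    Otherwise \<open>x ^ m * a = d\<close> writes \<open>a\<close> as a polynomial in
    \<open>inverse x\<close> without constant term, so that \<open>a * x\<close> is still a
    polynomial in \<open>inverse x\<close>.\<close>
  have key: "a \<in> V \<and> a * x \<in> V" if V: "valuation_ring V" "T \<subseteq> V" for V
  proof (cases "x \<in> V")
    case True
    then have "a \<in> V" unfolding a_def using PT V by (intro vr_intros[OF V(1)]) auto
    then show ?thesis using True vr_intros(3)[OF V(1)] by blast
  next
    case False
    then have x: "x \<noteq> 0" "inverse x \<in> V" using not_in_iff[OF V(1)] max_ideal_subset[OF V(1)] by auto
    have "a = inverse x ^ m * d" using xa x(1) by (simp add: field_simps)
    also have "\<dots> = - (\<Sum>i<m. coeff P i * inverse x ^ (m - i))"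
      unfolding d_def mult_minus_right sum_distrib_left using x(1)
      by (intro arg_cong[of _ _ uminus] sum.cong) (auto simp: field_simps power_diff)
    finally have a: "a = - (\<Sum>i<m. coeff P i * inverse x ^ (m - i))" .
    have "a * x = - (\<Sum>i<m. coeff P i * inverse x ^ (m - i - 1))"
      unfolding a mult_minus_left sum_distrib_right using x(1)
      by (intro arg_cong[of _ _ uminus] sum.cong) (auto simp: field_simps power_diff)
    then show ?thesis using a x PT V by (auto intro!: vr_intros[OF V(1)])
  qed
  define R where "R = adjoin T x"
  have R: "is_subring R" "T \<subseteq> R" "\<O> \<subseteq> R" "x \<in> R"
    unfolding R_def using is_subring_adjoin[OF S(1)] subset_adjoin[OF S(1)] adjoin_self[OF S(1)] S(2) by blast+
  have "a - e c = (coeff P m - e c) + (\<Sum>i=Suc m..N. coeff P i * x ^ (i - m))"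
    unfolding a_def by (subst sum.atLeast_Suc_atMost) (auto simp: N_def)
  also have "\<dots> \<in> mI R"
    using m(2,3) mI_mono[OF R(2)] R subring_power[OF R(1)]
    by (intro mI_ideal[OF R(1,3)] mI_sum[OF R(1,3)]) auto
  finally show ?thesis using key integral_if_in_all_vr[OF S(1)] unfolding R_def by blast
qed

end

section \<open>Noether normalization over the ring of integers\<close>

definition monomial :: "'a::comm_monoid_mult list \<Rightarrow> nat list \<Rightarrow> 'a" where
  "monomial xs \<nu> = prod_list (map2 (^) xs \<nu>)"

lemma monomial_simps [simp]:
  "monomial [] \<nu> = 1" "monomial (x # xs) (n # \<nu>) = x ^ n * monomial xs \<nu>"
  by (auto simp: monomial_def)

lemma monomial_in_subring:
  assumes "is_subring A" shows "set xs \<subseteq> A \<Longrightarrow> length \<nu> = length xs \<Longrightarrow> monomial xs \<nu> \<in> A"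
proof (induction xs arbitrary: \<nu>)
  case Nil then show ?case by (auto intro: subring_intros[OF assms])
next
  case (Cons x xs)
  then obtain n \<mu> where "\<nu> = n # \<mu>" "length \<mu> = length xs" by (cases \<nu>) auto
  then show ?case using Cons by (auto intro!: subring_intros[OF assms])
qed

lemma poly_monomial:
  "length \<nu> = length ps \<Longrightarrow> poly (monomial ps \<nu>) x = monomial (map (\<lambda>p. poly p x) ps) \<nu>"
proof (induction ps arbitrary: \<nu>)
  case (Cons p ps)
  then obtain n \<mu> where "\<nu> = n # \<mu>" "length \<mu> = length ps" by (cases \<nu>) auto
  then show ?case using Cons by auto
qed auto

lemma lead_coeff_monomial:
  fixes ps :: "'a::idom poly list"
  shows "\<forall>p\<in>set ps. lead_coeff p = 1 \<Longrightarrow> length \<nu> = length ps \<Longrightarrow> lead_coeff (monomial ps \<nu>) = 1"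
proof (induction ps arbitrary: \<nu>)
  case (Cons p ps)
  then obtain n \<mu> where "\<nu> = n # \<mu>" "length \<mu> = length ps" by (cases \<nu>) auto
  then show ?case using Cons by (simp add: lead_coeff_mult lead_coeff_power)
qed auto

fun of_digits :: "nat \<Rightarrow> nat list \<Rightarrow> nat" where
  "of_digits d [] = 0"
| "of_digits d (n # \<nu>) = n + d * of_digits d \<nu>"

lemma of_digits_inj:
  "length \<mu> = length \<nu> \<Longrightarrow> \<forall>n\<in>set \<mu>. n < d \<Longrightarrow> \<forall>n\<in>set \<nu>. n < d \<Longrightarrow>
    of_digits d \<mu> = of_digits d \<nu> \<Longrightarrow> \<mu> = \<nu>"
proof (induction \<mu> \<nu> rule: list_induct2)
  case (Cons m \<mu> n \<nu>)
  have *: "m + d * of_digits d \<mu> = n + d * of_digits d \<nu>" "m < d" "n < d" using Cons by auto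
  from arg_cong[OF *(1), of "\<lambda>x. x mod d"] *(2,3) have "m = n" by simp
  then show ?case using * Cons by auto
qed auto

text \<open>The weight \<open>w\<close> is there for the induction: dropping the head multiplies the
  remaining degrees by \<open>d\<close>. For \<open>w = 1\<close> the degree reads the exponent
  vector as digits in base \<open>d\<close>.\<close>

lemma degree_monomial:
  fixes ps :: "'a::idom poly list"
  shows "\<forall>p\<in>set ps. lead_coeff p = 1 \<Longrightarrow> length \<nu> = length ps \<Longrightarrow>
    (\<And>i. i < length ps \<Longrightarrow> degree (ps ! i) = w * d ^ i) \<Longrightarrow> degree (monomial ps \<nu>) = w * of_digits d \<nu>"
proof (induction ps arbitrary: \<nu> w)
  case (Cons p ps)
  then obtain n \<mu> where nu: "\<nu> = n # \<mu>" "length \<mu> = length ps" by (cases \<nu>) auto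
  have "degree (ps ! i) = (w * d) * d ^ i" if "i < length ps" for i
    using Cons.prems(3)[of "Suc i"] that by (simp add: mult.assoc)
  then have "degree (monomial ps \<mu>) = (w * d) * of_digits d \<mu>"
    using Cons nu by auto
  moreover have "degree p = w" using Cons.prems(3)[of 0] by simp
  moreover have "monomial ps \<mu> \<noteq> 0" using lead_coeff_monomial[of ps \<mu>] Cons.prems nu by auto
  moreover have "p \<noteq> 0" using Cons.prems by auto
  ultimately show ?case using nu by (simp add: degree_mult_eq degree_power_eq algebra_simps)
qed auto

context valued_embedding
begin

definition alg_hull :: "'c set \<Rightarrow> 'c set" where
  "alg_hull E = ring_hull (\<O> \<union> E)"

lemma alg_hull_subring: "is_subring (alg_hull E)" "\<O> \<subseteq> alg_hull E" "E \<subseteq> alg_hull E"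
  unfolding alg_hull_def using is_subring_ring_hull ring_hull_superset[of "\<O> \<union> E"] by auto

lemma alg_hull_minimal: "is_subring S \<Longrightarrow> \<O> \<subseteq> S \<Longrightarrow> E \<subseteq> S \<Longrightarrow> alg_hull E \<subseteq> S"
  unfolding alg_hull_def by (intro ring_hull_minimal) auto

lemma alg_hull_mono: "E \<subseteq> F \<Longrightarrow> alg_hull E \<subseteq> alg_hull F"
  unfolding alg_hull_def by (intro ring_hull_mono) auto

lemma adjoin_alg_hull: "adjoin (alg_hull E) y = alg_hull (insert y E)"
  unfolding alg_hull_def adjoin_ring_hull by simp

lemma alg_hull_empty: "alg_hull {} = \<O>"
  using alg_hull_minimal[OF is_subring_\<O>, of "{}"] alg_hull_subring(2)[of "{}"] by auto

text \<open>A presentation of \<open>t\<close> by a polynomial in \<open>ys\<close> over the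
  integers of k. It need not be unique, as \<open>ys\<close> may be algebraically dependent.\<close>

definition expansion :: "'c list \<Rightarrow> nat list set \<Rightarrow> (nat list \<Rightarrow> 'k) \<Rightarrow> 'c \<Rightarrow> bool" where
  "expansion ys S c t \<longleftrightarrow> finite S \<and> (\<forall>\<nu>\<in>S. length \<nu> = length ys \<and> v (c \<nu>) \<le> 1) \<and>
     t = (\<Sum>\<nu>\<in>S. e (c \<nu>) * monomial ys \<nu>)"

text \<open>If all scalars of the expansion had absolute value below 1, every coefficient of
  \<open>p\<close> would lie in the ideal \<open>mI\<close>; a primitive \<open>p\<close> therefore
  yields a unit among them.\<close>

lemma expansion_poly:
  assumes coeffs: "\<And>i. \<exists>S c. expansion ys S c (coeff p i)"
  shows "\<exists>S c. expansion (x # ys) S c (poly p x) \<and>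
    (p \<notin> polys_over (mI (alg_hull (set ys))) \<longrightarrow> (\<exists>\<nu>\<in>S. v (c \<nu>) = 1))"
proof -
  obtain S c where Sc: "\<And>i. expansion ys (S i) (c i) (coeff p i)" using coeffs by metis
  define d where "d = degree p"
  define S' where "S' = (\<lambda>(i, \<nu>). i # \<nu>) ` (SIGMA i:{..d}. S i)"
  define c' where "c' \<nu> = c (hd \<nu>) (tl \<nu>)" for \<nu>
  have fin: "\<And>i. finite (S i)" and len: "\<And>i \<nu>. \<nu> \<in> S i \<Longrightarrow> length \<nu> = length ys \<and> v (c i \<nu>) \<le> 1"
    and eq: "\<And>i. coeff p i = (\<Sum>\<nu>\<in>S i. e (c i \<nu>) * monomial ys \<nu>)"
    using Sc unfolding expansion_def by blast+
  have "(\<Sum>\<nu>\<in>S'. e (c' \<nu>) * monomial (x # ys) \<nu>) =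
      (\<Sum>(i, \<nu>)\<in>(SIGMA i:{..d}. S i). e (c i \<nu>) * (x ^ i * monomial ys \<nu>))"
    unfolding S'_def by (subst sum.reindex) (auto simp: inj_on_def c'_def intro!: sum.cong)
  also have "\<dots> = (\<Sum>i\<le>d. \<Sum>\<nu>\<in>S i. e (c i \<nu>) * (x ^ i * monomial ys \<nu>))"
    by (subst sum.Sigma) (use fin in auto)
  also have "\<dots> = (\<Sum>i\<le>d. coeff p i * x ^ i)"
    unfolding eq sum_distrib_right by (intro sum.cong) (auto simp: mult_ac)
  also have "\<dots> = poly p x" by (simp add: poly_altdef d_def)
  finally have "poly p x = (\<Sum>\<nu>\<in>S'. e (c' \<nu>) * monomial (x # ys) \<nu>)" ..
  moreover have "finite S'" unfolding S'_def using fin by (intro finite_imageI finite_SigmaI) auto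
  moreover have "length \<nu> = length (x # ys) \<and> v (c' \<nu>) \<le> 1" if "\<nu> \<in> S'" for \<nu>
    using that len unfolding S'_def c'_def by auto
  ultimately have "expansion (x # ys) S' c' (poly p x)" unfolding expansion_def by blast
  moreover have "\<exists>\<nu>\<in>S'. v (c' \<nu>) = 1" if p: "p \<notin> polys_over (mI (alg_hull (set ys)))"
  proof (rule ccontr)
    assume none: "\<not> (\<exists>\<nu>\<in>S'. v (c' \<nu>) = 1)"
    note A = alg_hull_subring[of "set ys"]
    have "coeff p i \<in> mI (alg_hull (set ys))" for i
    proof (cases "i \<le> d")
      case True
      show ?thesis
        unfolding eq
      proof (rule mI_sum[OF A(1,2)])
        fix \<nu> assume nu: "\<nu> \<in> S i"
        then have "i # \<nu> \<in> S'" using True unfolding S'_def by auto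
        then have "v (c i \<nu>) \<noteq> 1" using none unfolding c'_def by force
        then have "v (c i \<nu>) < 1" using len[OF nu] by simp
        then show "e (c i \<nu>) * monomial ys \<nu> \<in> mI (alg_hull (set ys))"
          using monomial_in_subring[OF A(1,3)] len[OF nu] by (intro mI_I) auto
      qed
    next
      case False
      then show ?thesis using mI_ideal(1)[OF A(1,2)] by (simp add: d_def coeff_eq_0)
    qed
    then show False using p by (auto simp: polys_over_def)
  qed
  ultimately show ?thesis by blast
qed

lemma expansion_exists: "t \<in> alg_hull (set ys) \<Longrightarrow> \<exists>S c. expansion ys S c t"
proof (induction ys arbitrary: t)
  case Nil
  then obtain c where "t = e c" "v c \<le> 1" by (auto simp: alg_hull_empty \<O>_def valring_def)
  then have "expansion [] {[]} (\<lambda>_. c) t" unfolding expansion_def by simp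
  then show ?case by blast
next
  case (Cons y ys)
  then obtain p where "p \<in> polys_over (alg_hull (set ys))" "t = poly p y"
    by (auto simp: adjoin_alg_hull[symmetric] elim: adjoinE)
  then show ?case using expansion_poly[of ys p y] Cons.IH polys_overD by blast
qed

text \<open>Nagata's substitution, with exponents chosen so that different monomials get different degrees in \<open>x\<close>.\<close>

lemma nagata_substitution:
  assumes rel: "expansion (x # ys) S c 0" and unit: "\<exists>\<nu>\<in>S. v (c \<nu>) = 1"
  shows "\<exists>zs P m c0. length zs = length ys \<and>
    (\<forall>E. alg_hull (insert x (set zs \<union> E)) = alg_hull (insert x (set ys \<union> E))) \<and>
    P \<in> polys_over (alg_hull (set zs)) \<and> poly P x = 0 \<and> v c0 = 1 \<and>
    coeff P m - e c0 \<in> mI (alg_hull (set zs)) \<and> (\<forall>j>m. coeff P j \<in> mI (alg_hull (set zs)))"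
proof -
  have fin: "finite S" and len: "\<And>\<nu>. \<nu> \<in> S \<Longrightarrow> length \<nu> = Suc (length ys)" "\<And>\<nu>. \<nu> \<in> S \<Longrightarrow> v (c \<nu>) \<le> 1"
    and eq: "(\<Sum>\<nu>\<in>S. e (c \<nu>) * monomial (x # ys) \<nu>) = 0"
    using rel unfolding expansion_def by auto
  have "finite (\<Union>\<nu>\<in>S. set \<nu>)" using fin by simp
  then obtain d0 where d0: "\<And>n \<nu>. \<nu> \<in> S \<Longrightarrow> n \<in> set \<nu> \<Longrightarrow> n \<le> d0"
    unfolding finite_nat_set_iff_bounded_le by blast
  \<comment> \<open>The base \<open>d\<close> exceeds every exponent that occurs, so an exponent
    vector is determined by its value in base \<open>d\<close>.\<close>
  define d where "d = Suc d0"
  have d: "n < d" if "\<nu> \<in> S" "n \<in> set \<nu>" for n \<nu> using d0[OF that] by (simp add: d_def)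
  \<comment> \<open>The exponents begin with \<open>d ^ 1\<close> because \<open>x\<close>, at the
    head of the list, occupies the weight \<open>d ^ 0\<close>.\<close>
  define zs where "zs = map (\<lambda>i. ys ! i - x ^ (d ^ Suc i)) [0..<length ys]"
  define Ys where "Ys = map (\<lambda>i. [:zs ! i:] + monom 1 (d ^ Suc i)) [0..<length ys]"
  define Ps where "Ps = monom 1 1 # Ys"
  have lz: "length zs = length ys" by (simp add: zs_def)
  have zi: "zs ! i = ys ! i - x ^ (d ^ Suc i)" if "i < length ys" for i using that by (simp add: zs_def)
  define T where "T = alg_hull (set zs)"
  note T = alg_hull_subring[of "set zs", folded T_def]
  \<comment> \<open>The set \<open>E\<close> carries along generators that the substitution leaves
    untouched.\<close>
  have hull: "alg_hull (insert x (set zs \<union> E)) = alg_hull (insert x (set ys \<union> E))" for E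
  proof
    note A = alg_hull_subring[of "insert x (set ys \<union> E)"] and B = alg_hull_subring[of "insert x (set zs \<union> E)"]
    show "alg_hull (insert x (set zs \<union> E)) \<subseteq> alg_hull (insert x (set ys \<union> E))"
    proof (rule alg_hull_minimal[OF A(1,2)], safe)
      fix z assume "z \<in> set zs"
      then obtain i where i: "i < length ys" "z = ys ! i - x ^ (d ^ Suc i)"
        unfolding zs_def by auto
      then show "z \<in> alg_hull (insert x (set ys \<union> E))"
        using A(3) unfolding i(2) by (intro subring_diff subring_power A(1)) auto
    qed (use A(3) in auto)
    show "alg_hull (insert x (set ys \<union> E)) \<subseteq> alg_hull (insert x (set zs \<union> E))"
    proof (rule alg_hull_minimal[OF B(1,2)], safe)
      fix y assume "y \<in> set ys"
      then obtain i where i: "i < length ys" "y = ys ! i" by (auto simp: in_set_conv_nth)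
      then have y: "y = zs ! i + x ^ (d ^ Suc i)" using zi by simp
      show "y \<in> alg_hull (insert x (set zs \<union> E))"
        using B(3) i lz unfolding y by (intro subring_add subring_power B(1)) auto
    qed (use B(3) in auto)
  qed
  have dpos: "d ^ Suc i \<noteq> 0" for i by (simp add: d_def)
  have Ydeg: "degree ([:a:] + monom 1 k) = k \<and> lead_coeff ([:a:] + monom 1 k) = 1" if "k \<noteq> 0" for k and a :: 'c
  proof -
    have "degree ([:a:] + monom 1 k) = k"
      using that by (subst degree_add_eq_right) (auto simp: degree_monom_eq)
    then show ?thesis using that by (cases k) auto
  qed
  have monic: "\<forall>p\<in>set Ps. lead_coeff p = 1"
  proof
    fix p assume "p \<in> set Ps"
    then consider "p = monom 1 1" | i where "p = [:zs ! i:] + monom 1 (d ^ Suc i)"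
      unfolding Ps_def Ys_def by auto
    then show "lead_coeff p = 1"
    proof cases
      case 1 then show ?thesis by (simp only: lead_coeff_monom)
    next
      case 2 then show ?thesis using Ydeg[OF dpos] by blast
    qed
  qed
  have lP: "length Ps = Suc (length ys)" by (simp add: Ps_def Ys_def)
  have degs: "degree (Ps ! i) = 1 * d ^ i" if "i < length Ps" for i
  proof (cases i)
    case 0 then show ?thesis by (simp add: Ps_def degree_monom_eq)
  next
    case (Suc k)
    then show ?thesis using that lP Ydeg[OF dpos[of k], of "zs ! k"] by (simp add: Ps_def Ys_def)
  qed
  have mon: "lead_coeff (monomial Ps \<nu>) = 1" "degree (monomial Ps \<nu>) = of_digits d \<nu>"
    if "\<nu> \<in> S" for \<nu>
    using lead_coeff_monomial[OF monic] degree_monomial[OF monic _ degs] len(1)[OF that] lP by auto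
  have PsT: "set Ps \<subseteq> polys_over T"
  proof -
    have "zs ! i \<in> T" if "i < length ys" for i using that T(3) lz by auto
    then show ?thesis unfolding Ps_def Ys_def
      using subring_zero[OF T(1)] subring_one[OF T(1)]
      by (auto intro!: subring_add[OF subring_polys_over[OF T(1)]] monom_in_polys_over pCons_in_polys_over
          subring_zero[OF subring_polys_over[OF T(1)]])
  qed
  have pT: "monomial Ps \<nu> \<in> polys_over T" if "\<nu> \<in> S" for \<nu>
    using monomial_in_subring[OF subring_polys_over[OF T(1)] PsT] len(1)[OF that] lP by simp
  have ev: "map (\<lambda>p. poly p x) Ps = x # ys"
    unfolding Ps_def Ys_def by (auto simp: poly_monom zi intro: nth_equalityI)
  \<comment> \<open>The given relation as a polynomial over the new generators: the polynomials
    \<open>Ps\<close> take the values \<open>x # ys\<close> at \<open>x\<close>.\<close>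
  define P where "P = (\<Sum>\<nu>\<in>S. smult (e (c \<nu>)) (monomial Ps \<nu>))"
  have "poly P x = 0"
    using eq poly_monomial[of _ Ps x] len(1) lP unfolding P_def ev by (simp add: poly_sum)
  have cT: "e (c \<nu>) \<in> T" if "\<nu> \<in> S" for \<nu> using \<O>_I[OF len(2)[OF that]] T(2) by blast
  have "P \<in> polys_over T"
    unfolding P_def using pT cT
    by (intro subring_sum[OF subring_polys_over[OF T(1)]] smult_in_polys_over T(1)) auto
  define U where "U = {\<nu>\<in>S. v (c \<nu>) = 1}"
  have U: "finite U" "U \<noteq> {}" using fin unit by (auto simp: U_def)
  have "Max (of_digits d ` U) \<in> of_digits d ` U" by (rule Max_in) (use U in auto)
  then obtain \<mu> where mu: "\<mu> \<in> U" "Max (of_digits d ` U) = of_digits d \<mu>" by auto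
  \<comment> \<open>The top degree among the monomials with unit scalars. Monomials of higher degree
    may occur in \<open>P\<close>, but only with scalars of absolute value below 1.\<close>
  define m where "m = of_digits d \<mu>"
  have max: "of_digits d \<nu> \<le> m" if "\<nu> \<in> U" for \<nu>
    using U that unfolding m_def mu(2)[symmetric] by auto
  have small: "e (c \<nu>) * coeff (monomial Ps \<nu>) j \<in> mI T"
    if "\<nu> \<in> S" "\<nu> \<in> U \<Longrightarrow> of_digits d \<nu> < j" for \<nu> j
  proof (cases "\<nu> \<in> U")
    case True
    then have "coeff (monomial Ps \<nu>) j = 0" using that mon(2) by (intro coeff_eq_0) auto
    then show ?thesis using mI_ideal(1)[OF T(1,2)] by simp
  next
    case False
    then have "v (c \<nu>) < 1" using that len(2) unfolding U_def by force
    then show ?thesis using pT[OF that(1)] polys_overD by (intro mI_I) auto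
  qed
  have cP: "coeff P j = (\<Sum>\<nu>\<in>S. e (c \<nu>) * coeff (monomial Ps \<nu>) j)" for j
    by (simp add: P_def coeff_sum)
  have high: "coeff P j \<in> mI T" if "j > m" for j
    unfolding cP using max that by (intro mI_sum[OF T(1,2)] small) force+
  have muS: "\<mu> \<in> S" "v (c \<mu>) = 1" using mu unfolding U_def by auto
  have "coeff P m - e (c \<mu>) = (\<Sum>\<nu>\<in>S - {\<mu>}. e (c \<nu>) * coeff (monomial Ps \<nu>) m)"
    unfolding cP using mon[OF muS(1)] by (subst sum.remove[OF fin muS(1)]) (simp add: m_def)
  also have "\<dots> \<in> mI T"
  proof (intro mI_sum[OF T(1,2)] small)
    fix \<nu> assume nu: "\<nu> \<in> S - {\<mu>}" "\<nu> \<in> U"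
    have "of_digits d \<nu> \<noteq> m"
      using of_digits_inj[of \<nu> \<mu> d] nu muS len(1) d unfolding m_def by force
    then show "of_digits d \<nu> < m" using max[OF nu(2)] by simp
  qed auto
  finally have "coeff P m - e (c \<mu>) \<in> mI T" .
  then show ?thesis
    unfolding T_def[symmetric] using lz hull \<open>P \<in> polys_over T\<close> \<open>poly P x = 0\<close> muS(2) high
    by (intro exI[of _ zs] exI[of _ P] exI[of _ m] exI[of _ "c \<mu>"]) (simp add: T_def)
qed

text \<open>Read from the end of the list, the algebra remains a Gauss ring as long as each new
  generator is transcendental over the preceding ones; \<open>x\<close> is the first that is
  not.\<close>

lemma gauss_ring_or_dependent:
  "gauss_ring (alg_hull (set xs)) \<or> (\<exists>us x ys. xs = us @ x # ys \<and>
     gauss_ring (alg_hull (set ys)) \<and> \<not> transcendental_over (alg_hull (set ys)) x)"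
proof (induction xs)
  case Nil
  then show ?case using gauss_ring_\<O> by (simp add: alg_hull_empty)
next
  case (Cons y xs)
  then show ?case
  proof
    assume g: "gauss_ring (alg_hull (set xs))"
    show ?thesis
    proof (cases "transcendental_over (alg_hull (set xs)) y")
      case True
      then show ?thesis using gauss_ring_adjoin[OF g] by (simp add: adjoin_alg_hull)
    next
      case False
      then show ?thesis using g by (metis append_Nil)
    qed
  next
    assume "\<exists>us x ys. xs = us @ x # ys \<and>
     gauss_ring (alg_hull (set ys)) \<and> \<not> transcendental_over (alg_hull (set ys)) x"
    then obtain us x ys where "xs = us @ x # ys" "gauss_ring (alg_hull (set ys))"
      "\<not> transcendental_over (alg_hull (set ys)) x" by blast
    then have "y # xs = (y # us) @ x # ys \<and> gauss_ring (alg_hull (set ys)) \<and> \<not> transcendental_over (alg_hull (set ys)) x" by simp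
    then show ?thesis by blast
  qed
qed

theorem good_ring_finitely_generated: "good_ring (alg_hull (set xs))"
proof (induction "length xs" arbitrary: xs)
  case 0
  then show ?case using good_ring_if_gauss_ring[OF gauss_ring_\<O>] by (simp add: alg_hull_empty)
next
  case (Suc n)
  consider "gauss_ring (alg_hull (set xs))" | us x ys where "xs = us @ x # ys"
    "gauss_ring (alg_hull (set ys))" "\<not> transcendental_over (alg_hull (set ys)) x"
    using gauss_ring_or_dependent by blast
  then show ?case
  proof cases
    case 1 then show ?thesis by (rule good_ring_if_gauss_ring)
  next
    case 2
    define A where "A = alg_hull (set ys)"
    obtain P0 where P0: "P0 \<in> polys_over A" "P0 \<noteq> 0" "poly P0 x = 0"
      using 2(3) unfolding transcendental_over_def A_def by blast
    \<comment> \<open>The relation is made primitive because Nagata's substitution requires a unit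
      among its scalars.\<close>
    then obtain c p where cp: "c \<noteq> 0" "P0 = smult (e c) p" "p \<in> polys_over A - polys_over (mI A)"
      using gauss_content 2(2) unfolding A_def by blast
    then have px: "poly p x = 0" using P0(3) by (simp add: e_eq_0)
    have "\<exists>S c. expansion ys S c (coeff p i)" for i
      using expansion_exists cp(3) polys_overD unfolding A_def by blast
    then obtain S c where Sc: "expansion (x # ys) S c 0" "\<exists>\<nu>\<in>S. v (c \<nu>) = 1"
      using expansion_poly[of ys p x] px cp(3) unfolding A_def by auto
    obtain zs P m c0 where "length zs = length ys \<and>
      (\<forall>E. alg_hull (insert x (set zs \<union> E)) = alg_hull (insert x (set ys \<union> E))) \<and>
      P \<in> polys_over (alg_hull (set zs)) \<and> poly P x = 0 \<and> v c0 = 1 \<and>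
      coeff P m - e c0 \<in> mI (alg_hull (set zs)) \<and> (\<forall>j>m. coeff P j \<in> mI (alg_hull (set zs)))"
      using nagata_substitution[OF Sc] by (elim exE)
    then have zs: "length zs = length ys"
      "\<And>E. alg_hull (insert x (set zs \<union> E)) = alg_hull (insert x (set ys \<union> E))"
      "P \<in> polys_over (alg_hull (set zs))" "poly P x = 0" "v c0 = 1"
      "coeff P m - e c0 \<in> mI (alg_hull (set zs))" "\<And>j. j > m \<Longrightarrow> coeff P j \<in> mI (alg_hull (set zs))"
      by simp_all
    \<comment> \<open>With \<open>x\<close> split off there is one generator fewer, so the induction
      hypothesis covers \<open>T\<close>, which need not be a Gauss ring.\<close>
    define T where "T = alg_hull (set (us @ zs))"
    have sub: "alg_hull (set zs) \<subseteq> T" unfolding T_def by (rule alg_hull_mono) auto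
    have T: "is_subring T" "\<O> \<subseteq> T" unfolding T_def using alg_hull_subring by auto
    have good: "good_ring T" unfolding T_def using Suc.hyps(1)[of "us @ zs"] Suc.hyps(2) 2(1) zs(1) by simp
    have "\<exists>a. integral_over T a \<and> integral_over T (a * x) \<and> a - e c0 \<in> mI (adjoin T x)"
      by (rule weierstrass_tail[OF T _ zs(4,5)]) (use zs(3,6,7) mI_mono[OF sub] polys_over_mono[OF sub] in auto)
    then have "good_ring (adjoin T x)" using good_ring_quasi_finite[OF good T _ _ zs(5)] by blast
    moreover have "adjoin T x = alg_hull (set xs)"
      using zs(2)[of "set us"] unfolding T_def adjoin_alg_hull 2(1) by (simp add: Un_commute)
    ultimately show ?thesis by simp
  qed
qed

end

section \<open>The seminorm of a valuation ring\<close>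

context valued_embedding
begin

text \<open>The divisible hull of the value group of k in the positive reals.\<close>

definition scale :: "real set" where
  "scale = {r. r > 0 \<and> (\<exists>m>0. \<exists>c. v c = r ^ m)}"

text \<open>The infimum is multiplicative even if \<open>V\<close> has rank greater than one; it is junk where no bound exists.\<close>

definition ubounds :: "'c set \<Rightarrow> 'c \<Rightarrow> real set" where
  "ubounds V z = {r. r > 0 \<and> (\<exists>m>0. \<exists>c. v c = r ^ m \<and> z ^ m / e c \<in> V)}"

definition vr_seminorm :: "'c set \<Rightarrow> 'c \<Rightarrow> real" where
  "vr_seminorm V z = Inf (ubounds V z)"

text \<open>The rational powers of \<open>v \<pi>\<close> are dense in the positive reals, as
  \<open>v \<pi>\<close> lies strictly between 0 and 1.\<close>

lemma scale_dense:
  assumes "0 \<le> s" "s < t" shows "\<exists>r\<in>scale. s < r \<and> r < t"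
proof -
  define s' where "s' = max s (t / 2)"
  have s': "0 < s'" "s' < t" "s \<le> s'" using assms by (auto simp: s'_def)
  define L where "L = ln (v \<pi>)"
  have L: "L < 0" using pi_pos pi_less by (simp add: L_def)
  have "ln t / L < ln s' / L" using s' L by (intro divide_strict_right_mono_neg) auto
  then obtain q where q: "q \<in> \<rat>" "ln t / L < q" "q < ln s' / L" using Rats_dense_in_real by blast
  obtain a b where ab: "b > 0" "q = of_int a / of_int b" using Rats_cases'[OF q(1)] by metis
  define m where "m = nat b"
  have m: "m > 0" "q * real m = of_int a" using ab by (auto simp: m_def)
  define r where "r = exp (q * L)"
  have "ln s' < q * L" "q * L < ln t" using q L by (auto simp: field_simps)
  then have r: "s' < r" "r < t" "r > 0"
    using s' exp_less_mono[of "ln s'" "q * L"] exp_less_mono[of "q * L" "ln t"] by (simp_all add: r_def)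
  have "r ^ m = exp (of_int a * L)" using m by (simp add: r_def exp_of_nat_mult[symmetric] mult_ac)
  also have "\<exists>c. v c = exp (of_int a * L)"
  proof (cases "a \<ge> 0")
    case True
    then have "v (\<pi> ^ nat a) = exp (of_int a * L)"
      using pi_pos True exp_of_nat_mult[of "nat a" L] by (simp add: v_simps L_def)
    then show ?thesis by blast
  next
    case False
    then have "v (inverse \<pi> ^ nat (- a)) = exp (of_int a * L)"
      using pi_pos exp_of_nat_mult[of "nat (-a)" "- L"] by (simp add: v_simps L_def exp_minus)
    then show ?thesis by blast
  qed
  finally have "r \<in> scale" using r m(1) unfolding scale_def by blast
  then show ?thesis using r s' by force
qed

context
  fixes V assumes V: "valuation_ring V" "\<O> \<subseteq> V" "e \<pi> \<in> max_ideal V"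
begin

private lemma e_in_V: "e c \<in> V \<longleftrightarrow> v c \<le> 1"
  by (rule e_in_valuation_ring_iff[OF V])

lemma ubounds_bdd: "bdd_below (ubounds V z)"
  unfolding ubounds_def by (rule bdd_belowI[of _ 0]) auto

lemma ubounds_nonempty:
  assumes "z \<in> localized V (e \<pi>)" shows "ubounds V z \<noteq> {}"
proof -
  obtain m where m: "e \<pi> ^ m * z \<in> V" using assms unfolding localized_def by blast
  have "z ^ 1 / e (inverse \<pi> ^ m) \<in> V" using m by (simp add: e_power e_inverse divide_inverse mult.commute power_inverse)
  moreover have "v (inverse \<pi> ^ m) > 0" using pi_pos by (simp add: v_simps)
  ultimately have "v (inverse \<pi> ^ m) \<in> ubounds V z" unfolding ubounds_def
    by (intro CollectI conjI exI[of _ 1] exI[of _ "inverse \<pi> ^ m"]) auto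
  then show ?thesis by blast
qed

lemma vr_seminorm_le: "r \<in> ubounds V z \<Longrightarrow> vr_seminorm V z \<le> r"
  unfolding vr_seminorm_def by (rule cInf_lower[OF _ ubounds_bdd])

lemma vr_seminorm_greatest:
  "z \<in> localized V (e \<pi>) \<Longrightarrow> (\<And>r. r \<in> ubounds V z \<Longrightarrow> l \<le> r) \<Longrightarrow> l \<le> vr_seminorm V z"
  unfolding vr_seminorm_def by (rule cInf_greatest[OF ubounds_nonempty])

lemma vr_seminorm_nonneg: "z \<in> localized V (e \<pi>) \<Longrightarrow> 0 \<le> vr_seminorm V z"
  by (rule vr_seminorm_greatest) (auto simp: ubounds_def)

lemma vr_seminorm_le_one: "z \<in> V \<Longrightarrow> vr_seminorm V z \<le> 1"
  by (rule vr_seminorm_le) (auto simp: ubounds_def v_simps e_1 intro!: exI[of _ 1])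

text \<open>For nonzero \<open>c\<close> the number \<open>v c\<close> is itself an upper bound, and
  the least one because \<open>V\<close> meets k in the ring of integers. For \<open>c = 0\<close>
  all of \<open>scale\<close> consists of upper bounds, and density gives the infimum 0.\<close>

lemma vr_seminorm_scalar: "vr_seminorm V (e c) = v c"
proof (cases "c = 0")
  case True
  have "0 ^ m / e d \<in> V" if "m > 0" for m d using vr_intros(4)[OF V(1)] that by (simp add: zero_power)
  then have "ubounds V 0 = scale"
    unfolding ubounds_def scale_def by (intro Collect_cong) metis
  moreover have "Inf scale = 0"
  proof (rule cInf_eq)
    show "0 \<le> r" if "r \<in> scale" for r using that by (simp add: scale_def)
    show "y \<le> 0" if "\<And>r. r \<in> scale \<Longrightarrow> y \<le> r" for y
    proof (rule ccontr)
      assume "\<not> y \<le> 0"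
      then obtain r where "r \<in> scale" "r < y" using scale_dense[of 0 y] by auto
      then show False using that by fastforce
    qed
  qed
  ultimately show ?thesis using True by (simp add: vr_seminorm_def e_0 v_simps)
next
  case False
  then have pos: "v c > 0" using v_simps(6,7) by (metis order_le_less)
  have "e c ^ 1 / e c \<in> V" using vr_intros(1)[OF V(1)] False by (simp add: e_eq_0)
  then have in_ub: "v c \<in> ubounds V (e c)" using pos unfolding ubounds_def
    by (intro CollectI conjI exI[of _ 1] exI[of _ c]) auto
  have "v c \<le> r" if r: "r \<in> ubounds V (e c)" for r
  proof -
    obtain m d where r: "r > 0" "m > 0" "v d = r ^ m" "e c ^ m / e d \<in> V"
      using r unfolding ubounds_def by blast
    then have "v (c ^ m / d) \<le> 1" using e_in_V[of "c ^ m / d"] by (simp add: e_divide e_power)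
    then have "v c ^ m \<le> r ^ m" using r by (simp add: v_simps divide_le_eq_1)
    then show ?thesis using r by (simp add: power_mono_iff pos less_imp_le)
  qed
  then have "Inf (ubounds V (e c)) = v c" using in_ub by (intro cInf_eq_minimum) auto
  then show ?thesis by (simp add: vr_seminorm_def)
qed

text \<open>If \<open>z / z' \<in> V\<close>, the sum is \<open>z'\<close> times an element of
  \<open>V\<close>, so every upper bound for \<open>z'\<close> is one for the sum; the inequality is
  in fact ultrametric.\<close>

lemma vr_seminorm_add_le:
  assumes z: "z \<in> localized V (e \<pi>)" "z' \<in> localized V (e \<pi>)"
  shows "vr_seminorm V (z + z') \<le> vr_seminorm V z + vr_seminorm V z'"
proof -
  have *: "vr_seminorm V (z + z') \<le> vr_seminorm V z'"
    if z': "z' \<in> localized V (e \<pi>)" and q: "z / z' \<in> V" "z' \<noteq> 0" for z z'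
  proof (rule vr_seminorm_greatest[OF z'])
    fix r assume "r \<in> ubounds V z'"
    then obtain m c where r: "r > 0" "m > 0" "v c = r ^ m" "z' ^ m / e c \<in> V"
      unfolding ubounds_def by blast
    have "z + z' = z' * (1 + z / z')" using q by (simp add: field_simps)
    then have "(z + z') ^ m / e c = z' ^ m / e c * (1 + z / z') ^ m" by (simp add: power_mult_distrib)
    moreover have "1 + z / z' \<in> V" using q vr_intros(1,6)[OF V(1)] by blast
    ultimately have "(z + z') ^ m / e c \<in> V" using r vr_intros(3,7)[OF V(1)] by metis
    then have "r \<in> ubounds V (z + z')" using r unfolding ubounds_def by blast
    then show "vr_seminorm V (z + z') \<le> r" by (rule vr_seminorm_le)
  qed
  note nn = vr_seminorm_nonneg[OF z(1)] vr_seminorm_nonneg[OF z(2)]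
  consider "z = 0 \<or> z' = 0" | "z \<noteq> 0" "z' \<noteq> 0" "z / z' \<in> V" | "z \<noteq> 0" "z' \<noteq> 0" "z' / z \<in> V"
    using vr_inverse[OF V(1), of "z / z'"] by auto
  then show ?thesis
  proof cases
    case 1 then show ?thesis using nn by auto
  next
    case 2 then show ?thesis using *[OF z(2)] nn by fastforce
  next
    case 3 then show ?thesis using *[OF z(1)] nn by (fastforce simp: add.commute)
  qed
qed

text \<open>Products of upper bounds are upper bounds, which gives one inequality. For the other,
  elements of \<open>scale\<close> below the two seminorms fail to be upper bounds, and in a
  valuation ring this failure is the opposite divisibility, which can be multiplied as well.\<close>

lemma vr_seminorm_mult:
  assumes z: "z \<in> localized V (e \<pi>)" "z' \<in> localized V (e \<pi>)"
  shows "vr_seminorm V (z * z') = vr_seminorm V z * vr_seminorm V z'"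
proof (rule antisym)
  note nn = vr_seminorm_nonneg[OF z(1)] vr_seminorm_nonneg[OF z(2)]
  have VS: "is_subring V" "e \<pi> \<in> V" using V max_ideal_subset vr_subring by auto
  have zz: "z * z' \<in> localized V (e \<pi>)" using subring_mult[OF subring_localized[OF VS]] z by blast
  have ub: "vr_seminorm V (z * z') \<le> r * s" if r: "r \<in> ubounds V z" and s: "s \<in> ubounds V z'" for r s
  proof -
    obtain m c where r: "r > 0" "m > 0" "v c = r ^ m" "z ^ m / e c \<in> V"
      using r unfolding ubounds_def by blast
    obtain n d where s: "s > 0" "n > 0" "v d = s ^ n" "z' ^ n / e d \<in> V"
      using s unfolding ubounds_def by blast
    have "(z ^ m / e c) ^ n * (z' ^ n / e d) ^ m \<in> V" using r s vr_intros(3,7)[OF V(1)] by blast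
    moreover have "(z ^ m / e c) ^ n * (z' ^ n / e d) ^ m = (z * z') ^ (m * n) / e (c ^ n * d ^ m)"
      by (simp add: e_mult e_power power_divide power_mult_distrib power_mult[symmetric] mult.commute)
    moreover have "v (c ^ n * d ^ m) = (r * s) ^ (m * n)"
      using r s by (simp add: v_simps power_mult_distrib power_mult[symmetric] mult.commute)
    ultimately have "r * s \<in> ubounds V (z * z')" unfolding ubounds_def using r s
      by (intro CollectI conjI exI[of _ "m * n"] exI[of _ "c ^ n * d ^ m"]) auto
    then show ?thesis by (rule vr_seminorm_le)
  qed
  have "vr_seminorm V (z * z') \<le> vr_seminorm V z * s" if s: "s \<in> ubounds V z'" for s
  proof -
    have s0: "s > 0" using s by (simp add: ubounds_def)
    have "vr_seminorm V (z * z') / s \<le> vr_seminorm V z"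
      using ub[OF _ s] s0 by (intro vr_seminorm_greatest[OF z(1)]) (simp add: field_simps)
    then show ?thesis using s0 by (simp add: field_simps)
  qed
  then have le: "vr_seminorm V (z * z') \<le> vr_seminorm V z * s" if "s \<in> ubounds V z'" for s using that .
  show "vr_seminorm V (z * z') \<le> vr_seminorm V z * vr_seminorm V z'"
  proof (cases "vr_seminorm V z = 0")
    case True
    obtain s where "s \<in> ubounds V z'" using ubounds_nonempty[OF z(2)] by blast
    then show ?thesis using le[of s] True by simp
  next
    case False
    then have pos: "vr_seminorm V z > 0" using nn by simp
    have "vr_seminorm V (z * z') / vr_seminorm V z \<le> vr_seminorm V z'"
      using le pos by (intro vr_seminorm_greatest[OF z(2)]) (simp add: field_simps)
    then show ?thesis using pos by (simp add: field_simps)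
  qed
  show "vr_seminorm V z * vr_seminorm V z' \<le> vr_seminorm V (z * z')"
  proof (rule ccontr)
    assume "\<not> ?thesis"
    then have "Inf (ubounds V (z * z')) < vr_seminorm V z * vr_seminorm V z'" by (simp add: vr_seminorm_def)
    then obtain t where t: "t \<in> ubounds V (z * z')" "t < vr_seminorm V z * vr_seminorm V z'"
      using cInf_lessD[OF ubounds_nonempty[OF zz]] by blast
    obtain n d where nd: "t > 0" "n > 0" "v d = t ^ n" "(z * z') ^ n / e d \<in> V"
      using t(1) unfolding ubounds_def by blast
    have "vr_seminorm V z * vr_seminorm V z' > 0" using t nd by simp
    then have pos: "vr_seminorm V z > 0" "vr_seminorm V z' > 0" using nn by (auto simp: zero_less_mult_iff)
    \<comment> \<open>The numbers \<open>r\<close> and \<open>s\<close> are chosen in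
      \<open>scale\<close> below the two seminorms with product still above
      \<open>t\<close>.\<close>
    have "t / vr_seminorm V z' < vr_seminorm V z" using t(2) pos by (simp add: field_simps)
    then obtain r where r: "r \<in> scale" "t / vr_seminorm V z' < r" "r < vr_seminorm V z"
      using scale_dense[of "t / vr_seminorm V z'"] pos nd by auto
    have r0: "r > 0" using r(1) by (simp add: scale_def)
    have "t / r < vr_seminorm V z'" using r(2) r0 pos by (simp add: field_simps)
    then obtain s where s: "s \<in> scale" "t / r < s" "s < vr_seminorm V z'"
      using scale_dense[of "t / r"] r0 nd by auto
    have s0: "s > 0" using s(1) by (simp add: scale_def)
    have div: "\<exists>m c. m > 0 \<and> v c = r ^ m \<and> e c / y ^ m \<in> V \<and> y \<noteq> 0"
      if r: "r \<in> scale" "r < vr_seminorm V y" for r y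
    proof -
      obtain m c where mc: "r > 0" "m > 0" "v c = r ^ m" using r(1) unfolding scale_def by blast
      have "r \<notin> ubounds V y" using vr_seminorm_le[of r y] r(2) by auto
      then have "y ^ m / e c \<notin> V" using mc unfolding ubounds_def by blast
      then have "inverse (y ^ m / e c) \<in> V" "y \<noteq> 0"
        using vr_inverse[OF V(1)] vr_intros(4)[OF V(1)] mc(2) by (auto simp only: zero_power div_0)
      then show ?thesis using mc by (auto intro!: exI[of _ m] exI[of _ c])
    qed
    obtain m1 c1 where 1: "m1 > 0" "v c1 = r ^ m1" "e c1 / z ^ m1 \<in> V" "z \<noteq> 0" using div[OF r(1,3)] by blast
    obtain m2 c2 where 2: "m2 > 0" "v c2 = s ^ m2" "e c2 / z' ^ m2 \<in> V" "z' \<noteq> 0" using div[OF s(1,3)] by blast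
    \<comment> \<open>With these exponents \<open>z\<close> and \<open>z'\<close> cancel, leaving in
      \<open>V\<close> a scalar of absolute value
      \<open>(r * s / t) ^ (m1 * m2 * n)\<close>.\<close>
    have "(e c1 / z ^ m1) ^ (m2 * n) * (e c2 / z' ^ m2) ^ (m1 * n) * ((z * z') ^ n / e d) ^ (m1 * m2) \<in> V"
      by (intro vr_intros(3,7)[OF V(1)] 1 2 nd)
    also have "(e c1 / z ^ m1) ^ (m2 * n) * (e c2 / z' ^ m2) ^ (m1 * n) * ((z * z') ^ n / e d) ^ (m1 * m2)
        = e (c1 ^ (m2 * n) * c2 ^ (m1 * n) / d ^ (m1 * m2))"
    proof -
      have "(e c1 / z ^ m1) ^ (m2 * n) = e c1 ^ (m2 * n) / z ^ (m1 * m2 * n)"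
        "(e c2 / z' ^ m2) ^ (m1 * n) = e c2 ^ (m1 * n) / z' ^ (m1 * m2 * n)"
        "((z * z') ^ n / e d) ^ (m1 * m2) = z ^ (m1 * m2 * n) * z' ^ (m1 * m2 * n) / e d ^ (m1 * m2)"
        by (simp_all add: power_divide power_mult[symmetric] power_mult_distrib mult_ac)
      then show ?thesis using 1(4) 2(4) by (simp add: e_mult e_power e_divide)
    qed
    finally have "v (c1 ^ (m2 * n) * c2 ^ (m1 * n) / d ^ (m1 * m2)) \<le> 1" using e_in_V by blast
    moreover have "v (c1 ^ (m2 * n) * c2 ^ (m1 * n) / d ^ (m1 * m2)) = (r * s) ^ (m1 * m2 * n) / t ^ (m1 * m2 * n)"
      using 1 2 nd by (simp add: v_simps power_mult[symmetric] power_mult_distrib mult_ac)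
    ultimately have "(r * s) ^ (m1 * m2 * n) \<le> t ^ (m1 * m2 * n)" using nd by (simp add: divide_le_eq_1)
    then have "r * s \<le> t" using r0 s0 nd 1 2 by (subst (asm) power_mono_iff) auto
    then show False using s(2) r0 by (simp add: field_simps)
  qed
qed

lemma vr_seminorm_greater_one:
  assumes z: "z \<in> localized V (e \<pi>)" "z \<noteq> 0" and M: "inverse z ^ M / e \<pi> \<in> V"
  shows "vr_seminorm V z > 1"
proof -
  \<comment> \<open>Every upper bound \<open>r\<close> satisfies
    \<open>r ^ M * v \<pi> \<ge> 1\<close>, and \<rho> is the smallest positive number with this
    property. The exponent \<open>M\<close> is positive, as otherwise 1/\<pi> would lie in
    \<open>V\<close>.\<close>
  define \<rho> where "\<rho> = root M (1 / v \<pi>)"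
  have M0: "M > 0"
  proof (rule ccontr)
    assume "\<not> M > 0"
    then have "e (inverse \<pi>) \<in> V" using M by (simp add: e_divide e_1 inverse_eq_divide)
    then show False using e_in_V pi_pos pi_less by (simp add: v_simps field_simps)
  qed
  have rho: "\<rho> > 1" "\<rho> ^ M = 1 / v \<pi>" using M0 pi_pos pi_less by (simp_all add: \<rho>_def)
  have "\<rho> \<le> r" if r: "r \<in> ubounds V z" for r
  proof -
    obtain m c where r: "r > 0" "m > 0" "v c = r ^ m" "z ^ m / e c \<in> V"
      using r unfolding ubounds_def by blast
    have "(z ^ m / e c) ^ M * (inverse z ^ M / e \<pi>) ^ m \<in> V" using r M vr_intros(3,7)[OF V(1)] by blast
    also have "(z ^ m / e c) ^ M * (inverse z ^ M / e \<pi>) ^ m = e (inverse (c ^ M * \<pi> ^ m))"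
    proof -
      have "(z ^ m / e c) ^ M = z ^ (m * M) / e c ^ M" by (simp add: power_divide power_mult)
      moreover have "(inverse z ^ M / e \<pi>) ^ m = 1 / (z ^ (m * M) * e \<pi> ^ m)"
        by (simp add: power_divide power_mult_distrib power_mult[symmetric] inverse_eq_divide mult.commute)
      ultimately show ?thesis using z(2) by (simp add: e_divide e_1 e_mult e_power inverse_eq_divide)
    qed
    finally have "inverse (r ^ (M * m) * v \<pi> ^ m) \<le> 1"
      using e_in_V r by (simp add: v_simps power_mult[symmetric] mult.commute)
    moreover have "r ^ (M * m) * v \<pi> ^ m = (r ^ M * v \<pi>) ^ m" by (simp add: power_mult power_mult_distrib)
    moreover have "(r ^ M * v \<pi>) ^ m > 0" using r(1) pi_pos by simp
    ultimately have "1 \<le> (r ^ M * v \<pi>) ^ m" by (metis inverse_le_1_iff not_le)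
    then have "1 \<le> r ^ M * v \<pi>" using power_mono_iff[of 1 "r ^ M * v \<pi>" m] r(1,2) pi_pos by simp
    then have "\<rho> ^ M \<le> r ^ M" unfolding rho(2) using pi_pos by (simp add: field_simps)
    then show ?thesis using M0 r rho by (subst (asm) power_mono_iff) auto
  qed
  then show ?thesis using vr_seminorm_greatest[OF z(1), of \<rho>] rho by force
qed

end

end

section \<open>Embedding a residue ring into a field\<close>

definition ring_ideal :: "'b::comm_ring_1 set \<Rightarrow> bool" where
  "ring_ideal I \<longleftrightarrow> 0 \<in> I \<and> (\<forall>x\<in>I. \<forall>y\<in>I. x + y \<in> I) \<and> (\<forall>x\<in>I. \<forall>a. x * a \<in> I)"

text \<open>In the presence of zero divisors degrees need not add; here the coefficient 1 in the top
  position makes them do so.\<close>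

lemma monic_mult:
  fixes p q :: "'b::comm_ring_1 poly"
  assumes "lead_coeff p = 1" "lead_coeff q = 1"
  shows "lead_coeff (p * q) = 1"
proof -
  have "coeff (p * q) (degree p + degree q) = 1" using assms by (simp add: coeff_mult_degree_sum)
  moreover from this have "degree (p * q) = degree p + degree q"
    by (intro antisym degree_mult_le le_degree) simp
  ultimately show ?thesis by simp
qed

text \<open>The values at \<alpha> of monic polynomials over \<open>R\<close> form a
  multiplicatively closed set, which omits 0 because \<alpha> is not integral. An ideal maximal
  among those disjoint from such a set is prime.\<close>

lemma prime_avoiding_integrality:
  fixes \<alpha> :: "'b::comm_ring_1"
  assumes R: "is_subring R" and nint: "\<not> integral_over R \<alpha>"
  shows "\<exists>q. prime_ideal_in UNIV q \<and> 1 \<notin> q \<and> (\<forall>p\<in>polys_over R. lead_coeff p = 1 \<longrightarrow> poly p \<alpha> \<notin> q)"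
proof -
  define \<F> where "\<F> = {I. ring_ideal I \<and> (\<forall>p\<in>polys_over R. lead_coeff p = 1 \<longrightarrow> poly p \<alpha> \<notin> I)}"
  have "{0} \<in> \<F>" using nint integral_over_iff_monic[OF R] unfolding \<F>_def ring_ideal_def by auto
  then have ne: "\<F> \<noteq> {}" by blast
  have "\<exists>M\<in>\<F>. \<forall>I\<in>\<F>. M \<subseteq> I \<longrightarrow> I = M"
  proof (rule subset_Zorn_nonempty[OF ne])
    fix \<C> assume C: "\<C> \<noteq> {}" "subset.chain \<F> \<C>"
    have CF: "I \<in> \<F>" if "I \<in> \<C>" for I using C that unfolding subset.chain_def by blast
    have "x + y \<in> \<Union>\<C>" if "x \<in> \<Union>\<C>" "y \<in> \<Union>\<C>" for x y
    proof -
      obtain I J where IJ: "I \<in> \<C>" "x \<in> I" "J \<in> \<C>" "y \<in> J" using \<open>x \<in> \<Union>\<C>\<close> \<open>y \<in> \<Union>\<C>\<close> by blast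
      have "I \<subseteq> J \<or> J \<subseteq> I" using C(2) IJ unfolding subset.chain_def by blast
      then obtain K where "K \<in> \<C>" "x \<in> K" "y \<in> K" using IJ by blast
      then show ?thesis using CF[of K] unfolding \<F>_def ring_ideal_def by blast
    qed
    moreover have "x * a \<in> \<Union>\<C>" if "x \<in> \<Union>\<C>" for x a
      using that CF unfolding \<F>_def ring_ideal_def by blast
    moreover have "0 \<in> \<Union>\<C>" using C(1) CF unfolding \<F>_def ring_ideal_def by blast
    ultimately have "ring_ideal (\<Union>\<C>)" unfolding ring_ideal_def by blast
    moreover have "\<forall>p\<in>polys_over R. lead_coeff p = 1 \<longrightarrow> poly p \<alpha> \<notin> \<Union>\<C>" using CF unfolding \<F>_def by blast
    ultimately show "\<Union>\<C> \<in> \<F>" unfolding \<F>_def by blast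
  qed
  then obtain q where q: "q \<in> \<F>" and max: "\<And>I. I \<in> \<F> \<Longrightarrow> q \<subseteq> I \<Longrightarrow> I = q" by blast
  have qi: "ring_ideal q" and qn: "\<And>p. p \<in> polys_over R \<Longrightarrow> lead_coeff p = 1 \<Longrightarrow> poly p \<alpha> \<notin> q"
    using q unfolding \<F>_def by auto
  have add: "x + y \<in> q" if "x \<in> q" "y \<in> q" for x y using qi that unfolding ring_ideal_def by blast
  have mult: "x * a \<in> q" "a * x \<in> q" if "x \<in> q" for x a
    using qi that unfolding ring_ideal_def by (blast, metis mult.commute)
  have one: "1 \<notin> q" using qn[of 1] subring_one[OF subring_polys_over[OF R]] by simp
  have bigger: "\<exists>p h b. p \<in> polys_over R \<and> lead_coeff p = 1 \<and> h \<in> q \<and> poly p \<alpha> = h + a * b" if a: "a \<notin> q" for a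
  proof -
    define J where "J = {h + a * b |h b. h \<in> q}"
    have J0: "0 \<in> q" using qi unfolding ring_ideal_def by blast
    have "ring_ideal J"
      unfolding ring_ideal_def
    proof (intro conjI ballI allI)
      show "0 \<in> J" unfolding J_def using J0 by (auto intro!: exI[of _ 0])
      fix x y assume "x \<in> J" "y \<in> J"
      then obtain h b h' b' where "x = h + a * b" "y = h' + a * b'" "h \<in> q" "h' \<in> q" unfolding J_def by blast
      then have "x + y = (h + h') + a * (b + b')" "h + h' \<in> q" using add by (auto simp: algebra_simps)
      then show "x + y \<in> J" unfolding J_def by blast
    next
      fix x c assume "x \<in> J"
      then obtain h b where "x = h + a * b" "h \<in> q" unfolding J_def by blast
      then have "x * c = h * c + a * (b * c)" "h * c \<in> q" using mult(1)[of h c] by (simp_all add: distrib_right mult.assoc)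
      then show "x * c \<in> J" unfolding J_def by blast
    qed
    moreover have "q \<subseteq> J"
    proof
      fix h assume "h \<in> q"
      then have "h + a * 0 \<in> J" unfolding J_def by blast
      then show "h \<in> J" by simp
    qed
    moreover have "0 + a * 1 \<in> J" unfolding J_def using J0 by blast
    then have "a \<in> J" by simp
    ultimately have "J \<notin> \<F>" using max a by blast
    then show ?thesis using \<open>ring_ideal J\<close> unfolding \<F>_def J_def by blast
  qed
  have "a \<in> q \<or> b \<in> q" if ab: "a * b \<in> q" for a b
  proof (rule ccontr)
    assume "\<not> (a \<in> q \<or> b \<in> q)"
    then obtain p h c p' h' c' where p: "p \<in> polys_over R" "lead_coeff p = 1" "h \<in> q" "poly p \<alpha> = h + a * c"
      "p' \<in> polys_over R" "lead_coeff p' = 1" "h' \<in> q" "poly p' \<alpha> = h' + b * c'"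
      using bigger by meson
    have "poly (p * p') \<alpha> = h * (h' + b * c') + (h' * (a * c) + (a * b) * (c * c'))"
      using p by (simp add: algebra_simps)
    also have "\<dots> \<in> q" by (intro add mult p ab)
    finally show False using qn[of "p * p'"] p monic_mult subring_mult[OF subring_polys_over[OF R]] by blast
  qed
  then have "prime_ideal_in UNIV q"
    unfolding prime_ideal_in_def using add mult qi unfolding ring_ideal_def by blast
  then show ?thesis using one qn by blast
qed

text \<open>A partial embedding of the residue ring modulo \<open>q\<close> into \<open>'c\<close>,
  held as a subring of the product ring. The last clause gives both well-definedness and injectivity
  modulo \<open>q\<close>, so that neither quotients nor partial maps have to be formed.\<close>

definition graph_embedding :: "'b::comm_ring_1 set \<Rightarrow> ('b \<times> 'c::field) set \<Rightarrow> bool" where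
  "graph_embedding q G \<longleftrightarrow> (1, 1) \<in> G \<and>
     (\<forall>(b, z)\<in>G. \<forall>(b', z')\<in>G. (b - b', z - z') \<in> G \<and> (b * b', z * z') \<in> G) \<and>
     (\<forall>(b, z)\<in>G. b \<in> q \<longleftrightarrow> z = 0)"

definition poly_pairs :: "('b::comm_ring_1 \<times> 'c::field) set \<Rightarrow> ('b poly \<times> 'c poly) set" where
  "poly_pairs G = {(p, r). \<forall>i. (coeff p i, coeff r i) \<in> G}"

definition extend_graph :: "('b::comm_ring_1 \<times> 'c::field) set \<Rightarrow> 'b \<Rightarrow> 'c \<Rightarrow> ('b \<times> 'c) set" where
  "extend_graph G g \<rho> = (\<lambda>(p, r). (poly p g, poly r \<rho>)) ` poly_pairs G"

text \<open>Algebraicity modulo \<open>q\<close> of \<open>g\<close> over the domain of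
  \<open>G\<close>; the condition \<open>r \<noteq> 0\<close> says that \<open>p\<close> is nonzero
  modulo \<open>q\<close>.\<close>

definition graph_algebraic :: "'b::comm_ring_1 set \<Rightarrow> ('b \<times> 'c::field) set \<Rightarrow> 'b \<Rightarrow> bool" where
  "graph_algebraic q G g \<longleftrightarrow> (\<exists>(p, r)\<in>poly_pairs G. r \<noteq> 0 \<and> poly p g \<in> q)"

locale prime_quotient =
  fixes q :: "'b::comm_ring_1 set"
  assumes prime: "prime_ideal_in UNIV q" and one_not: "1 \<notin> q"
begin

lemma q_zero: "0 \<in> q" and q_add: "x \<in> q \<Longrightarrow> y \<in> q \<Longrightarrow> x + y \<in> q"
  and q_mult: "x \<in> q \<Longrightarrow> x * a \<in> q" and q_prime: "x * y \<in> q \<Longrightarrow> x \<in> q \<or> y \<in> q"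
  using prime unfolding prime_ideal_in_def by blast+

lemma q_mult_left: "x \<in> q \<Longrightarrow> a * x \<in> q"
  using q_mult[of x a] by (simp add: mult.commute)

lemma q_power: "x ^ n \<in> q \<Longrightarrow> x \<in> q"
  by (induction n) (use one_not q_prime in auto)

lemma q_sum: "(\<And>i. i \<in> S \<Longrightarrow> f i \<in> q) \<Longrightarrow> sum f S \<in> q"
  by (rule prime_ideal_in_sum[OF prime])

context
  fixes G :: "('b \<times> 'c::alg_closed_field) set"
  assumes G: "graph_embedding q G"
begin

lemma graph_one: "(1, 1) \<in> G"
  and graph_diff: "(b, z) \<in> G \<Longrightarrow> (b', z') \<in> G \<Longrightarrow> (b - b', z - z') \<in> G"
  and graph_mult: "(b, z) \<in> G \<Longrightarrow> (b', z') \<in> G \<Longrightarrow> (b * b', z * z') \<in> G"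
  and graph_kernel: "(b, z) \<in> G \<Longrightarrow> b \<in> q \<longleftrightarrow> z = 0"
  using G unfolding graph_embedding_def by blast+

lemma graph_zero: "(0, 0) \<in> G"
  using graph_diff[OF graph_one graph_one] by simp

lemma graph_add: "(b, z) \<in> G \<Longrightarrow> (b', z') \<in> G \<Longrightarrow> (b + b', z + z') \<in> G"
  using graph_diff[of b z "- b'" "- z'"] graph_diff[OF graph_zero, of b' z'] by simp

lemma graph_sum: "(\<And>i. i \<in> S \<Longrightarrow> (f i, h i) \<in> G) \<Longrightarrow> (sum f S, sum h S) \<in> G"
  by (induction S rule: infinite_finite_induct) (auto intro: graph_zero graph_add)

lemma pairs_diff: "(p, r) \<in> poly_pairs G \<Longrightarrow> (p', r') \<in> poly_pairs G \<Longrightarrow> (p - p', r - r') \<in> poly_pairs G"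
  by (auto simp: poly_pairs_def intro: graph_diff)

lemma pairs_add: "(p, r) \<in> poly_pairs G \<Longrightarrow> (p', r') \<in> poly_pairs G \<Longrightarrow> (p + p', r + r') \<in> poly_pairs G"
  by (auto simp: poly_pairs_def intro: graph_add)

lemma pairs_mult: "(p, r) \<in> poly_pairs G \<Longrightarrow> (p', r') \<in> poly_pairs G \<Longrightarrow> (p * p', r * r') \<in> poly_pairs G"
  unfolding poly_pairs_def by (auto simp: coeff_mult intro!: graph_sum graph_mult)

lemma pairs_monom: "(b, z) \<in> G \<Longrightarrow> (monom b n, monom z n) \<in> poly_pairs G"
  by (auto simp: poly_pairs_def graph_zero)

lemma pairs_smult: "(b, z) \<in> G \<Longrightarrow> (p, r) \<in> poly_pairs G \<Longrightarrow> (smult b p, smult z r) \<in> poly_pairs G"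
  by (auto simp: poly_pairs_def intro: graph_mult)

lemma pairs_coeff: "(p, r) \<in> poly_pairs G \<Longrightarrow> (coeff p i, coeff r i) \<in> G"
  by (auto simp: poly_pairs_def)

lemma pairs_zero_kernel:
  assumes "(p, 0) \<in> poly_pairs G" shows "poly p g \<in> q"
proof -
  have "coeff p i \<in> q" for i using pairs_coeff[OF assms, of i] graph_kernel by simp
  then show ?thesis unfolding poly_altdef by (intro q_sum q_mult) auto
qed

lemma extend_graph_superset: "G \<subseteq> extend_graph G g \<rho>"
proof
  fix x assume "x \<in> G"
  then obtain b z where x: "x = (b, z)" "(b, z) \<in> G" by (cases x) auto
  have "(\<lambda>(p, r). (poly p g, poly r \<rho>)) (monom b 0, monom z 0) \<in> extend_graph G g \<rho>"
    unfolding extend_graph_def by (rule imageI) (rule pairs_monom[OF x(2)])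
  then show "x \<in> extend_graph G g \<rho>" by (simp add: x poly_monom)
qed

lemma extend_graph_new: "(g, \<rho>) \<in> extend_graph G g \<rho>"
proof -
  have "(\<lambda>(p, r). (poly p g, poly r \<rho>)) (monom 1 1, monom 1 1) \<in> extend_graph G g \<rho>"
    unfolding extend_graph_def by (rule imageI) (rule pairs_monom[OF graph_one])
  then show ?thesis by (simp add: poly_monom)
qed

lemma graph_embedding_extend:
  assumes "\<And>p r. (p, r) \<in> poly_pairs G \<Longrightarrow> poly p g \<in> q \<longleftrightarrow> poly r \<rho> = 0"
  shows "graph_embedding q (extend_graph G g \<rho>)"
  unfolding graph_embedding_def
proof (intro conjI)
  show "(1, 1) \<in> extend_graph G g \<rho>" using graph_one extend_graph_superset by blast
  show "\<forall>(b, z)\<in>extend_graph G g \<rho>. \<forall>(b', z')\<in>extend_graph G g \<rho>.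
      (b - b', z - z') \<in> extend_graph G g \<rho> \<and> (b * b', z * z') \<in> extend_graph G g \<rho>"
  proof (clarify)
    fix b z b' z' assume "(b, z) \<in> extend_graph G g \<rho>" "(b', z') \<in> extend_graph G g \<rho>"
    then obtain p r p' r' where pr: "(p, r) \<in> poly_pairs G" "b = poly p g" "z = poly r \<rho>"
      "(p', r') \<in> poly_pairs G" "b' = poly p' g" "z' = poly r' \<rho>" unfolding extend_graph_def by auto
    have "(\<lambda>(p, r). (poly p g, poly r \<rho>)) (p - p', r - r') \<in> extend_graph G g \<rho>"
      "(\<lambda>(p, r). (poly p g, poly r \<rho>)) (p * p', r * r') \<in> extend_graph G g \<rho>"
      unfolding extend_graph_def by (rule imageI, intro pairs_diff pairs_mult pr)+
    then show "(b - b', z - z') \<in> extend_graph G g \<rho> \<and> (b * b', z * z') \<in> extend_graph G g \<rho>"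
      using pr by simp
  qed
  show "\<forall>(b, z)\<in>extend_graph G g \<rho>. (b \<in> q) = (z = 0)" using assms unfolding extend_graph_def by auto
qed

text \<open>Pseudo-division on both components at once. Degrees are measured in \<open>'c\<close>,
  since the first component may have terms above that degree with coefficients in \<open>q\<close>;
  hence the multiplier is \<open>coeff p (degree r)\<close> rather than the leading coefficient of
  \<open>p\<close>.\<close>

lemma pairs_pseudo_division:
  assumes p: "(p, r) \<in> poly_pairs G" "r \<noteq> 0"
  shows "(h, s) \<in> poly_pairs G \<Longrightarrow> \<exists>N u t h' s'. (u, t) \<in> poly_pairs G \<and> (h', s') \<in> poly_pairs G \<and>
    smult (coeff p (degree r) ^ N) h = p * u + h' \<and> smult (lead_coeff r ^ N) s = r * t + s' \<and>
    (s' = 0 \<or> degree s' < degree r)"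
proof (induction "degree s" arbitrary: h s rule: less_induct)
  case less
  show ?case
  proof (cases "s = 0 \<or> degree s < degree r")
    case True
    then show ?thesis using less.prems graph_zero
      by (intro exI[of _ 0] exI[of _ 0] exI[of _ 0] exI[of _ h] exI[of _ s]) (auto simp: poly_pairs_def)
  next
    case False
    define a b where "a = coeff p (degree r)" and "b = lead_coeff r"
    have ab: "(a, b) \<in> G" unfolding a_def b_def by (rule pairs_coeff[OF p(1)])
    define d c where "d = coeff h (degree s)" and "c = lead_coeff s"
    have dc: "(d, c) \<in> G" unfolding d_def c_def by (rule pairs_coeff[OF less.prems])
    define k where "k = degree s - degree r"
    define h1 s1 where "h1 = smult a h - p * monom d k" and "s1 = smult b s - r * monom c k"
    have hs1: "(h1, s1) \<in> poly_pairs G"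
      unfolding h1_def s1_def by (intro pairs_diff pairs_smult pairs_mult pairs_monom ab dc p less.prems)
    have deg_le: "degree (r * monom c k) \<le> degree s"
    proof -
      have "degree r + k = degree s" using False by (simp add: k_def)
      then show ?thesis using degree_mult_le[of r "monom c k"] degree_monom_le[of c k] by linarith
    qed
    have z: "coeff s1 i = 0" if "i \<ge> degree s" for i
    proof (cases "i = degree s")
      case True
      have "coeff (r * monom c k) (degree s) = b * c"
        using coeff_mult_degree_sum[of r "monom c k"] False lead_coeff_monom[of c k]
        by (simp add: k_def b_def c_def degree_monom_eq)
      then show ?thesis using True by (simp add: s1_def c_def)
    next
      case F: False
      then show ?thesis using that deg_le by (simp add: s1_def coeff_eq_0)
    qed
    have lt: "s1 = 0 \<or> degree s1 < degree s"
    proof (cases "s1 = 0")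
      case F: False
      then show ?thesis using z[of "degree s1"] leading_coeff_0_iff[of s1] by (meson not_le)
    qed simp
    have "\<exists>N u t h' s'. (u, t) \<in> poly_pairs G \<and> (h', s') \<in> poly_pairs G \<and>
      smult (a ^ N) h1 = p * u + h' \<and> smult (b ^ N) s1 = r * t + s' \<and> (s' = 0 \<or> degree s' < degree r)"
    proof (cases "s1 = 0")
      case True
      then show ?thesis using hs1 graph_zero
        by (intro exI[of _ 0] exI[of _ 0] exI[of _ 0] exI[of _ h1] exI[of _ s1]) (auto simp: poly_pairs_def)
    next
      case F: False
      then show ?thesis using less.hyps[OF _ hs1] lt unfolding a_def b_def by blast
    qed
    then obtain N u t h' s' where *: "(u, t) \<in> poly_pairs G" "(h', s') \<in> poly_pairs G"
      "smult (a ^ N) h1 = p * u + h'" "smult (b ^ N) s1 = r * t + s'" "s' = 0 \<or> degree s' < degree r" by blast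
    have aN: "(a ^ N, b ^ N) \<in> G" by (induction N) (auto intro: graph_one graph_mult[OF ab])
    have "smult (a ^ Suc N) h = p * (u + smult (a ^ N) (monom d k)) + h'"
    proof -
      have "smult (a ^ Suc N) h = smult (a ^ N) h1 + smult (a ^ N) (p * monom d k)"
        unfolding h1_def by (simp add: smult_diff_right mult.commute)
      then show ?thesis unfolding *(3) by (simp add: algebra_simps)
    qed
    moreover have "smult (b ^ Suc N) s = r * (t + smult (b ^ N) (monom c k)) + s'"
    proof -
      have "smult (b ^ Suc N) s = smult (b ^ N) s1 + smult (b ^ N) (r * monom c k)"
        unfolding s1_def by (simp add: smult_diff_right mult.commute)
      then show ?thesis unfolding *(4) by (simp add: algebra_simps)
    qed
    moreover have "(u + smult (a ^ N) (monom d k), t + smult (b ^ N) (monom c k)) \<in> poly_pairs G"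
      by (intro pairs_add pairs_smult pairs_monom aN dc *)
    ultimately show ?thesis using * unfolding a_def b_def by blast
  qed
qed

lemma extend_transcendental:
  assumes g: "\<not> graph_algebraic q G g" and \<rho>: "transcendental_over P \<rho>" "snd ` G \<subseteq> P"
  shows "graph_embedding q (extend_graph G g \<rho>)"
proof (rule graph_embedding_extend)
  fix p r assume pr: "(p, r) \<in> poly_pairs G"
  have "r \<in> polys_over P" using pairs_coeff[OF pr] \<rho>(2) unfolding polys_over_def by force
  then have "poly r \<rho> = 0 \<longleftrightarrow> r = 0" using \<rho>(1) unfolding transcendental_over_def by auto
  moreover have "poly p g \<in> q \<longleftrightarrow> r = 0"
    using g pr pairs_zero_kernel unfolding graph_algebraic_def by blast
  ultimately show "poly p g \<in> q \<longleftrightarrow> poly r \<rho> = 0" by simp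
qed

text \<open>The point \<rho> is a root of an \<open>r\<close> of least degree among the relations of
  \<open>g\<close> modulo \<open>q\<close>. Since \<open>q\<close> is prime, no relation of \<rho>
  has smaller degree than \<open>r\<close>. A pseudo-remainder modulo \<open>r\<close> is therefore
  0 as soon as it vanishes at \<rho>, or modulo \<open>q\<close> at \<open>g\<close>.\<close>

lemma extend_algebraic:
  assumes g: "graph_algebraic q G g"
  shows "\<exists>\<rho>. graph_embedding q (extend_graph G g \<rho>)"
proof -
  define A where "A x \<longleftrightarrow> x \<in> poly_pairs G \<and> snd x \<noteq> 0 \<and> poly (fst x) g \<in> q" for x
  have "\<exists>x. A x" using g unfolding A_def graph_algebraic_def by auto
  then obtain x where x: "A x" and minA: "\<And>y. A y \<Longrightarrow> degree (snd x) \<le> degree (snd y)"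
    using ex_has_least_nat[of A _ "\<lambda>x. degree (snd x)"] by blast
  obtain p r where xpr: "x = (p, r)" by (cases x)
  have p: "(p, r) \<in> poly_pairs G" "r \<noteq> 0" "poly p g \<in> q" using x by (auto simp: A_def xpr)
  have min: "degree r \<le> degree s" if "(h, s) \<in> poly_pairs G" "s \<noteq> 0" "poly h g \<in> q" for h s
    using minA[of "(h, s)"] that by (simp add: A_def xpr)
  have deg_zero: "(coeff h 0, coeff s 0) \<in> G \<and> poly h g - coeff h 0 \<in> q"
    if "(h, s) \<in> poly_pairs G" "degree s = 0" for h s
  proof
    show "(coeff h 0, coeff s 0) \<in> G" by (rule pairs_coeff[OF that(1)])
    have "(monom (coeff h 0) 0, monom (coeff s 0) 0) \<in> poly_pairs G"
      by (intro pairs_monom pairs_coeff that)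
    moreover have "s - monom (coeff s 0) 0 = 0"
      using degree_eq_zeroE[OF that(2)] by (metis coeff_pCons_0 diff_self monom_0)
    ultimately have "(h - monom (coeff h 0) 0, 0) \<in> poly_pairs G" using pairs_diff[OF that(1)] by metis
    from pairs_zero_kernel[OF this, of g] show "poly h g - coeff h 0 \<in> q" by (simp add: poly_monom)
  qed
  have "degree r > 0"
  proof (rule ccontr)
    assume "\<not> degree r > 0"
    then have d: "degree r = 0" by simp
    from deg_zero[OF p(1) d] have "(coeff p 0, coeff r 0) \<in> G" "poly p g - coeff p 0 \<in> q" by auto
    moreover have "coeff p 0 = poly p g + (poly p g - coeff p 0) * (-1)" by simp
    ultimately have "coeff p 0 \<in> q" using p(3) q_add q_mult by metis
    then have "coeff r 0 = 0" using graph_kernel \<open>(coeff p 0, coeff r 0) \<in> G\<close> by blast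
    then show False using p(2) d by (metis leading_coeff_0_iff)
  qed
  then obtain \<rho> where rho: "poly r \<rho> = 0" using alg_closed_imp_poly_has_root by blast
  define B where "B x \<longleftrightarrow> x \<in> poly_pairs G \<and> snd x \<noteq> 0 \<and> poly (snd x) \<rho> = 0" for x
  have "B (p, r)" using p rho by (simp add: B_def)
  then obtain y where y: "B y" and minB: "\<And>x. B x \<Longrightarrow> degree (snd y) \<le> degree (snd x)"
    using ex_has_least_nat[of B _ "\<lambda>x. degree (snd x)"] by blast
  obtain h s where yhs: "y = (h, s)" by (cases y)
  have h: "(h, s) \<in> poly_pairs G" "s \<noteq> 0" "poly s \<rho> = 0" using y by (auto simp: B_def yhs)
  have minh: "degree s \<le> degree s'" if "(h', s') \<in> poly_pairs G" "s' \<noteq> 0" "poly s' \<rho> = 0" for h' s'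
    using minB[of "(h', s')"] that by (simp add: B_def yhs)
  have deg_s: "degree s > 0"
  proof (rule ccontr)
    assume "\<not> degree s > 0"
    then obtain c where "s = [:c:]" using degree_eq_zeroE[of s] by blast
    then show False using h by simp
  qed
  \<comment> \<open>A relation \<open>s\<close> of smaller degree would divide \<open>r\<close> up
    to a scalar, and by primality one of the two factors would be a relation of \<open>g\<close>
    below the minimal degree.\<close>
  have deg: "degree r \<le> degree s"
  proof (rule ccontr)
    assume "\<not> degree r \<le> degree s"
    then have lt: "degree s < degree r" by simp
    obtain N u t h' s' where *: "(u, t) \<in> poly_pairs G" "(h', s') \<in> poly_pairs G"
      "smult (coeff h (degree s) ^ N) p = h * u + h'" "smult (lead_coeff s ^ N) r = s * t + s'"
      "s' = 0 \<or> degree s' < degree s" using pairs_pseudo_division[OF h(1,2) p(1)] by blast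
    have "poly s' \<rho> = 0" using arg_cong[OF *(4), of "\<lambda>p. poly p \<rho>"] rho h(3) by simp
    then have s': "s' = 0" using minh[OF *(2)] *(5) by force
    have t: "t \<noteq> 0" using *(4) s' p(2) h(2) by auto
    have "poly h' g \<in> q" using *(2) s' pairs_zero_kernel by blast
    moreover have "poly (smult (coeff h (degree s) ^ N) p) g \<in> q" using p(3) by (simp add: q_mult_left)
    moreover have "poly h g * poly u g = poly (smult (coeff h (degree s) ^ N) p) g + poly h' g * (-1)"
      unfolding *(3) by simp
    ultimately have "poly h g * poly u g \<in> q" using q_add q_mult by metis
    then have "poly h g \<in> q \<or> poly u g \<in> q" by (rule q_prime)
    then have "degree r \<le> degree s \<or> degree r \<le> degree t" using min h(1,2) *(1) t by blast
    moreover have "degree r = degree s + degree t"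
      using arg_cong[OF *(4), of degree] s' t h(2) by (simp add: degree_mult_eq)
    ultimately show False using lt deg_s by linarith
  qed
  have lr: "lead_coeff r \<noteq> 0" using p(2) by simp
  have lp: "coeff p (degree r) \<notin> q" using graph_kernel[OF pairs_coeff[OF p(1)]] lr by blast
  have "poly f g \<in> q \<longleftrightarrow> poly k \<rho> = 0" if fk: "(f, k) \<in> poly_pairs G" for f k
  proof -
    obtain N u t h' s' where *: "(u, t) \<in> poly_pairs G" "(h', s') \<in> poly_pairs G"
      "smult (coeff p (degree r) ^ N) f = p * u + h'" "smult (lead_coeff r ^ N) k = r * t + s'"
      "s' = 0 \<or> degree s' < degree r" using pairs_pseudo_division[OF p(1,2) fk] by blast
    have 1: "lead_coeff r ^ N * poly k \<rho> = poly s' \<rho>" using arg_cong[OF *(4), of "\<lambda>p. poly p \<rho>"] rho by simp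
    have 2: "coeff p (degree r) ^ N * poly f g = poly p g * poly u g + poly h' g"
      using arg_cong[OF *(3), of "\<lambda>p. poly p g"] by simp
    show ?thesis
    proof
      assume f: "poly f g \<in> q"
      have "poly h' g = coeff p (degree r) ^ N * poly f g + poly p g * (- poly u g)" unfolding 2 by simp
      then have "poly h' g \<in> q" using q_add q_mult[OF p(3)] q_mult_left[OF f] by metis
      then have "s' = 0" using min[OF *(2)] *(5) by force
      then show "poly k \<rho> = 0" using 1 lr by simp
    next
      assume "poly k \<rho> = 0"
      then have "poly s' \<rho> = 0" using 1 by simp
      then have "s' = 0" using minh[OF *(2)] *(5) deg by force
      then have "poly h' g \<in> q" using *(2) pairs_zero_kernel by blast
      then have "coeff p (degree r) ^ N * poly f g \<in> q" unfolding 2 using q_add q_mult p(3) by metis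
      then show "poly f g \<in> q" using q_prime q_power lp by blast
    qed
  qed
  then have "graph_embedding q (extend_graph G g \<rho>)" by (rule graph_embedding_extend)
  then show ?thesis by blast
qed

end

lemma graph_algebraic_mono: "graph_algebraic q G g \<Longrightarrow> G \<subseteq> H \<Longrightarrow> graph_algebraic q H g"
  unfolding graph_algebraic_def poly_pairs_def by blast

lemma graph_algebraic_mem:
  assumes G: "graph_embedding q (G :: ('b \<times> 'c::alg_closed_field) set)" and g: "(g, z) \<in> G"
  shows "graph_algebraic q G g"
proof -
  have "(monom 1 1 - monom g 0, monom 1 1 - monom z 0) \<in> poly_pairs G"
    by (intro pairs_diff[OF G] pairs_monom[OF G] graph_one[OF G] g)
  moreover have "monom 1 1 - monom z 0 \<noteq> 0"
  proof
    assume "monom 1 1 - monom z 0 = 0"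
    then have "coeff (monom 1 1 - monom z 0) 1 = 0" by (metis coeff_0)
    then show False by simp
  qed
  moreover have "poly (monom 1 1 - monom g 0) g \<in> q" using q_zero by (simp add: poly_monom)
  ultimately show ?thesis unfolding graph_algebraic_def by blast
qed

text \<open>A transcendence basis chosen among the generators is sent to some of the
  \<open>Y n\<close>, and the remaining generators are algebraic over it. The chain
  \<open>P n\<close> bounds the part of the target used so far, over which \<open>Y n\<close> is
  still transcendental.\<close>

theorem residue_ring_embedding:
  fixes \<iota> :: "'k::field \<Rightarrow> 'b" and \<kappa> :: "'k \<Rightarrow> 'c::alg_closed_field" and Y :: "nat \<Rightarrow> 'c"
  assumes \<iota>: "ring_hom_fun \<iota>" and \<kappa>: "ring_hom_fun \<kappa>"
    and E: "finite E" "ring_hull (range \<iota> \<union> E) = UNIV"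
    and P: "\<And>n. is_subring (P n)" "\<And>n. P n \<subseteq> P (Suc n)" "range \<kappa> \<subseteq> P 0"
      "\<And>n. Y n \<in> P (Suc n)" "\<And>n. transcendental_over (P n) (Y n)"
  shows "\<exists>\<psi> :: 'b \<Rightarrow> 'c. ring_hom_fun \<psi> \<and> (\<forall>c. \<psi> (\<iota> c) = \<kappa> c) \<and> (\<forall>b. \<psi> b = 0 \<longleftrightarrow> b \<in> q)"
proof -
  define G0 where "G0 = (\<lambda>c. (\<iota> c, \<kappa> c)) ` UNIV"
  have hom_diff: "f (x - y) = f x - f y" if "ring_hom_fun f" for f :: "'k \<Rightarrow> 'z::comm_ring_1" and x y
    using that unfolding ring_hom_fun_def by (metis add_diff_cancel diff_add_cancel)
  have hom_0: "f 0 = 0" if "ring_hom_fun f" for f :: "'k \<Rightarrow> 'z::comm_ring_1"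
    using hom_diff[OF that, of 0 0] by simp
  have G0: "graph_embedding q G0"
    unfolding graph_embedding_def
  proof (intro conjI)
    show "(1, 1) \<in> G0" using \<iota> \<kappa> unfolding ring_hom_fun_def G0_def by (metis (mono_tags, lifting) rangeI)
    show "\<forall>(b, z)\<in>G0. \<forall>(b', z')\<in>G0. (b - b', z - z') \<in> G0 \<and> (b * b', z * z') \<in> G0"
      unfolding G0_def
      using hom_diff[OF \<iota>, symmetric] hom_diff[OF \<kappa>, symmetric] \<iota> \<kappa>[unfolded ring_hom_fun_def] \<iota>[unfolded ring_hom_fun_def]
      by (auto simp: image_iff) metis+
    have "\<iota> c \<in> q \<longleftrightarrow> \<kappa> c = 0" for c
    proof (cases "c = 0")
      case True then show ?thesis using hom_0[OF \<iota>] hom_0[OF \<kappa>] q_zero by simp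
    next
      case False
      have "\<iota> c * \<iota> (inverse c) = 1" "\<kappa> c * \<kappa> (inverse c) = 1"
        using \<iota> \<kappa> False unfolding ring_hom_fun_def by (metis right_inverse)+
      then show ?thesis using q_mult[of "\<iota> c" "\<iota> (inverse c)"] one_not by auto
    qed
    then show "\<forall>(b, z)\<in>G0. (b \<in> q) = (z = 0)" unfolding G0_def by auto
  qed
  \<comment> \<open>Transcendental generators are adjoined before any algebraic one, because roots
    may leave the subrings \<open>P n\<close>.\<close>
  have "\<exists>G n. graph_embedding q G \<and> G0 \<subseteq> G \<and> snd ` G \<subseteq> P n \<and> (\<forall>g\<in>E. graph_algebraic q G g)"
    using E(1)
  proof (induction E)
    case empty
    have "snd ` G0 \<subseteq> P 0" using P(3) unfolding G0_def by auto
    then show ?case using G0 by blast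
  next
    case (insert g E)
    then obtain G n where G: "graph_embedding q G" "G0 \<subseteq> G" "snd ` G \<subseteq> P n" "\<forall>g\<in>E. graph_algebraic q G g"
      by blast
    show ?case
    proof (cases "graph_algebraic q G g")
      case True then show ?thesis using G by blast
    next
      case False
      define H where "H = extend_graph G g (Y n)"
      have H: "graph_embedding q H" unfolding H_def using extend_transcendental[OF G(1) False P(5) G(3)] .
      have GH: "G \<subseteq> H" unfolding H_def by (rule extend_graph_superset[OF G(1)])
      have "poly r (Y n) \<in> P (Suc n)" if "(p, r) \<in> poly_pairs G" for p r
      proof -
        have "r \<in> polys_over (P (Suc n))"
          using pairs_coeff[OF G(1) that] G(3) P(2)[of n] unfolding polys_over_def by force
        then show ?thesis using poly_in_subring[OF P(1) _ P(4)] by blast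
      qed
      then have "snd ` H \<subseteq> P (Suc n)" unfolding H_def extend_graph_def by auto
      moreover have "graph_algebraic q H g"
        using graph_algebraic_mem[OF H] extend_graph_new[OF G(1)] unfolding H_def by blast
      ultimately show ?thesis using H GH G graph_algebraic_mono[OF _ GH] by blast
    qed
  qed
  then obtain G where G: "graph_embedding q G" "G0 \<subseteq> G" "\<forall>g\<in>E. graph_algebraic q G g" by blast
  have "\<exists>H. graph_embedding q H \<and> G \<subseteq> H \<and> E \<subseteq> fst ` H"
    using E(1) G(3)
  proof (induction E)
    case empty then show ?case using G(1) by blast
  next
    case (insert g E)
    then obtain H where H: "graph_embedding q H" "G \<subseteq> H" "E \<subseteq> fst ` H" by blast
    have "graph_algebraic q H g" using insert.prems graph_algebraic_mono[OF _ H(2)] by blast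
    then obtain \<rho> where rho: "graph_embedding q (extend_graph H g \<rho>)" using extend_algebraic[OF H(1)] by blast
    have "g \<in> fst ` extend_graph H g \<rho>" using extend_graph_new[OF H(1)] by force
    then show ?case using rho H extend_graph_superset[OF H(1), of g \<rho>] by blast
  qed
  then obtain H where H: "graph_embedding q H" "G0 \<subseteq> H" "E \<subseteq> fst ` H" using G(2) by blast
  note Hc = graph_one[OF H(1)] graph_diff[OF H(1)] graph_mult[OF H(1)] graph_kernel[OF H(1)] graph_add[OF H(1)]
  have "is_subring (fst ` H)"
    unfolding is_subring_def
  proof (intro conjI ballI)
    show "1 \<in> fst ` H" using Hc(1) by force
    fix x y assume "x \<in> fst ` H" "y \<in> fst ` H"
    then obtain z z' where "(x, z) \<in> H" "(y, z') \<in> H" by force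
    then show "x - y \<in> fst ` H" "x * y \<in> fst ` H" using Hc(2)[of x z y z'] Hc(3)[of x z y z'] by force+
  qed
  moreover have "range \<iota> \<union> E \<subseteq> fst ` H"
  proof -
    have "fst (\<iota> c, \<kappa> c) \<in> fst ` H" for c using H(2) unfolding G0_def by (intro imageI) blast
    then show ?thesis using H(3) by auto
  qed
  ultimately have "fst ` H = UNIV" using ring_hull_minimal[of "fst ` H" "range \<iota> \<union> E"] unfolding E(2) by blast
  then have ex: "\<exists>z. (b, z) \<in> H" for b by (metis (no_types) UNIV_I imageE prod.collapse)
  have unique: "z = z'" if "(b, z) \<in> H" "(b, z') \<in> H" for b z z'
    using Hc(2)[OF that] Hc(4)[of 0 "z - z'"] q_zero by simp
  define \<psi> where "\<psi> b = (SOME z. (b, z) \<in> H)" for b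
  have psi: "(b, \<psi> b) \<in> H" for b unfolding \<psi>_def by (rule someI_ex[OF ex])
  have "ring_hom_fun \<psi>"
    unfolding ring_hom_fun_def
    using unique[OF psi Hc(1)] unique[OF psi Hc(5)[OF psi psi]] unique[OF psi Hc(3)[OF psi psi]] by blast
  moreover have "\<psi> (\<iota> c) = \<kappa> c" for c using H(2) unique[OF psi] unfolding G0_def by blast
  moreover have "\<psi> b = 0 \<longleftrightarrow> b \<in> q" for b using Hc(4)[OF psi] by blast
  ultimately show ?thesis by blast
qed

end

section \<open>A field with enough transcendental elements\<close>

text \<open>The types depend on k alone, so one field serves every \<open>'b\<close> and every prime
  \<open>q\<close>; countably many variables leave a fresh transcendental for each of the finitely
  many generators.\<close>

type_synonym 'k variable_ring = "(nat \<Rightarrow>\<^sub>0 nat) \<Rightarrow>\<^sub>0 'k"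
type_synonym 'k big_field = "'k variable_ring fract alg_closure"

definition to_big_field :: "'k::field variable_ring \<Rightarrow> 'k big_field" where
  "to_big_field x = to_ac (Fract x 1)"

definition vars_below :: "nat \<Rightarrow> 'k::field variable_ring set" where
  "vars_below n = {p. \<forall>m\<in>Poly_Mapping.keys p. \<forall>j\<ge>n. Poly_Mapping.lookup m j = 0}"

definition variable :: "nat \<Rightarrow> 'k::field variable_ring" where
  "variable n = Poly_Mapping.single (Poly_Mapping.single n 1) 1"

lemma to_big_field_hom:
  "to_big_field 1 = 1" "to_big_field (x + y) = to_big_field x + to_big_field y"
  "to_big_field (x * y) = to_big_field x * to_big_field y" "to_big_field x = 0 \<longleftrightarrow> x = 0"
  by (simp_all add: to_big_field_def One_fract_def[symmetric] Zero_fract_def eq_fract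
      flip: to_ac_add to_ac_mult)

lemma ring_hom_to_big_field: "ring_hom_fun to_big_field"
  by (simp add: ring_hom_fun_def to_big_field_hom)

lemma is_subring_vars_below: "is_subring (vars_below n)"
  unfolding is_subring_def
proof (intro conjI ballI)
  show "1 \<in> vars_below n" by (simp add: vars_below_def)
  fix x y :: "'a variable_ring" assume xy: "x \<in> vars_below n" "y \<in> vars_below n"
  have "Poly_Mapping.keys (x - y) \<subseteq> Poly_Mapping.keys x \<union> Poly_Mapping.keys y"
    by (auto simp: in_keys_iff lookup_minus)
  then show "x - y \<in> vars_below n" using xy unfolding vars_below_def by blast
  have "Poly_Mapping.lookup m j = 0" if m: "m \<in> Poly_Mapping.keys (x * y)" and j: "j \<ge> n" for m j
  proof -
    obtain a b where "m = a + b" "a \<in> Poly_Mapping.keys x" "b \<in> Poly_Mapping.keys y"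
      using keys_mult[of x y] m by blast
    then show ?thesis using xy j by (simp add: vars_below_def lookup_add)
  qed
  then show "x * y \<in> vars_below n" by (simp add: vars_below_def)
qed

lemma is_subring_image_vars_below: "is_subring (to_big_field ` vars_below n)"
  by (rule is_subring_image[OF ring_hom_to_big_field is_subring_vars_below])

lemma variable_power: "variable n ^ i = Poly_Mapping.single (Poly_Mapping.single n i) 1"
  by (induction i) (simp_all add: variable_def mult_single single_add[symmetric])

lemma poly_mapping_sum_single:
  "(\<Sum>k\<in>Poly_Mapping.keys a. Poly_Mapping.single k (Poly_Mapping.lookup a k)) = a"
  by (rule poly_mapping_eqI) (simp add: lookup_sum lookup_single when_def in_keys_iff sum.delta)

lemma lookup_mult_single:
  fixes a :: "'a::cancel_comm_monoid_add \<Rightarrow>\<^sub>0 'k::comm_semiring_1"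
  shows "Poly_Mapping.lookup (a * Poly_Mapping.single s 1) (m + s) = Poly_Mapping.lookup a m"
proof -
  have "a * Poly_Mapping.single s 1 =
      (\<Sum>k\<in>Poly_Mapping.keys a. Poly_Mapping.single k (Poly_Mapping.lookup a k)) * Poly_Mapping.single s 1"
    by (simp add: poly_mapping_sum_single)
  also have "\<dots> = (\<Sum>k\<in>Poly_Mapping.keys a. Poly_Mapping.single (k + s) (Poly_Mapping.lookup a k))"
    by (simp add: sum_distrib_right mult_single)
  finally show ?thesis
    by (simp add: lookup_sum lookup_single when_def in_keys_iff sum.delta)
qed

text \<open>The \<open>a i\<close> are free of the variable \<open>n\<close>, so the monomials of
  \<open>a i * variable n ^ i\<close> for different \<open>i\<close> differ in their exponent at
  \<open>n\<close>. Each coefficient of \<open>a j\<close> can therefore be read off from the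
  sum.\<close>

lemma transcendental_variable:
  "transcendental_over (to_big_field ` vars_below n) (to_big_field (variable n :: 'k::field variable_ring))"
  unfolding transcendental_over_def
proof (intro ballI impI)
  fix f :: "'k big_field poly"
  assume f: "f \<in> polys_over (to_big_field ` vars_below n)" and root: "poly f (to_big_field (variable n)) = 0"
  have "\<exists>a. \<forall>i. a i \<in> vars_below n \<and> coeff f i = to_big_field (a i)"
    by (rule choice) (use polys_overD[OF f] in blast)
  then obtain a where a: "\<And>i. a i \<in> vars_below n" "\<And>i. coeff f i = to_big_field (a i)" by blast
  define h where "h i = a i * variable n ^ i" for i
  have "to_big_field (\<Sum>i\<le>degree f. h i) = poly f (to_big_field (variable n))"
    unfolding poly_altdef h_def by (simp add: ring_hom_fun_simps[OF ring_hom_to_big_field] a)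
  then have sum0: "(\<Sum>i\<le>degree f. h i) = 0" using root by (simp add: to_big_field_hom)
  have "a j = 0" if j: "j \<le> degree f" for j
  proof (rule poly_mapping_eqI)
    fix m
    show "Poly_Mapping.lookup (a j) m = Poly_Mapping.lookup 0 m"
    proof (cases "m \<in> Poly_Mapping.keys (a j)")
      case True
      then have mn: "Poly_Mapping.lookup m n = 0" using a(1)[of j] by (simp add: vars_below_def)
      have "Poly_Mapping.lookup (h i) (m + Poly_Mapping.single n j) = 0" if ij: "i \<noteq> j" for i
      proof (rule ccontr)
        assume "\<not> ?thesis"
        then have "m + Poly_Mapping.single n j \<in> Poly_Mapping.keys (h i)" by (simp add: in_keys_iff)
        then obtain k where k: "m + Poly_Mapping.single n j = k + Poly_Mapping.single n i"
          "k \<in> Poly_Mapping.keys (a i)"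
          using keys_mult[of "a i" "variable n ^ i"] unfolding h_def variable_power by auto
        have "Poly_Mapping.lookup k n = 0" using k(2) a(1)[of i] by (simp add: vars_below_def)
        then show False using arg_cong[OF k(1), of "\<lambda>m. Poly_Mapping.lookup m n"] mn ij by (simp add: lookup_add)
      qed
      then have "(\<Sum>i\<le>degree f. Poly_Mapping.lookup (h i) (m + Poly_Mapping.single n j)) =
          Poly_Mapping.lookup (h j) (m + Poly_Mapping.single n j)"
        using j by (subst sum.remove[of _ j]) auto
      also have "\<dots> = Poly_Mapping.lookup (a j) m"
        unfolding h_def variable_power by (rule lookup_mult_single)
      finally show ?thesis using sum0 by (simp add: lookup_sum[symmetric])
    qed (simp add: in_keys_iff)
  qed
  then have "lead_coeff f = 0" using a(2) to_big_field_hom(4) by auto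
  then show "f = 0" by simp
qed

section \<open>Integral elements and the Berkovich spectrum\<close>

lemma mult_seminorm_sum_le:
  assumes "mult_seminorm f" shows "f (sum g S) \<le> (\<Sum>i\<in>S. f (g i))"
proof (induction S rule: infinite_finite_induct)
  case (insert x S)
  have "f (g x + sum g S) \<le> f (g x) + f (sum g S)" using assms unfolding mult_seminorm_def by blast
  then show ?case using insert by simp
qed (use assms in \<open>auto simp: mult_seminorm_def\<close>)

text \<open>Only the triangle inequality is available for \<open>f\<close>, so the terms of the
  integral equation cannot be compared directly. Instead all powers of \<alpha> are combinations
  over \<open>S\<close> of the first \<open>n\<close> of them, which bounds the powers of
  \<open>f \<alpha>\<close>.\<close>

lemma integral_seminorm_le_one:
  assumes f: "mult_seminorm f" "f 1 = 1" and S: "is_subring S" "\<And>s. s \<in> S \<Longrightarrow> f s \<le> 1"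
    and \<alpha>: "integral_over S \<alpha>"
  shows "f \<alpha> \<le> 1"
proof (rule ccontr)
  assume big: "\<not> f \<alpha> \<le> 1"
  have fm: "f (x * y) = f x * f y" "f x \<ge> 0" for x y using f(1) unfolding mult_seminorm_def by blast+
  have fp: "f (x ^ n) = f x ^ n" for x n by (induction n) (auto simp: f(2) fm)
  obtain n c where c: "\<forall>i<n. c i \<in> S" and eq: "\<alpha> ^ n + (\<Sum>i<n. c i * \<alpha> ^ i) = 0"
    using \<alpha> unfolding integral_over_def by blast
  have n: "n > 0" using eq by (cases n) auto
  have an: "\<alpha> ^ n = - (\<Sum>i<n. c i * \<alpha> ^ i)" using eq by (simp add: eq_neg_iff_add_eq_0)
  note I = subring_intros[OF S(1)]
  have "\<exists>d. (\<forall>i<n. d i \<in> S) \<and> \<alpha> ^ m = (\<Sum>i<n. d i * \<alpha> ^ i)" for m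
  proof (induction m)
    case 0
    have "(\<Sum>i<n. (if i = 0 then 1 else 0) * \<alpha> ^ i) = 1" using n by (simp add: if_distrib[of "\<lambda>x. x * _"] sum.delta cong: if_cong)
    then show ?case using I(1,4) by (intro exI[of _ "\<lambda>i. if i = 0 then 1 else 0"]) auto
  next
    case (Suc m)
    then obtain d where d: "\<forall>i<n. d i \<in> S" "\<alpha> ^ m = (\<Sum>i<n. d i * \<alpha> ^ i)" by blast
    obtain k where k: "n = Suc k" using n by (cases n) auto
    \<comment> \<open>Multiplication by \<alpha> shifts the coefficients, and the integral equation
      removes the resulting term of degree \<open>n\<close>.\<close>
    define d' where "d' i = (if i = 0 then 0 else d (i - 1)) - d k * c i" for i
    have "\<alpha> ^ Suc m = (\<Sum>i<n. d i * \<alpha> ^ Suc i)" unfolding power_Suc[of \<alpha> m] d(2) by (simp add: sum_distrib_left mult_ac)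
    also have "\<dots> = (\<Sum>i<k. d i * \<alpha> ^ Suc i) + d k * \<alpha> ^ n" unfolding k by simp
    also have "(\<Sum>i<k. d i * \<alpha> ^ Suc i) = (\<Sum>i<n. (if i = 0 then 0 else d (i - 1)) * \<alpha> ^ i)"
      unfolding k by (subst sum.lessThan_Suc_shift) simp
    also have "\<dots> + d k * \<alpha> ^ n = (\<Sum>i<n. d' i * \<alpha> ^ i)"
      unfolding an d'_def by (simp add: left_diff_distrib sum_subtractf sum_distrib_left mult.assoc)
    finally have "\<alpha> ^ Suc m = (\<Sum>i<n. d' i * \<alpha> ^ i)" .
    moreover have "d' i \<in> S" if "i < n" for i
      using d(1) c that k by (auto simp: d'_def intro!: I)
    ultimately show ?case by blast
  qed
  then obtain d where d: "\<And>m i. i < n \<Longrightarrow> d m i \<in> S" "\<And>m. \<alpha> ^ m = (\<Sum>i<n. d m i * \<alpha> ^ i)" by metis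
  have "f \<alpha> ^ m \<le> (\<Sum>i<n. f \<alpha> ^ i)" for m
  proof -
    have "f \<alpha> ^ m = f (\<Sum>i<n. d m i * \<alpha> ^ i)" by (simp only: fp[symmetric] d(2)[symmetric])
    also have "\<dots> \<le> (\<Sum>i<n. f (d m i * \<alpha> ^ i))" by (rule mult_seminorm_sum_le[OF f(1)])
    also have "\<dots> \<le> (\<Sum>i<n. f \<alpha> ^ i)"
      using S(2)[OF d(1)] fm(2) by (intro sum_mono) (simp add: fm fp mult_left_le_one_le)
    finally show ?thesis .
  qed
  moreover obtain m where "(\<Sum>i<n. f \<alpha> ^ i) < f \<alpha> ^ m" using real_arch_pow[of "f \<alpha>"] big by auto
  ultimately show False by (meson not_le)
qed

theorem exists_seminorm_greater_one:
  fixes v :: "'k::field \<Rightarrow> real"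
    and j :: "'k \<Rightarrow> 'a::comm_ring_1"
    and \<iota> :: "'k \<Rightarrow> 'b::comm_ring_1"
    and \<phi> :: "'a \<Rightarrow> 'b"
  assumes v: "nonarch_abs v" and fg: "fin_gen_alg (valring v) j"
    and bc: "base_change_field (valring v) j \<iota> \<phi>"
    and nint: "\<not> integral_over (range \<phi>) \<alpha>"
  shows "\<exists>x\<in>berk_an_model v \<iota> \<phi>. x \<alpha> > 1"
proof -
  have \<iota>: "ring_hom_fun \<iota>" and \<phi>: "ring_hom_fun \<phi>" and compat: "\<And>c. v c \<le> 1 \<Longrightarrow> \<phi> (j c) = \<iota> c"
    and frac: "\<And>b. \<exists>a s. v s \<le> 1 \<and> s \<noteq> 0 \<and> \<iota> s * b = \<phi> a"
    using bc unfolding base_change_field_def valring_def by auto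
  note vs = nonarch_abs_simps[OF v] and i = ring_hom_fun_simps[OF \<iota>] and ph = ring_hom_fun_simps[OF \<phi>]
  have R: "is_subring (range \<phi>)" by (rule is_subring_image[OF \<phi> is_subring_UNIV])
  have \<iota>_inv: "\<iota> (inverse s) * (\<iota> s * b) = b" if "s \<noteq> 0" for s b
    using i(3)[of "inverse s" s] i(1) that by (simp add: mult.assoc[symmetric])
  \<comment> \<open>Taking \<pi> as a denominator of \<alpha> makes \<alpha> one of the elements
    that \<open>good_ring\<close> speaks of, with exponent 1.\<close>
  obtain a0 \<pi> where pi: "v \<pi> \<le> 1" "\<pi> \<noteq> 0" "\<iota> \<pi> * \<alpha> = \<phi> a0" using frac by blast
  have pi_pos: "0 < v \<pi>" using pi(2) vs(6,7) by (metis order_le_less)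
  \<comment> \<open>A denominator of absolute value 1 is invertible in the ring of integers and
    would put \<alpha> into the image of \<phi>. The case of a trivially valued k ends here.\<close>
  have pi_less: "v \<pi> < 1"
  proof (rule ccontr)
    assume "\<not> v \<pi> < 1"
    then have "v (inverse \<pi>) \<le> 1" using pi vs(9) by simp
    then have "\<alpha> = \<phi> (j (inverse \<pi>) * a0)" using \<iota>_inv[OF pi(2), of \<alpha>] pi(3) compat by (simp add: ph)
    then show False using nint integral_over_mem[OF R] by blast
  qed
  obtain G where G: "finite G" "gen_alg (valring v) j G = UNIV" using fg unfolding fin_gen_alg_def by blast
  have gen: "\<phi> a \<in> S" if S: "is_subring S" "\<iota> ` valring v \<subseteq> S" "\<phi> ` G \<subseteq> S" for a S
  proof -
    have "a \<in> gen_alg (valring v) j G" using G(2) by simp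
    then show ?thesis
    proof induction
      case (scal c) then show ?case using S(2) compat[of c] by (auto simp: valring_def)
    next
      case (gen g) then show ?case using S(3) by blast
    qed (use S(1) in \<open>auto simp: ph intro: subring_add subring_mult\<close>)
  qed
  have UN: "ring_hull (range \<iota> \<union> \<phi> ` G) = UNIV"
  proof -
    note H = is_subring_ring_hull[of "range \<iota> \<union> \<phi> ` G"] and sup = ring_hull_superset[of "range \<iota> \<union> \<phi> ` G"]
    have "b \<in> ring_hull (range \<iota> \<union> \<phi> ` G)" for b
    proof -
      obtain a s where as: "s \<noteq> 0" "\<iota> s * b = \<phi> a" using frac by blast
      have "\<phi> a \<in> ring_hull (range \<iota> \<union> \<phi> ` G)" using sup by (intro gen H) auto
      moreover have "\<iota> (inverse s) \<in> ring_hull (range \<iota> \<union> \<phi> ` G)" using sup by blast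
      ultimately have "\<iota> (inverse s) * \<phi> a \<in> ring_hull (range \<iota> \<union> \<phi> ` G)" by (intro subring_mult[OF H])
      then show ?thesis using \<iota>_inv[OF as(1), of b] as(2) by simp
    qed
    then show ?thesis by blast
  qed
  obtain q where q: "prime_ideal_in UNIV q" "1 \<notin> q"
    "\<And>p. p \<in> polys_over (range \<phi>) \<Longrightarrow> lead_coeff p = 1 \<Longrightarrow> poly p \<alpha> \<notin> q"
    using prime_avoiding_integrality[OF R nint] by blast
  interpret prime_quotient q by unfold_locales (rule q)+
  define \<kappa> :: "'k \<Rightarrow> 'k big_field" where "\<kappa> c = to_big_field (Poly_Mapping.single 0 c)" for c
  have \<kappa>: "ring_hom_fun \<kappa>"
    unfolding ring_hom_fun_def \<kappa>_def
    by (simp add: to_big_field_hom(2,3)[symmetric] single_add mult_single to_big_field_hom(1))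
  have "\<exists>\<psi> :: 'b \<Rightarrow> 'k big_field. ring_hom_fun \<psi> \<and> (\<forall>c. \<psi> (\<iota> c) = \<kappa> c) \<and> (\<forall>b. \<psi> b = 0 \<longleftrightarrow> b \<in> q)"
  proof (rule residue_ring_embedding[OF \<iota> \<kappa> _ UN is_subring_image_vars_below _ _ _ transcendental_variable])
    show "finite (\<phi> ` G)" using G(1) by simp
    show "to_big_field ` vars_below n \<subseteq> to_big_field ` vars_below (Suc n)" for n by (auto simp: vars_below_def)
    show "range \<kappa> \<subseteq> to_big_field ` vars_below 0" by (auto simp: \<kappa>_def vars_below_def)
    show "to_big_field (variable n) \<in> to_big_field ` vars_below (Suc n)" for n
      by (auto simp: vars_below_def variable_def lookup_single when_def)
  qed
  then obtain \<psi> :: "'b \<Rightarrow> 'k big_field" where \<psi>: "ring_hom_fun \<psi>" and \<psi>\<iota>: "\<And>c. \<psi> (\<iota> c) = \<kappa> c"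
    and ker: "\<And>b. \<psi> b = 0 \<longleftrightarrow> b \<in> q" by blast
  note ps = ring_hom_fun_simps[OF \<psi>]
  interpret K: valued_embedding v \<kappa> \<pi>
    by unfold_locales (use v \<kappa> pi_pos pi_less in auto)
  obtain xs where xs: "set xs = \<psi> ` \<phi> ` G" using G(1) finite_list by (metis finite_imageI)
  define T where "T = K.alg_hull (set xs)"
  note T = K.alg_hull_subring[of "set xs", folded T_def]
  have T_eq: "T = \<psi> ` range \<phi>"
  proof
    have "K.\<O> \<subseteq> \<psi> ` range \<phi>"
    proof
      fix z assume "z \<in> K.\<O>"
      then obtain c where "z = \<kappa> c" "v c \<le> 1" by (auto simp: K.\<O>_def valring_def)
      then have "z = \<psi> (\<phi> (j c))" using compat \<psi>\<iota> by simp
      then show "z \<in> \<psi> ` range \<phi>" by blast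
    qed
    then show "T \<subseteq> \<psi> ` range \<phi>"
      unfolding T_def using xs by (intro K.alg_hull_minimal is_subring_image[OF \<psi> R]) auto
    have "is_subring (\<psi> -` T)"
      using T(1) unfolding is_subring_def by (auto simp: ps)
    moreover have "\<iota> ` valring v \<subseteq> \<psi> -` T" using \<psi>\<iota> T(2) by (auto simp: K.\<O>_def)
    moreover have "\<phi> ` G \<subseteq> \<psi> -` T" using T(3) xs by auto
    ultimately show "\<psi> ` range \<phi> \<subseteq> T" using gen[of "\<psi> -` T"] by auto
  qed
  \<comment> \<open>An integral equation of \<open>\<psi> \<alpha>\<close> lifts to a monic
    polynomial whose value at \<alpha> lies in the kernel \<open>q\<close>, and \<open>q\<close> was
    chosen to avoid such values.\<close>
  have nintT: "\<not> integral_over T (\<psi> \<alpha>)"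
  proof
    assume "integral_over T (\<psi> \<alpha>)"
    then obtain n c where c: "\<forall>i<n. c i \<in> T" and eq: "\<psi> \<alpha> ^ n + (\<Sum>i<n. c i * \<psi> \<alpha> ^ i) = 0"
      unfolding integral_over_def by blast
    have "\<exists>r. \<forall>i<n. r i \<in> range \<phi> \<and> c i = \<psi> (r i)" by (rule choice) (use c T_eq in blast)
    then obtain r where r: "\<forall>i<n. r i \<in> range \<phi>" "\<And>i. i < n \<Longrightarrow> c i = \<psi> (r i)" by blast
    obtain p where p: "p \<in> polys_over (range \<phi>)" "lead_coeff p = 1" "poly p \<alpha> = \<alpha> ^ n + (\<Sum>i<n. r i * \<alpha> ^ i)"
      using monic_poly_of_relation[OF R r(1)] by blast
    have "\<psi> (poly p \<alpha>) = 0" unfolding p(3) using eq r(2) by (simp add: ps)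
    then show False using ker q(3)[OF p(1,2)] by blast
  qed
  obtain F where F: "\<And>V. V \<in> F \<Longrightarrow> valuation_ring V \<and> T \<subseteq> V \<and> \<kappa> \<pi> \<in> max_ideal V"
    and F1: "\<And>b m. integral_over T (\<kappa> \<pi> ^ m * b) \<Longrightarrow> (\<And>V. V \<in> F \<Longrightarrow> b \<in> V) \<Longrightarrow> integral_over T b"
    and F2: "\<And>b m. integral_over T (\<kappa> \<pi> ^ m * b) \<Longrightarrow> K.uniformly_small F b \<and> K.uniformly_small F (inverse b)"
    using K.good_ring_finitely_generated[of xs] unfolding T_def[symmetric] K.good_ring_def by metis
  have "\<kappa> \<pi> ^ 1 * \<psi> \<alpha> = \<psi> (\<phi> a0)" using arg_cong[OF pi(3), of \<psi>] by (simp add: ps \<psi>\<iota>)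
  then have piT: "integral_over T (\<kappa> \<pi> ^ 1 * \<psi> \<alpha>)" using T_eq by (intro integral_over_mem[OF T(1)]) auto
  obtain V where VF: "V \<in> F" and aV: "\<psi> \<alpha> \<notin> V" using F1[OF piT] nintT by blast
  have V: "valuation_ring V" "T \<subseteq> V" "\<kappa> \<pi> \<in> max_ideal V" using F[OF VF] by auto
  have OV: "K.\<O> \<subseteq> V" using T(2) V(2) by blast
  have nz: "\<psi> \<alpha> \<noteq> 0" "inverse (\<psi> \<alpha>) \<in> max_ideal V" using aV not_in_iff[OF V(1)] by auto
  obtain M where M: "inverse (\<psi> \<alpha>) ^ M / \<kappa> \<pi> \<in> V"
    using F2[OF piT] VF nz(2) unfolding K.uniformly_small_def by blast
  \<comment> \<open>Each element of \<open>'b\<close> has a denominator in the ring of integers and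
    hence a power of \<pi> as denominator; for such elements the infimum defining the seminorm runs
    over a nonempty set.\<close>
  have loc: "\<psi> b \<in> localized V (\<kappa> \<pi>)" for b
  proof -
    obtain a s where as: "v s \<le> 1" "s \<noteq> 0" "\<iota> s * b = \<phi> a" using frac by blast
    have vs0: "v s > 0" using as(2) vs(6,7) by (metis order_le_less)
    obtain m where "v \<pi> ^ m < v s" using real_arch_pow_inv[OF vs0 pi_less] by blast
    then have "v (\<pi> ^ m / s) \<le> 1" using vs0 by (simp add: vs)
    then have "\<kappa> (\<pi> ^ m / s) \<in> V" using K.\<O>_I OV by blast
    moreover have "\<kappa> s * \<psi> b \<in> V"
    proof -
      have "\<kappa> s * \<psi> b = \<psi> (\<phi> a)" using arg_cong[OF as(3), of \<psi>] by (simp add: ps \<psi>\<iota>)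
      then show ?thesis using T_eq V(2) by auto
    qed
    ultimately have "\<kappa> (\<pi> ^ m / s) * (\<kappa> s * \<psi> b) \<in> V" by (rule vr_intros(3)[OF V(1)])
    moreover have "\<kappa> (\<pi> ^ m / s) * (\<kappa> s * \<psi> b) = \<kappa> \<pi> ^ m * \<psi> b"
      using as(2) by (simp add: K.e_divide K.e_power K.e_eq_0)
    ultimately show ?thesis unfolding localized_def by auto
  qed
  define x where "x b = K.vr_seminorm V (\<psi> b)" for b
  have "mult_seminorm x"
    unfolding mult_seminorm_def
  proof (intro conjI allI)
    show "x b \<ge> 0" for b unfolding x_def by (rule K.vr_seminorm_nonneg[OF V(1) OV V(3) loc])
    show "x 0 = 0" unfolding x_def using K.vr_seminorm_scalar[OF V(1) OV V(3), of 0] by (simp add: ps K.e_0 vs)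
    show "x (b + b') \<le> x b + x b'" "x (b * b') = x b * x b'" for b b' unfolding x_def ps
      by (rule K.vr_seminorm_add_le[OF V(1) OV V(3) loc loc], rule K.vr_seminorm_mult[OF V(1) OV V(3) loc loc])
  qed
  moreover have "x (\<iota> c) = v c" for c unfolding x_def \<psi>\<iota> by (rule K.vr_seminorm_scalar[OF V(1) OV V(3)])
  moreover have "x (\<phi> a) \<le> 1" for a
    unfolding x_def using T_eq V(2) by (intro K.vr_seminorm_le_one[OF V(1) OV V(3)]) auto
  ultimately have "x \<in> berk_an_model v \<iota> \<phi>" by (simp add: berk_an_model_def berk_an_def)
  moreover have "x \<alpha> > 1"
    unfolding x_def by (rule K.vr_seminorm_greater_one[OF V(1) OV V(3) loc nz(1) M])
  ultimately show ?thesis by blast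
qed

theorem theorem2p1:
  fixes v :: "'k::field \<Rightarrow> real"
    and j :: "'k \<Rightarrow> 'a::comm_ring_1"
    and \<iota> :: "'k \<Rightarrow> 'b::comm_ring_1"
    and \<phi> :: "'a \<Rightarrow> 'b"
  assumes "nonarch_abs v" and "complete_abs v"
    and "subring_embedding (valring v) j"
    and "fin_gen_alg (valring v) j"
    and "base_change_field (valring v) j \<iota> \<phi>"
  shows "{\<alpha>. integral_over (range \<phi>) \<alpha>} = (\<Inter>x\<in>berk_an_model v \<iota> \<phi>. {\<alpha>. x \<alpha> \<le> 1})"
proof (intro equalityI subsetI INT_I)
  have \<iota>: "ring_hom_fun \<iota>" and \<phi>: "ring_hom_fun \<phi>" using assms(5) by (auto simp: base_change_field_def)
  have R: "is_subring (range \<phi>)" by (rule is_subring_image[OF \<phi> is_subring_UNIV])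
  fix \<alpha> x assume \<alpha>: "\<alpha> \<in> {\<alpha>. integral_over (range \<phi>) \<alpha>}" and x: "x \<in> berk_an_model v \<iota> \<phi>"
  \<comment> \<open>The value at 1 is not prescribed by \<open>mult_seminorm\<close>; it comes from
    \<open>x\<close> extending \<open>v\<close>.\<close>
  have "x (\<iota> 1) = v 1" using x by (simp add: berk_an_model_def berk_an_def)
  then have "x 1 = 1" using ring_hom_fun_simps(1)[OF \<iota>] nonarch_abs_simps(2)[OF assms(1)] by simp
  then have "x \<alpha> \<le> 1"
    using integral_seminorm_le_one[of x "range \<phi>" \<alpha>] R \<alpha> x by (auto simp: berk_an_model_def berk_an_def)
  then show "\<alpha> \<in> {\<alpha>. x \<alpha> \<le> 1}" by simp
next
  fix \<alpha> assume "\<alpha> \<in> (\<Inter>x\<in>berk_an_model v \<iota> \<phi>. {\<alpha>. x \<alpha> \<le> 1})"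
  then have "\<forall>x\<in>berk_an_model v \<iota> \<phi>. \<not> x \<alpha> > 1" by force
  then have "integral_over (range \<phi>) \<alpha>" using exists_seminorm_greater_one[OF assms(1,4,5)] by blast
  then show "\<alpha> \<in> {\<alpha>. integral_over (range \<phi>) \<alpha>}" by simp
qed

end
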